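(* Let $\kappa\ge3$ and let $K$ be a convex polygon in $\mathbb R^2$ with non-empty interior and exactly $\kappa$ sides. Let $m\in\{3,\dots,\kappa\}$ be the number of sides of $K$ to which $\mathsf{Dom}(K)$ is tangent. Then there exists a unique convex polygon $K_{\mathcal T}\supset K$ such that (1) $K_{\mathcal T}$ has exactly $m$ sides and $\mathsf{Dom}(K_{\mathcal T})$ is tangent to all $m$ sides of $K_{\mathcal T}$; (2) $\mathsf{Dom}(K)=\mathsf{Dom}(K_{\mathcal T})$.
   Context: Affine perimeter. For a compact convex set $S\subset\mathbb R^2$ with non-empty interior, take a subdivision $x_1,\dots,x_m,x_{m+1}=x_1$ of $\partial S$ (in cyclic order), let $d_i$ be a line supporting $S$ at $x_i$, let $y_i=d_i\cap d_{i+1}$ (any point between $x_i$ and $x_{i+1}$ if $d_i=d_{i+1}$), and let $T(x_i,y_i,x_{i+1})$ be the area of the triangle $x_i,y_i,x_{i+1}$. Then $\mathrm{AP}(S)=2\lim\sum_{i=1}^m \sqrt[3]{T(x_i,y_i,x_{i+1})}$, the limit being over sequences of subdivisions with $m\to\infty$ and $\max_i|x_i-x_{i+1}|\to0$. Limit shape. For a compact convex set $K$ with non-empty interior, $\mathrm{AP}^*(K)=\max\{\mathrm{AP}(S): S\subset K \text{ convex}\}$, and $\mathsf{Dom}(K)$ is the unique convex subset of $K$ with $\mathrm{AP}(\mathsf{Dom}(K))=\mathrm{AP}^*(K)$ (existence and uniqueness are a known theorem of Bárány; for a polygon $K$ the boundary of $\mathsf{Dom}(K)$ consists of finitely many parabola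 arcs and contains no line segment). $\mathsf{Dom}(K)$ is said to be tangent to a side of $K$ if its boundary touches that side. The number of sides of a polygon $K$ to which $\mathsf{Dom}(K)$ is tangent is always at least $3$. *)

theory Defs
  imports "HOL-Analysis.Analysis"
begin

type_synonym plane = "real ^ 2"

definition convex_body :: "plane set \<Rightarrow> bool" where
  "convex_body S \<longleftrightarrow> compact S \<and> convex S \<and> interior S \<noteq> {}"


text \<open>
  Cyclic order on the boundary is expressed through a simple closed parametrisation \<open>loop\<close> of
  \<open>frontier S\<close> starting at the first point: the subdivision points are \<open>loop (t i)\<close> for parameters
  \<open>0 = t 0 < \<dots> < t m = 1\<close>, so that the points with indices \<open>0\<close> and \<open>m\<close> coincide.  Either
  orientation is allowed.  For \<open>i < m\<close>, \<open>apex i\<close> is the third vertex of the \<open>i\<close>-th triangle.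
\<close>

record subdivision =
  loop :: "real \<Rightarrow> plane"
  size_of :: nat
  param :: "nat \<Rightarrow> real"
  tangent :: "nat \<Rightarrow> plane set"
  apex :: "nat \<Rightarrow> plane"

definition point :: "subdivision \<Rightarrow> nat \<Rightarrow> plane" where
  "point P i = loop P (param P i)"

definition supporting_line :: "plane set \<Rightarrow> plane \<Rightarrow> plane set \<Rightarrow> bool" where
  "supporting_line S x d \<longleftrightarrow>
     x \<in> S \<and> (\<exists>a. a \<noteq> 0 \<and> d = {p. a \<bullet> p = a \<bullet> x} \<and> (\<forall>p\<in>S. a \<bullet> p \<le> a \<bullet> x))"

definition subdivision_of :: "plane set \<Rightarrow> subdivision \<Rightarrow> bool" where
  "subdivision_of S P \<longleftrightarrow>
     simple_path (loop P) \<and> pathfinish (loop P) = pathstart (loop P) \<and>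
     path_image (loop P) = frontier S \<and>
     0 < size_of P \<and> param P 0 = 0 \<and> param P (size_of P) = 1 \<and>
     (\<forall>i<size_of P. param P i < param P (Suc i)) \<and>
     (\<forall>i\<le>size_of P. supporting_line S (point P i) (tangent P i)) \<and>
     tangent P (size_of P) = tangent P 0 \<and>
     (\<forall>i<size_of P.
        if tangent P i = tangent P (Suc i)
        then apex P i \<in> closed_segment (point P i) (point P (Suc i))
        else tangent P i \<inter> tangent P (Suc i) = {apex P i})"

text \<open>
  The mesh is measured by the diameters of the boundary arcs between consecutive points rather than
  by the chords \<open>dist (point P i) (point P (Suc i))\<close>.  Small chords alone do not exclude that all
  points cluster on one short arc, with the remaining arc almost the whole boundary; along such
  subdivisions the sums below tend to \<open>0\<close>.
\<close>

definition mesh :: "subdivision \<Rightarrow> real" where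
  "mesh P = Max ((\<lambda>i. diameter (loop P ` {param P i..param P (Suc i)})) ` {..<size_of P})"

definition triangle_area :: "plane \<Rightarrow> plane \<Rightarrow> plane \<Rightarrow> real" where
  "triangle_area x y z = measure lebesgue (convex hull {x, y, z})"

definition triangle_sum :: "subdivision \<Rightarrow> real" where
  "triangle_sum P =
     (\<Sum>i<size_of P. root 3 (triangle_area (point P i) (apex P i) (point P (Suc i))))"

definition affine_perimeter :: "plane set \<Rightarrow> real" where
  "affine_perimeter S = 2 * (THE L. \<forall>P :: nat \<Rightarrow> subdivision.
     (\<forall>n. subdivision_of S (P n)) \<longrightarrow>
     filterlim (\<lambda>n. size_of (P n)) at_top sequentially \<longrightarrow>
     (\<lambda>n. mesh (P n)) \<longlonglongrightarrow> 0 \<longrightarrow>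
     (\<lambda>n. triangle_sum (P n)) \<longlonglongrightarrow> L)"

definition max_affine_perimeter :: "plane set \<Rightarrow> real" where
  "max_affine_perimeter K =
     (GREATEST a. \<exists>S. convex_body S \<and> S \<subseteq> K \<and> a = affine_perimeter S)"

definition Dom :: "plane set \<Rightarrow> plane set" where
  "Dom K = (THE S. convex_body S \<and> S \<subseteq> K \<and> affine_perimeter S = max_affine_perimeter K)"


definition convex_polygon :: "plane set \<Rightarrow> bool" where
  "convex_polygon K \<longleftrightarrow> polytope K \<and> interior K \<noteq> {}"

definition sides :: "plane set \<Rightarrow> plane set set" where
  "sides K = {F. F edge_of K}"

definition Dom_tangent_to :: "plane set \<Rightarrow> plane set \<Rightarrow> bool" where
  "Dom_tangent_to K F \<longleftrightarrow> frontier (Dom K) \<inter> F \<noteq> {}"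

end

theory Submission
  imports Defs
begin

text \<open>
  If \<open>x\<close>, \<open>x'\<close> are boundary points of \<open>S\<close> with outer unit normals \<open>n\<close>, \<open>n'\<close> at an angle \<open>s < \<pi>\<close>, the
  triangle cut out by the chord and the two tangents has area
  \<open>(n' \<bullet> (x' - x)) (n \<bullet> (x - x')) / (2 sin s)\<close>. By AM-GM its cube root is superadditive when a further
  tangent is inserted, so half the affine perimeter is the infimum of these sums over all closed
  chains of contact elements.

  Fix finitely many normals, among them those of a polygon \<open>K\<close>. The sum of cube roots is a concave
  function \<open>Phi\<close> of the contact points; it bounds half the affine perimeter of every body with these
  contact points, with equality for the body whose arcs are the parabolas inscribed in the
  triangles. The maximiser of \<open>Phi\<close> over \<open>K\<close> is nondegenerate and unique, and the equality case of
  AM-GM forces the body, so the limit shape is the parabola body of the maximiser. By concavity the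
  maximiser stays maximal when only the touched sides are kept as constraints: the polygon cut out
  by the touched sides has the same limit shape. Nondegeneracy keeps the limit shape away from the
  vertices of \<open>K\<close>, hence every side of a polygon around \<open>K\<close> that touches the limit shape lies on a
  touched side of \<open>K\<close>, which gives uniqueness.
\<close>

section \<open>Plane vectors and cube root inequalities\<close>

text \<open>The affine perimeter and the limit shape are definite descriptions, so convergence of
  the triangle sums and existence and uniqueness of the maximiser have to be established before
  either denotes anything. The two bounds involved have different sources. An infimum is bounded
  above by any single chain, so finitely many normals reduce the maximisation over bodies to one
  over finitely many points, where compactness and concavity suffice. No chain gives a lower bound;
  it comes from parabolas: a further tangent of the inscribed parabola cuts the triangle with
  equality in AM-GM, so refining a chain along parabola arcs loses nothing and the bound is
  attained. Two obstacles shape the finite problem. Strict concavity of a cell sees only its two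
  gaps, hence the configuration up to a translation, and it is strict only where the triangles have
  positive area. Degenerate triangles are excluded by the infinite slope of the cube root at 0,
  translations by a separate comparison of configurations.\<close>

lemma inner_plane: "x \<bullet> y = x $ 1 * y $ 1 + x $ 2 * y $ 2" for x y :: plane
  by (simp add: inner_vec_def sum_2)

lemma plane_eqI: "x = y" if "x $ 1 = y $ 1" "x $ 2 = y $ 2" for x y :: plane
  using that by (simp add: vec_eq_iff forall_2)

definition uvec :: "real \<Rightarrow> plane" where
  "uvec t = vector [cos t, sin t]"

lemma uvec_nth [simp]: "uvec t $ 1 = cos t" "uvec t $ 2 = sin t"
  by (simp_all add: uvec_def)

lemma inner_uvec_uvec: "uvec a \<bullet> uvec b = cos (a - b)"
  by (simp add: inner_plane cos_diff)

lemma norm_uvec [simp]: "norm (uvec t) = 1"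
  by (simp add: norm_eq_sqrt_inner inner_uvec_uvec)

lemma uvec_nonzero [simp]: "uvec t \<noteq> 0"
  using norm_uvec[of t] by force

lemma uvec_periodic [simp]: "uvec (t + 2 * pi) = uvec t"
  by (rule plane_eqI) simp_all

lemma uvec_periodic_int [simp]: "uvec (t + 2 * pi * of_int k) = uvec t"
  by (rule plane_eqI)
     (simp_all add: cos_add sin_add sin_int_2pin cos_int_2pin)

lemma uvec_add_pi: "uvec (t + pi) = - uvec t"
  by (rule plane_eqI) simp_all

text \<open>Three vectors in the plane are linearly dependent; for unit vectors the coefficients are
  sines of the angles between the other two. No range of the angles is assumed, so the identity
  serves inside and outside the cone of \<open>a\<close> and \<open>c\<close>.\<close>

lemma uvec_decomp:
  "sin (c - a) *\<^sub>R uvec b = sin (c - b) *\<^sub>R uvec a + sin (b - a) *\<^sub>R uvec c"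
proof (rule plane_eqI)
  show "(sin (c - a) *\<^sub>R uvec b) $ 1 = (sin (c - b) *\<^sub>R uvec a + sin (b - a) *\<^sub>R uvec c) $ 1"
    by (simp add: sin_diff) (simp add: algebra_simps)
  show "(sin (c - a) *\<^sub>R uvec b) $ 2 = (sin (c - b) *\<^sub>R uvec a + sin (b - a) *\<^sub>R uvec c) $ 2"
    by (simp add: sin_diff) (simp add: algebra_simps)
qed

lemma inner_uvec_perp [simp]: "uvec t \<bullet> uvec (s + pi / 2) = sin (t - s)"
  by (simp add: inner_uvec_uvec cos_diff sin_diff cos_add sin_add algebra_simps)

lemma uvec_rotate: "uvec t = cos (t - s) *\<^sub>R uvec s + sin (t - s) *\<^sub>R uvec (s + pi / 2)"
  using uvec_decomp[of "s + pi/2" s t] by (simp add: sin_diff cos_diff sin_add cos_add algebra_simps)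

lemma uvec_parallel:
  assumes "sin (t - s) = 0" shows "uvec t = uvec s \<or> uvec t = - uvec s"
proof -
  have "cos (t - s) = 1 \<or> cos (t - s) = -1" using assms sin_zero_abs_cos_one by fastforce
  then show ?thesis using uvec_rotate[of t s] assms by auto
qed

lemma inner_uvec_decomp:
  "sin (c - a) * (uvec b \<bullet> x) = sin (c - b) * (uvec a \<bullet> x) + sin (b - a) * (uvec c \<bullet> x)"
  using arg_cong[OF uvec_decomp[of c a b], of "\<lambda>v. v \<bullet> x"] by (simp add: inner_add_left)

lemma uvec_inner_eqI:
  assumes "sin (b - a) \<noteq> 0" "uvec a \<bullet> x = uvec a \<bullet> y" "uvec b \<bullet> x = uvec b \<bullet> y"
  shows "x = y"
proof (rule plane_eqI)
  have *: "sin (b - a) * (uvec c \<bullet> x) = sin (b - a) * (uvec c \<bullet> y)" for c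
    using inner_uvec_decomp[of b a c x] inner_uvec_decomp[of b a c y] assms by simp
  show "x $ 1 = y $ 1" using *[of 0] assms(1) by (simp add: inner_plane)
  show "x $ 2 = y $ 2" using *[of "pi/2"] assms(1) by (simp add: inner_plane)
qed

lemma polar_plane:
  fixes v :: plane
  obtains t where "0 \<le> t" "t < 2 * pi" "v = norm v *\<^sub>R uvec t"
proof (cases "v = 0")
  case True
  then show ?thesis using that[of 0] by simp
next
  case False
  have n: "norm v ^ 2 = v $ 1 ^ 2 + v $ 2 ^ 2"
    by (simp only: power2_norm_eq_inner inner_plane) (simp add: power2_eq_square)
  have "(v $ 1 / norm v)\<^sup>2 + (v $ 2 / norm v)\<^sup>2 = 1"
    using False by (simp add: power_divide flip: add_divide_distrib n)
  then obtain t where t: "0 \<le> t" "t < 2*pi" "v $ 1 / norm v = cos t" "v $ 2 / norm v = sin t"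
    by (rule sincos_total_2pi)
  have "v = norm v *\<^sub>R uvec t"
    using t(3,4) False by (intro plane_eqI) (simp_all add: field_simps)
  then show ?thesis using that t by blast
qed

lemma root3_prod_le_mean:
  fixes a b c :: real
  assumes "a \<ge> 0" "b \<ge> 0" "c \<ge> 0"
  shows "root 3 (a * b * c) \<le> (a + b + c) / 3"
    and "root 3 (a * b * c) = (a + b + c) / 3 \<Longrightarrow> a = b \<and> b = c"
proof -
  define x y z where "x = root 3 a" "y = root 3 b" "z = root 3 c"
  have nn: "x \<ge> 0" "y \<ge> 0" "z \<ge> 0" using assms by (simp_all add: x_y_z_def)
  have p: "a = x ^ 3" "b = y ^ 3" "c = z ^ 3"
    using assms by (simp_all add: x_y_z_def)
  have id: "x ^ 3 + y ^ 3 + z ^ 3 - 3 * (x * y * z)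
      = (x + y + z) * ((x - y)\<^sup>2 + (y - z)\<^sup>2 + (x - z)\<^sup>2) / 2"
    by (simp add: power2_eq_square power3_eq_cube field_simps)
  have r: "root 3 (a * b * c) = x * y * z"
    by (simp add: x_y_z_def real_root_mult)
  have "0 \<le> (x + y + z) * ((x - y)\<^sup>2 + (y - z)\<^sup>2 + (x - z)\<^sup>2) / 2" using nn by simp
  then show "root 3 (a * b * c) \<le> (a + b + c) / 3" using id r p by simp
  assume "root 3 (a * b * c) = (a + b + c) / 3"
  then have "3 * (x * y * z) = x ^ 3 + y ^ 3 + z ^ 3" using r p by simp
  then have "(x + y + z) * ((x - y)\<^sup>2 + (y - z)\<^sup>2 + (x - z)\<^sup>2) / 2 = 0"
    unfolding id[symmetric] by linarith
  then have "(x + y + z) * ((x - y)\<^sup>2 + (y - z)\<^sup>2 + (x - z)\<^sup>2) = 0" by linarith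
  then consider "x + y + z = 0" | "(x - y)\<^sup>2 + (y - z)\<^sup>2 + (x - z)\<^sup>2 = 0" by auto
  then have "x = y \<and> y = z"
  proof cases
    case 1 then show ?thesis using nn by linarith
  next
    case 2
    then have "(x - y)\<^sup>2 = 0" "(y - z)\<^sup>2 = 0"
      using zero_le_power2[of "x - y"] zero_le_power2[of "y - z"] zero_le_power2[of "x - z"]
      by linarith+
    then show ?thesis by simp
  qed
  then show "a = b \<and> b = c" using p by simp
qed

text \<open>
  A line cutting two sides of a triangle in the ratios \<open>l\<close> and \<open>m\<close>, with a marked point at ratio
  \<open>n\<close> on the cut, leaves corner triangles of relative areas \<open>l m n\<close> and \<open>(1-l)(1-m)(1-n)\<close>.
\<close>

lemma root3_split_le_one:
  fixes l m n :: real
  assumes "l \<in> {0..1}" "m \<in> {0..1}" "n \<in> {0..1}"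
  shows "root 3 (l * m * n) + root 3 ((1-l) * (1-m) * (1-n)) \<le> 1"
    and "root 3 (l * m * n) + root 3 ((1-l) * (1-m) * (1-n)) = 1 \<Longrightarrow> l = m \<and> m = n"
proof -
  have *: "root 3 (l * m * n) \<le> (l + m + n) / 3"
     "root 3 ((1-l) * (1-m) * (1-n)) \<le> ((1-l) + (1-m) + (1-n)) / 3"
    by (rule root3_prod_le_mean(1); use assms in simp)+
  have sum1: "(l + m + n) / 3 + ((1-l) + (1-m) + (1-n)) / 3 = 1" by (simp add: field_simps)
  show "root 3 (l * m * n) + root 3 ((1-l) * (1-m) * (1-n)) \<le> 1" using * sum1 by linarith
  assume "root 3 (l * m * n) + root 3 ((1-l) * (1-m) * (1-n)) = 1"
  then have "root 3 (l * m * n) = (l + m + n) / 3" using * sum1 by linarith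
  then show "l = m \<and> m = n" using root3_prod_le_mean(2)[of l m n] assms by simp
qed

text \<open>The numbers \<open>a\<close> and \<open>b\<close> with indices \<open>i\<close>,
  \<open>j\<close> are the lengths of the tangent segments from the contact points \<open>i\<close>
  and \<open>j\<close> to the apex of their tangents. The middle tangent cuts a small triangle off
  at the outer apex; by the law of sines its sides are \<open>k * s23\<close>,
  \<open>k * s12\<close> and \<open>k * s13\<close>. With \<open>l\<close>, \<open>m\<close>,
  \<open>n\<close> as the ratios on its three sides the claim becomes
  \<open>root3_split_le_one\<close>. In the case of equality \<open>l = m\<close> already determines
  \<open>k\<close>, and with it the position of the middle tangent.\<close>

lemma root3_cut_triangle:
  fixes a12 a13 a23 b12 b13 b23 s12 s13 s23 k :: real
  assumes s: "s12 > 0" "s23 > 0" "s13 > 0"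
    and nn: "a12 \<ge> 0" "b12 \<ge> 0" "a23 \<ge> 0" "b23 \<ge> 0" "a13 \<ge> 0" "b13 \<ge> 0"
    and a: "a12 = a13 - k * s23" and b: "b23 = b13 - k * s12" and k: "b12 + a23 = k * s13"
  shows "root 3 (a12 * b12 * s12) + root 3 (a23 * b23 * s23) \<le> root 3 (a13 * b13 * s13)"
    and "root 3 (a12 * b12 * s12) + root 3 (a23 * b23 * s23) = root 3 (a13 * b13 * s13)
         \<Longrightarrow> a13 > 0 \<Longrightarrow> b13 > 0 \<Longrightarrow> k = a13 * b13 / (s23 * b13 + s12 * a13)"
proof -
  have k0: "k \<ge> 0" using k nn s by (smt (verit) mult_neg_pos)
  have main: "root 3 (a12 * b12 * s12) + root 3 (a23 * b23 * s23) \<le> root 3 (a13 * b13 * s13) \<and>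
     (root 3 (a12 * b12 * s12) + root 3 (a23 * b23 * s23) = root 3 (a13 * b13 * s13) \<longrightarrow>
       k = a13 * b13 / (s23 * b13 + s12 * a13))"
    if pos: "a13 > 0" "b13 > 0" "k > 0"
  proof -
    define l m n where "l = a12 / a13" "m = k * s12 / b13" "n = b12 / (k * s13)"
    have l1: "1 - l = k * s23 / a13" using pos by (simp add: l_m_n_def a field_simps)
    have m1: "1 - m = b23 / b13" using pos by (simp add: l_m_n_def b field_simps)
    have n1: "1 - n = a23 / (k * s13)"
    proof -
      have "a23 = k * s13 - b12" using k by simp
      then show ?thesis using pos s by (simp add: l_m_n_def diff_divide_distrib)
    qed
    have "l \<ge> 0" "m \<ge> 0" "n \<ge> 0" using pos s nn by (simp_all add: l_m_n_def)
    moreover have "1 - l \<ge> 0" "1 - m \<ge> 0" "1 - n \<ge> 0" unfolding l1 m1 n1 using pos s nn by simp_all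
    ultimately have r: "l \<in> {0..1}" "m \<in> {0..1}" "n \<in> {0..1}" by simp_all
    have e1: "a12 * b12 * s12 = (l * m * n) * (a13 * b13 * s13)"
      using pos s by (simp add: l_m_n_def field_simps)
    have e2: "a23 * b23 * s23 = ((1-l) * (1-m) * (1-n)) * (a13 * b13 * s13)"
      unfolding l1 m1 n1 using pos s by (simp add: field_simps)
    have P: "root 3 (a13 * b13 * s13) > 0" using pos s by simp
    have eq: "root 3 (a12 * b12 * s12) + root 3 (a23 * b23 * s23)
        = (root 3 (l * m * n) + root 3 ((1-l) * (1-m) * (1-n))) * root 3 (a13 * b13 * s13)"
      unfolding e1 e2 real_root_mult[of _ _ "a13 * b13 * s13"] by (simp only: distrib_right)
    have "k = a13 * b13 / (s23 * b13 + s12 * a13)" if "l = m"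
    proof -
      have "1 = k * s12 / b13 + k * s23 / a13" using that l1 by (simp add: l_m_n_def)
      then have "k * (s23 * b13 + s12 * a13) = a13 * b13" using pos by (simp add: field_simps)
      moreover have "s23 * b13 + s12 * a13 > 0" using pos s by (simp add: add_pos_pos)
      ultimately show ?thesis by (simp add: field_simps)
    qed
    then show ?thesis unfolding eq
      using root3_split_le_one[OF r] P
      by (smt (verit, best) mult_cancel_right1 mult_right_le_one_le mult_le_cancel_right1)
  qed
  show "root 3 (a12 * b12 * s12) + root 3 (a23 * b23 * s23) \<le> root 3 (a13 * b13 * s13)"
  proof (cases "a13 > 0 \<and> b13 > 0 \<and> k > 0")
    case True then show ?thesis using main by blast
  next
    case False
    then consider "k = 0" | "a13 = 0" | "b13 = 0" using nn k0 by linarith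
    \<comment> \<open>If a side of the outer triangle has length 0, there is no room for a cut, so
      both small triangles vanish.\<close>
    then have "k = 0"
    proof cases
      case 2 then show ?thesis using nn a s k0 by (smt (verit) mult_pos_pos)
    next
      case 3 then show ?thesis using nn b s k0 by (smt (verit) mult_pos_pos)
    qed simp
    then have "b12 = 0" "a23 = 0" using k nn by auto
    then show ?thesis using nn s by simp
  qed
  assume eq: "root 3 (a12 * b12 * s12) + root 3 (a23 * b23 * s23) = root 3 (a13 * b13 * s13)"
    and pos: "a13 > 0" "b13 > 0"
  show "k = a13 * b13 / (s23 * b13 + s12 * a13)"
  proof (cases "k > 0")
    case True then show ?thesis using main pos eq by blast
  next
    case False
    then have "b12 = 0" "a23 = 0" using k k0 nn by auto
    then have "root 3 (a13 * b13 * s13) = 0" using eq by simp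
    then show ?thesis using pos s by simp
  qed
qed

text \<open>After division by \<open>P\<close> and \<open>Q\<close>, AM-GM with a third factor 1
  bounds both cube roots by means whose weighted average is exactly 1. The factor 1 makes the
  concavity strict also along rays: equality forces \<open>p / P = q / Q = 1\<close>, not just
  proportionality.\<close>

lemma root3_mult_concave:
  fixes p q p' q' t :: real
  assumes nn: "p \<ge> 0" "q \<ge> 0" "p' \<ge> 0" "q' \<ge> 0" and t: "0 < t" "t < 1"
  defines "P \<equiv> (1 - t) * p + t * p'" and "Q \<equiv> (1 - t) * q + t * q'"
  shows "(1 - t) * root 3 (p * q) + t * root 3 (p' * q') \<le> root 3 (P * Q)"
    and "(1 - t) * root 3 (p * q) + t * root 3 (p' * q') = root 3 (P * Q) \<Longrightarrow> P > 0 \<Longrightarrow> Q > 0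
         \<Longrightarrow> p = p' \<and> q = q'"
proof -
  have main: "(1 - t) * root 3 (p * q) + t * root 3 (p' * q') \<le> root 3 (P * Q) \<and>
    ((1 - t) * root 3 (p * q) + t * root 3 (p' * q') = root 3 (P * Q) \<longrightarrow> p = p' \<and> q = q')"
    if pos: "P > 0" "Q > 0"
  proof -
    have R: "root 3 (P * Q) > 0" using pos by simp
    have e: "root 3 (p * q) = root 3 (p / P * (q / Q) * 1) * root 3 (P * Q)"
       "root 3 (p' * q') = root 3 (p' / P * (q' / Q) * 1) * root 3 (P * Q)"
      using pos by (simp_all flip: real_root_mult)
    have a1: "root 3 (p / P * (q / Q) * 1) \<le> (p / P + q / Q + 1) / 3"
      "root 3 (p' / P * (q' / Q) * 1) \<le> (p' / P + q' / Q + 1) / 3"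
      by (rule root3_prod_le_mean(1); use nn pos in simp)+
    have "(1 - t) * p / P + t * p' / P = 1" "(1 - t) * q / Q + t * q' / Q = 1"
      using pos by (simp_all add: P_def Q_def flip: add_divide_distrib)
    then have s: "(1 - t) * ((p / P + q / Q + 1) / 3) + t * ((p' / P + q' / Q + 1) / 3) = 1"
      by argo
    have b1: "(1 - t) * root 3 (p / P * (q / Q) * 1) \<le> (1 - t) * ((p / P + q / Q + 1) / 3)"
       "t * root 3 (p' / P * (q' / Q) * 1) \<le> t * ((p' / P + q' / Q + 1) / 3)"
      by (rule mult_left_mono; use a1 t in simp)+
    define X where "X = (1 - t) * root 3 (p / P * (q / Q) * 1) + t * root 3 (p' / P * (q' / Q) * 1)"
    have X1: "X \<le> 1" using b1 s unfolding X_def by linarith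
    have eq: "(1 - t) * root 3 (p * q) + t * root 3 (p' * q') = X * root 3 (P * Q)"
      unfolding X_def e by (simp add: algebra_simps)
    have "p = p' \<and> q = q'" if "X = 1"
    proof -
      have "(1 - t) * root 3 (p / P * (q / Q) * 1) = (1 - t) * ((p / P + q / Q + 1) / 3)"
         "t * root 3 (p' / P * (q' / Q) * 1) = t * ((p' / P + q' / Q + 1) / 3)"
        using b1 s that unfolding X_def by linarith+
      then have "root 3 (p / P * (q / Q) * 1) = (p / P + q / Q + 1) / 3"
        "root 3 (p' / P * (q' / Q) * 1) = (p' / P + q' / Q + 1) / 3"
        using t by simp_all
      then have "p / P = q / Q \<and> q / Q = 1" "p' / P = q' / Q \<and> q' / Q = 1"
        using root3_prod_le_mean(2)[of "p/P" "q/Q" 1] root3_prod_le_mean(2)[of "p'/P" "q'/Q" 1]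
          nn pos by simp_all
      then show ?thesis using pos by (metis divide_eq_1_iff)
    qed
    then show ?thesis unfolding eq using X1 R
      by (smt (verit, best) mult_cancel_right1 mult_le_cancel_right1)
  qed
  show "(1 - t) * root 3 (p * q) + t * root 3 (p' * q') = root 3 (P * Q) \<Longrightarrow> P > 0 \<Longrightarrow> Q > 0
         \<Longrightarrow> p = p' \<and> q = q'" using main by blast
  have PQ: "P \<ge> 0" "Q \<ge> 0" using nn t by (simp_all add: P_def Q_def)
  show "(1 - t) * root 3 (p * q) + t * root 3 (p' * q') \<le> root 3 (P * Q)"
  proof (cases "P > 0 \<and> Q > 0")
    case True then show ?thesis using main by blast
  next
    case False
    have "p * q = 0 \<and> p' * q' = 0"
    proof (cases "P = 0")
      case True
      then have "(1 - t) * p = 0" "t * p' = 0" using nn t unfolding P_def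
        by (smt (verit) mult_nonneg_nonneg)+
      then show ?thesis using t by simp
    next
      case False
      then have "Q = 0" using \<open>\<not> (P > 0 \<and> Q > 0)\<close> PQ by linarith
      then have "(1 - t) * q = 0" "t * q' = 0" using nn t unfolding Q_def
        by (smt (verit) mult_nonneg_nonneg)+
      then show ?thesis using t by simp
    qed
    then have "p * q = 0" "p' * q' = 0" by blast+
    then show ?thesis using PQ by (simp only: real_root_zero) simp
  qed
qed

section \<open>Contact elements and chains\<close>

text \<open>
  The normals of a contact element are given by real angles rather than unit vectors, so that
  contact elements can be followed around the boundary more than once.
\<close>

definition contact :: "plane set \<Rightarrow> real \<times> plane \<Rightarrow> bool" where
  "contact S e \<longleftrightarrow> snd e \<in> S \<and> (\<forall>q\<in>S. uvec (fst e) \<bullet> q \<le> uvec (fst e) \<bullet> snd e)"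

text \<open>For contact elements of one body, the distance from the point of \<open>e\<close> to the
  tangent at \<open>f\<close>. Divided by the sine of the angle between the normals, it is the
  length of the tangent segment from \<open>e\<close> to the apex.\<close>

definition gap :: "real \<times> plane \<Rightarrow> real \<times> plane \<Rightarrow> real" where
  "gap e f = uvec (fst f) \<bullet> (snd f - snd e)"

text \<open>
  The cube root of the area of the triangle cut out by the tangents at \<open>e\<close> and \<open>f\<close>; it is \<open>0\<close> when
  the two tangents have the same direction, because then the denominator vanishes.
\<close>

definition cell :: "real \<times> plane \<Rightarrow> real \<times> plane \<Rightarrow> real" where
  "cell e f = root 3 (gap e f * gap f e / (2 * sin (fst f - fst e)))"

text \<open>Counterclockwise order along the boundary. On a line segment of the boundary the normal
  stays constant, so ties are broken by the position along the tangent.\<close>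

definition cle :: "real \<times> plane \<Rightarrow> real \<times> plane \<Rightarrow> bool" where
  "cle e f \<longleftrightarrow> fst e < fst f \<or>
     fst e = fst f \<and> uvec (fst e + pi / 2) \<bullet> snd e \<le> uvec (fst e + pi / 2) \<bullet> snd f"

text \<open>An angle below \<open>pi\<close> keeps the sine in \<open>cell\<close> nonnegative and
  lets two non-parallel tangents meet on the outer side of the chord.\<close>

definition cstep :: "real \<times> plane \<Rightarrow> real \<times> plane \<Rightarrow> bool" where
  "cstep e f \<longleftrightarrow> cle e f \<and> fst f - fst e < pi"

lemma cle_trans: "cle e f \<Longrightarrow> cle f g \<Longrightarrow> cle e g"
  by (auto simp: cle_def)

lemma cle_total: "cle e f \<or> cle f e"
  unfolding cle_def by (cases "fst e = fst f") (simp_all, linarith+)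

lemma cle_refl [simp]: "cle e e"
  by (simp add: cle_def)

lemma cle_fst: "cle e f \<Longrightarrow> fst e \<le> fst f"
  by (auto simp: cle_def)

lemma contact_gap_nonneg: "contact S e \<Longrightarrow> contact S f \<Longrightarrow> gap e f \<ge> 0"
  by (simp add: contact_def gap_def inner_diff_right)

lemma contact_exists:
  assumes "compact S" "S \<noteq> {}"
  obtains x where "contact S (t, x)"
proof -
  have "continuous_on S (\<lambda>q. uvec t \<bullet> q)" by (intro continuous_intros)
  from continuous_attains_sup[OF assms this] show ?thesis
    using that by (auto simp: contact_def)
qed

lemma cell_nonneg:
  assumes "gap e f \<ge> 0" "gap f e \<ge> 0" "cstep e f"
  shows "cell e f \<ge> 0"
proof -
  have "sin (fst f - fst e) \<ge> 0"
    using assms(3) cle_fst[of e f] by (intro sin_ge_zero) (auto simp: cstep_def)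
  then show ?thesis using assms(1,2) by (simp add: cell_def)
qed

lemma contact_cell_nonneg: "contact S e \<Longrightarrow> contact S f \<Longrightarrow> cstep e f \<Longrightarrow> cell e f \<ge> 0"
  by (intro cell_nonneg contact_gap_nonneg)

lemma cell_eq_0: "fst e = fst f \<Longrightarrow> cell e f = 0"
  by (simp add: cell_def)

lemma gap_relations:
  fixes e1 e2 e3 :: "real \<times> plane"
  assumes "sin (fst e3 - fst e1) = s13" "sin (fst e2 - fst e1) = s12" "sin (fst e3 - fst e2) = s23"
  shows "s13 * gap e1 e2 = s12 * (gap e1 e3 - gap e2 e3) - s23 * gap e2 e1"
    and "s13 * gap e3 e2 = s23 * (gap e3 e1 - gap e2 e1) - s12 * gap e2 e3"
  using inner_uvec_decomp[of "fst e3" "fst e1" "fst e2" "snd e2 - snd e1"]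
    inner_uvec_decomp[of "fst e3" "fst e1" "fst e2" "snd e2 - snd e3"]
  unfolding assms by (simp_all add: gap_def algebra_simps)

text \<open>The right-hand side of the equality case depends on \<open>e2\<close> only through its
  angle: where nothing is lost, the tangent in that direction is determined by the two outer contact
  elements. This is what later identifies two bodies with the same contact points.\<close>

lemma cell_cut_facts:
  fixes e1 e2 e3
  assumes nn: "gap e1 e2 \<ge> 0" "gap e2 e1 \<ge> 0" "gap e2 e3 \<ge> 0" "gap e3 e2 \<ge> 0" "gap e1 e3 \<ge> 0" "gap e3 e1 \<ge> 0"
    and t: "fst e1 < fst e2" "fst e2 < fst e3" "fst e3 - fst e1 < pi"
  shows "cell e1 e2 + cell e2 e3 \<le> cell e1 e3"
    and "cell e1 e2 + cell e2 e3 = cell e1 e3 \<Longrightarrow> gap e1 e3 > 0 \<Longrightarrow> gap e3 e1 > 0 \<Longrightarrow>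
      gap e1 e2 = sin (fst e2 - fst e1) * (gap e1 e3 / sin (fst e3 - fst e1) - 
          sin (fst e3 - fst e2) * ((gap e1 e3 / sin (fst e3 - fst e1)) * (gap e3 e1 / sin (fst e3 - fst e1)) 
           / (sin (fst e3 - fst e2) * (gap e3 e1 / sin (fst e3 - fst e1)) +
              sin (fst e2 - fst e1) * (gap e1 e3 / sin (fst e3 - fst e1)))))"
proof -
  define s12 s13 s23 where "s12 = sin (fst e2 - fst e1)" "s13 = sin (fst e3 - fst e1)" "s23 = sin (fst e3 - fst e2)"
  have s: "s12 > 0" "s23 > 0" "s13 > 0"
    using t by (simp_all add: s12_s13_s23_def sin_gt_zero)
  have rel: "s13 * gap e1 e2 = s12 * (gap e1 e3 - gap e2 e3) - s23 * gap e2 e1"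
      "s13 * gap e3 e2 = s23 * (gap e3 e1 - gap e2 e1) - s12 * gap e2 e3"
    by (rule gap_relations; simp add: s12_s13_s23_def)+
  define a12 b12 a23 b23 a13 b13 where ab: "a12 = gap e1 e2 / s12" "b12 = gap e2 e1 / s12"
    "a23 = gap e2 e3 / s23" "b23 = gap e3 e2 / s23" "a13 = gap e1 e3 / s13" "b13 = gap e3 e1 / s13"
  define k where "k = (b12 + a23) / s13"
  have k: "b12 + a23 = k * s13" using s by (simp add: k_def)
  have g: "gap e1 e2 = a12 * s12" "gap e2 e1 = b12 * s12" "gap e2 e3 = a23 * s23" "gap e3 e2 = b23 * s23"
      "gap e1 e3 = a13 * s13" "gap e3 e1 = b13 * s13"
    using s by (simp_all add: ab)
  have "(s13 * s12) * a12 = (s13 * s12) * a13 - (s12 * s23) * (b12 + a23)"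
    using rel(1) unfolding g by (simp add: algebra_simps)
  then have "(s13 * s12) * a12 = (s13 * s12) * (a13 - k * s23)"
    unfolding k by (simp add: algebra_simps)
  moreover have "(s13 * s23) * b23 = (s13 * s23) * b13 - (s12 * s23) * (b12 + a23)"
    using rel(2) unfolding g by (simp add: algebra_simps)
  then have "(s13 * s23) * b23 = (s13 * s23) * (b13 - k * s12)"
    unfolding k by (simp add: algebra_simps)
  ultimately have a: "a12 = a13 - k * s23" "b23 = b13 - k * s12"
    using s by (simp_all only: mult_cancel_left) auto
  have nn': "a12 \<ge> 0" "b12 \<ge> 0" "a23 \<ge> 0" "b23 \<ge> 0" "a13 \<ge> 0" "b13 \<ge> 0"
    using nn s by (simp_all add: ab)
  have q: "a * x * (b * x) / (2 * x) = a * b * x / 2" if "x > 0" for a b x :: real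
    using that by simp
  have c: "cell e1 e2 = root 3 (a12 * b12 * s12) / root 3 2" "cell e2 e3 = root 3 (a23 * b23 * s23) / root 3 2"
    "cell e1 e3 = root 3 (a13 * b13 * s13) / root 3 2"
    unfolding cell_def g s12_s13_s23_def[symmetric] q[OF s(1)] q[OF s(2)] q[OF s(3)] by (simp_all only: real_root_divide)
  have r2: "root 3 (2::real) > 0" by simp
  show "cell e1 e2 + cell e2 e3 \<le> cell e1 e3"
    using root3_cut_triangle(1)[OF s nn' a k] r2 unfolding c by (simp add: add_divide_distrib[symmetric] divide_right_mono)
  assume eq: "cell e1 e2 + cell e2 e3 = cell e1 e3" and pos: "gap e1 e3 > 0" "gap e3 e1 > 0"
  have "a13 > 0" "b13 > 0" using pos s by (simp_all add: ab)
  moreover have "root 3 (a12 * b12 * s12) + root 3 (a23 * b23 * s23) = root 3 (a13 * b13 * s13)"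
    using eq r2 unfolding c by (simp add: add_divide_distrib[symmetric])
  ultimately have kk: "k = a13 * b13 / (s23 * b13 + s12 * a13)"
    using root3_cut_triangle(2)[OF s nn' a k] by blast
  have "gap e1 e2 = s12 * a12" using s by (simp add: ab)
  also have "\<dots> = s12 * (a13 - s23 * (a13 * b13 / (s23 * b13 + s12 * a13)))"
    unfolding a(1) kk by (simp add: mult.commute)
  finally show "gap e1 e2 = sin (fst e2 - fst e1) * (gap e1 e3 / sin (fst e3 - fst e1) - 
          sin (fst e3 - fst e2) * ((gap e1 e3 / sin (fst e3 - fst e1)) * (gap e3 e1 / sin (fst e3 - fst e1)) 
           / (sin (fst e3 - fst e2) * (gap e3 e1 / sin (fst e3 - fst e1)) +
              sin (fst e2 - fst e1) * (gap e1 e3 / sin (fst e3 - fst e1)))))"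
    unfolding ab s12_s13_s23_def .
qed

text \<open>A cell between equal normals is 0, so superadditivity with a parallel pair amounts to
  monotonicity of the remaining cell when a contact point slides along the common tangent. The slide
  changes a gap by its length times the sine of the angle to the third normal.\<close>

lemma parallel_gap_mono:
  assumes c: "contact S e" "contact S f" "cle e f" "fst e = fst f"
  shows "gap g e = gap g f"
    and "sin (fst g - fst e) \<ge> 0 \<Longrightarrow> gap f g \<le> gap e g"
    and "sin (fst g - fst e) \<le> 0 \<Longrightarrow> gap e g \<le> gap f g"
proof -
  have eq: "uvec (fst e) \<bullet> snd e = uvec (fst e) \<bullet> snd f"
    using c by (auto simp: contact_def intro: antisym)
  show "gap g e = gap g f" using eq c(4) by (simp add: gap_def inner_diff_right)
  define d where "d = uvec (fst e + pi/2) \<bullet> (snd f - snd e)"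
  have d: "d \<ge> 0" using c by (simp add: d_def cle_def inner_diff_right)
  have "uvec (fst g) \<bullet> (snd f - snd e) = sin (fst g - fst e) * d"
    using inner_uvec_decomp[of "fst e + pi/2" "fst e" "fst g" "snd f - snd e"] eq
    by (simp add: d_def inner_diff_right)
  then have "gap e g - gap f g = sin (fst g - fst e) * d" by (simp add: gap_def inner_diff_right)
  then show "sin (fst g - fst e) \<ge> 0 \<Longrightarrow> gap f g \<le> gap e g" "sin (fst g - fst e) \<le> 0 \<Longrightarrow> gap e g \<le> gap f g"
    using d mult_nonneg_nonneg[of "sin (fst g - fst e)" d] mult_nonpos_nonneg[of "sin (fst g - fst e)" d] by linarith+
qed

lemma cell_superadditive:
  assumes c: "contact S e1" "contact S e2" "contact S e3"
    and le: "cle e1 e2" "cle e2 e3" and t: "fst e3 - fst e1 < pi"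
  shows "cell e1 e2 + cell e2 e3 \<le> cell e1 e3"
proof -
  note nn = contact_gap_nonneg[OF c(1,2)] contact_gap_nonneg[OF c(2,1)] contact_gap_nonneg[OF c(2,3)]
    contact_gap_nonneg[OF c(3,2)] contact_gap_nonneg[OF c(1,3)] contact_gap_nonneg[OF c(3,1)]
  have s: "sin (fst e3 - fst e1) \<ge> 0"
    using t le[THEN cle_fst] by (intro sin_ge_zero) auto
  consider "fst e1 < fst e2" "fst e2 < fst e3" | "fst e1 = fst e2" | "fst e2 = fst e3"
    using le[THEN cle_fst] by linarith
  then show ?thesis
  proof cases
    case 1
    then show ?thesis using cell_cut_facts(1)[OF nn _ _ t] by blast
  next
    case 2
    then have "gap e2 e3 \<le> gap e1 e3" "gap e3 e1 = gap e3 e2" 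
      using parallel_gap_mono[OF c(1,2) le(1)] s by auto
    then have "gap e2 e3 * gap e3 e2 / (2 * sin (fst e3 - fst e1)) \<le> gap e1 e3 * gap e3 e1 / (2 * sin (fst e3 - fst e1))"
      using nn s by (intro divide_right_mono mult_mono) auto
    then show ?thesis using 2 by (simp add: cell_eq_0) (simp add: cell_def)
  next
    case 3
    then have "gap e2 e1 \<le> gap e3 e1" "gap e1 e2 = gap e1 e3" 
      using parallel_gap_mono[OF c(2,3) le(2), of e1] s sin_minus[of "fst e3 - fst e1"] by auto
    then have "gap e1 e2 * gap e2 e1 / (2 * sin (fst e3 - fst e1)) \<le> gap e1 e3 * gap e3 e1 / (2 * sin (fst e3 - fst e1))"
      using nn s by (intro divide_right_mono mult_mono) auto
    then show ?thesis using 3 by (simp add: cell_eq_0) (simp add: cell_def)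
  qed
qed

section \<open>Full turns, chains and their sums\<close>

definition cshift :: "int \<Rightarrow> real \<times> plane \<Rightarrow> real \<times> plane" where
  "cshift k e = (fst e + 2 * pi * of_int k, snd e)"

lemma fst_cshift [simp]: "fst (cshift k e) = fst e + 2 * pi * of_int k"
  and snd_cshift [simp]: "snd (cshift k e) = snd e"
  by (simp_all add: cshift_def)

lemma contact_cshift [simp]: "contact S (cshift k e) \<longleftrightarrow> contact S e"
  by (simp add: contact_def)

lemma cell_cshift [simp]: "cell (cshift k e) (cshift k f) = cell e f"
  by (simp add: cell_def gap_def)

lemma cle_cshift [simp]: "cle (cshift k e) (cshift k f) \<longleftrightarrow> cle e f"
proof -
  have "uvec (t + 2 * pi * of_int k + pi/2) = uvec (t + pi/2)" for t
    using uvec_periodic_int[of "t + pi/2" k] by (simp add: algebra_simps)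
  then show ?thesis by (auto simp: cle_def)
qed

lemma cstep_cshift [simp]: "cstep (cshift k e) (cshift k f) \<longleftrightarrow> cstep e f"
  by (simp add: cstep_def)

lemma cshift_cshift [simp]: "cshift j (cshift k e) = cshift (j + k) e"
  by (simp add: cshift_def algebra_simps)

lemma cshift_0 [simp]: "cshift 0 e = e"
  by (simp add: cshift_def)

definition chain_sum :: "(nat \<Rightarrow> real \<times> plane) \<Rightarrow> nat \<Rightarrow> real" where
  "chain_sum e m = (\<Sum>i<m. cell (e i) (e (Suc i)))"

definition open_chain :: "plane set \<Rightarrow> (nat \<Rightarrow> real \<times> plane) \<Rightarrow> nat \<Rightarrow> bool" where
  "open_chain S e m \<longleftrightarrow> (\<forall>i\<le>m. contact S (e i)) \<and> (\<forall>i<m. cstep (e i) (e (Suc i)))"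

text \<open>The chain returns to its first point with the normal turned exactly once. Since angles
  never decrease, returning to the same angle would force all normals to be equal.\<close>

definition closed_chain :: "plane set \<Rightarrow> (nat \<Rightarrow> real \<times> plane) \<Rightarrow> nat \<Rightarrow> bool" where
  "closed_chain S e m \<longleftrightarrow> open_chain S e m \<and> e m = cshift 1 (e 0)"

lemma open_chain_cell_nonneg: "open_chain S e m \<Longrightarrow> i < m \<Longrightarrow> cell (e i) (e (Suc i)) \<ge> 0"
  unfolding open_chain_def by (intro contact_cell_nonneg[of S]) (auto simp: Suc_leI)

lemma chain_sum_nonneg: "open_chain S e m \<Longrightarrow> chain_sum e m \<ge> 0"
  unfolding chain_sum_def by (intro sum_nonneg) (auto intro: open_chain_cell_nonneg)

lemma open_chain_mono:
  assumes "open_chain S e m" "i \<le> j" "j \<le> m" shows "cle (e i) (e j)"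
  using assms(2,3)
proof (induction j)
  case (Suc j)
  show ?case
  proof (cases "i = Suc j")
    case False
    then have "cle (e i) (e j)" "cle (e j) (e (Suc j))"
      using Suc assms(1) by (auto simp: open_chain_def cstep_def)
    then show ?thesis by (rule cle_trans)
  qed simp
qed simp

lemma open_chain_sub: "open_chain S e m \<Longrightarrow> i + j \<le> m \<Longrightarrow> open_chain S (\<lambda>l. e (i + l)) j"
  by (auto simp: open_chain_def)

lemma chain_sum_split:
  assumes "j \<le> m"
  shows "chain_sum e m = chain_sum e j + chain_sum (\<lambda>l. e (j + l)) (m - j)"
proof -
  have "chain_sum e (j + n) = chain_sum e j + chain_sum (\<lambda>l. e (j + l)) n" for n
    by (induction n) (simp_all add: chain_sum_def)
  from this[of "m - j"] show ?thesis using assms by simp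
qed

lemma chain_sum_le_cell:
  assumes "open_chain S e m" "contact S a" "contact S b" "cle a (e 0)" "cle (e m) b" "fst b - fst a < pi"
  shows "chain_sum e m \<le> cell a b"
proof -
  \<comment> \<open>Carrying the last cell up to \<open>b\<close> along makes each induction step a
    single use of superadditivity.\<close>
  have "chain_sum e m + cell (e m) b \<le> cell (e 0) b" using assms(1,5)
  proof (induction m)
    case (Suc m)
    have oc: "open_chain S e m" using Suc.prems(1) by (auto simp: open_chain_def)
    have st: "cle (e m) (e (Suc m))" "contact S (e m)" "contact S (e (Suc m))"
      using Suc.prems(1) by (auto simp: open_chain_def cstep_def)
    have "fst a \<le> fst (e m)" using assms(4) open_chain_mono[OF oc, of 0 m] cle_trans cle_fst by blast
    then have "cell (e m) (e (Suc m)) + cell (e (Suc m)) b \<le> cell (e m) b"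
      using assms(6) by (intro cell_superadditive[of S]) (use st Suc.prems(2) assms(3) in auto)
    moreover have "cle (e m) b" using st(1) Suc.prems(2) cle_trans by blast
    ultimately show ?case using Suc.IH[OF oc] by (simp add: chain_sum_def)
  qed (simp add: chain_sum_def)
  moreover have c0: "contact S (e 0)" "contact S (e m)" using assms(1) by (auto simp: open_chain_def)
  moreover have l0: "cle (e 0) b" "cle a (e m)"
    using open_chain_mono[OF assms(1), of 0 m] assms(4,5) cle_trans by blast+
  moreover have "cell a (e 0) + cell (e 0) b \<le> cell a b"
    using assms c0 l0 by (intro cell_superadditive[of S]) auto
  moreover have "cell a (e 0) \<ge> 0" 
    using assms c0 l0 cle_fst[OF l0(1)] by (intro contact_cell_nonneg[of S]) (auto simp: cstep_def)
  moreover have "cell (e m) b \<ge> 0" 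
    using assms c0 l0 cle_fst[OF l0(2)] by (intro contact_cell_nonneg[of S]) (auto simp: cstep_def)
  ultimately show ?thesis by linarith
qed

section \<open>Comparison of two chains\<close>

lemma open_chain_crossing:
  assumes "open_chain S e m" "cle (e 0) c" "cle c (e m)" "m > 0"
  obtains j where "j < m" "cle (e j) c" "cle c (e (Suc j))"
proof -
  have "\<exists>j<m. cle (e j) c \<and> cle c (e (Suc j))"
    using assms
  proof (induction m)
    case (Suc m)
    show ?case
    proof (cases "cle (e m) c")
      case True then show ?thesis using Suc.prems by blast
    next
      case False
      then have le: "cle c (e m)" using cle_total by blast
      have "m > 0" using False Suc.prems(2) by (cases m) auto
      moreover have "open_chain S e m" using Suc.prems(1) by (auto simp: open_chain_def)
      ultimately obtain j where "j < m" "cle (e j) c \<and> cle c (e (Suc j))" using Suc.IH Suc.prems le by blast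
      then show ?thesis using less_SucI by blast
    qed
  qed simp
  then show ?thesis using that by blast
qed

text \<open>
  At most one cell of \<open>P\<close> straddles each element of \<open>C\<close>; all others lie within a cell of \<open>C\<close>, where
  superadditivity applies.
\<close>

lemma open_chain_sum_le:
  assumes C: "open_chain S C l" and P: "open_chain S P m"
    and "cle (C 0) (P 0)" "cle (P m) (C l)" "\<delta> \<ge> 0"
    and "\<And>i. i < m \<Longrightarrow> cell (P i) (P (Suc i)) \<le> \<delta>"
  shows "chain_sum P m \<le> chain_sum C l + of_nat l * \<delta>"
  using assms
proof (induction l arbitrary: P m)
  case 0
  \<comment> \<open>\<open>C\<close> consists of one element, so all of \<open>P\<close> is squeezed
    onto its angle.\<close>
  have "cell (P i) (P (Suc i)) = 0" if "i < m" for i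
  proof -
    have "cle (C 0) (P i)"
      using that by (intro cle_trans[OF 0(3)] open_chain_mono[OF 0(2)]) auto
    moreover have "cle (P (Suc i)) (C 0)"
      using that by (intro cle_trans[OF _ 0(4)] open_chain_mono[OF 0(2)]) auto
    moreover have "cle (P i) (P (Suc i))" using open_chain_mono[OF 0(2), of i "Suc i"] that by simp
    ultimately have "fst (P i) = fst (P (Suc i))" using cle_fst[of "P i" "P (Suc i)"] cle_fst[of "C 0" "P i"] cle_fst[of "P (Suc i)" "C 0"] by linarith
    then show ?thesis by (rule cell_eq_0)
  qed
  then show ?case by (simp add: chain_sum_def)
next
  case (Suc l)
  have Cl: "open_chain S C l" using Suc.prems(1) by (auto simp: open_chain_def)
  have cC: "contact S (C l)" "contact S (C (Suc l))" "cstep (C l) (C (Suc l))"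
    using Suc.prems(1) by (auto simp: open_chain_def)
  have S: "chain_sum C (Suc l) = chain_sum C l + cell (C l) (C (Suc l))" by (simp add: chain_sum_def)
  have cn: "cell (C l) (C (Suc l)) \<ge> 0" using cC by (intro contact_cell_nonneg)
  consider "cle (P m) (C l)" | "cle (C l) (P 0)" | "cle (P 0) (C l)" "cle (C l) (P m)" "m > 0" 
    using cle_total[of "P m" "C l"] cle_total[of "P 0" "C l"] by (cases "m = 0") auto
  then show ?case
  proof cases
    case 1
    have "chain_sum P m \<le> chain_sum C l + of_nat l * \<delta>"
      by (rule Suc.IH[OF Cl Suc.prems(2,3) 1 Suc.prems(5,6)])
    then show ?thesis using S cn Suc.prems(5) by (simp add: algebra_simps)
  next
    case 2
    have "chain_sum P m \<le> cell (C l) (C (Suc l))"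
      using cC by (intro chain_sum_le_cell[OF Suc.prems(2) _ _ 2 Suc.prems(4)]) (auto simp: cstep_def)
    moreover have "chain_sum C l \<ge> 0" using Cl by (rule chain_sum_nonneg)
    moreover have "0 \<le> of_nat (Suc l) * \<delta>" using Suc.prems(5) by simp
    ultimately show ?thesis using S by linarith
  next
    case 3
    then obtain j where j: "j < m" "cle (P j) (C l)" "cle (C l) (P (Suc j))"
      using open_chain_crossing[OF Suc.prems(2)] by blast
    have e: "chain_sum P m = chain_sum P j + cell (P j) (P (Suc j)) + chain_sum (\<lambda>i. P (Suc j + i)) (m - Suc j)"
      using chain_sum_split[of "Suc j" m P] j by (simp add: chain_sum_def)
    have "open_chain S P j" using Suc.prems(2) j by (auto simp: open_chain_def)
    then have "chain_sum P j \<le> chain_sum C l + of_nat l * \<delta>"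
      using j by (intro Suc.IH[of P j] Cl Suc.prems(3,5,6)) auto
    moreover have "cell (P j) (P (Suc j)) \<le> \<delta>" using j Suc.prems(6) by blast
    moreover have "chain_sum (\<lambda>i. P (Suc j + i)) (m - Suc j) \<le> cell (C l) (C (Suc l))"
      using cC j Suc.prems(4)
      by (intro chain_sum_le_cell[OF open_chain_sub[OF Suc.prems(2)]]) (auto simp: cstep_def)
    ultimately show ?thesis using e S by (simp add: algebra_simps)
  qed
qed

lemma closed_chain_shift:
  assumes "closed_chain S P m"
  shows "closed_chain S (\<lambda>i. cshift k (P i)) m" "chain_sum (\<lambda>i. cshift k (P i)) m = chain_sum P m"
  using assms by (auto simp: closed_chain_def open_chain_def chain_sum_def add.commute)

lemma cle_cshift_between:
  obtains k where "cle c (cshift k e)" "cle (cshift k e) (cshift 1 c)"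
proof -
  define k where "k = \<lceil>(fst c - fst e) / (2*pi)\<rceil>"
  have "(fst c - fst e) / (2*pi) \<le> k" "k < (fst c - fst e) / (2*pi) + 1"
    unfolding k_def by linarith+
  then have k: "fst c \<le> fst (cshift k e)" "fst (cshift k e) < fst (cshift 1 c)"
    by (simp_all add: field_simps)
  show ?thesis
  proof (cases "cle c (cshift k e)")
    case True
    then show ?thesis using k that by (simp add: cle_def)
  next
    \<comment> \<open>The angles agree, but the shifted element precedes \<open>c\<close> on the
      common tangent; one more turn places it in the period.\<close>
    case False
    then have "cle (cshift k e) c" using cle_total by blast
    then have "cle (cshift (k + 1) e) (cshift 1 c)" by (metis add.commute cle_cshift cshift_cshift)
    moreover have "cle c (cshift (k + 1) e)" using k by (simp add: cle_def algebra_simps)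
    ultimately show ?thesis using that by blast
  qed
qed

text \<open>The cell of \<open>P\<close> that straddles the start of \<open>C\<close> is removed,
  and the rest is read as an open chain beginning right after it. The removed cell accounts for the
  one \<open>\<delta>\<close> beyond those of \<open>open_chain_sum_le\<close>.\<close>

lemma closed_chain_sum_le:
  assumes C: "closed_chain S C l" and P: "closed_chain S P m"
    and d: "\<delta> \<ge> 0" and small: "\<And>i. i < m \<Longrightarrow> cell (P i) (P (Suc i)) \<le> \<delta>"
  shows "chain_sum P m \<le> chain_sum C l + of_nat (Suc l) * \<delta>"
proof -
  obtain k where k: "cle (C 0) (cshift k (P 0))" "cle (cshift k (P 0)) (cshift 1 (C 0))"
    using cle_cshift_between by blast
  define Q where "Q i = cshift k (P i)" for i
  have Q: "closed_chain S Q m" "chain_sum Q m = chain_sum P m" and small: "\<And>i. i < m \<Longrightarrow> cell (Q i) (Q (Suc i)) \<le> \<delta>"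
    using closed_chain_shift[OF P, of k] small unfolding Q_def by auto
  have oQ: "open_chain S Q m" and Qm: "Q m = cshift 1 (Q 0)" using Q by (simp_all add: closed_chain_def)
  have "cle (cshift 1 (C 0)) (Q m)" unfolding Qm using k by (simp add: Q_def del: cshift_cshift)
  moreover have "m > 0"
  proof (rule ccontr)
    assume "\<not> m > 0" then have "fst (Q 0) = fst (cshift 1 (Q 0))" using Qm by simp
    then show False by simp
  qed
  ultimately obtain j where j: "j < m" "cle (Q j) (cshift 1 (C 0))" "cle (cshift 1 (C 0)) (Q (Suc j))"
    using open_chain_crossing[OF oQ, of "cshift 1 (C 0)"] k by (auto simp: Q_def)
  define n where "n = m - Suc j"
  \<comment> \<open>The piece of \<open>Q\<close> behind the removed cell, turned back once,
    followed by the piece in front of it; they fit together because \<open>Q\<close> closes up after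
    one turn.\<close>
  define R where "R i = (if i < n then cshift (-1) (Q (Suc j + i)) else Q (i - n))" for i
  have Rn: "R i = cshift (-1) (Q (Suc j + i))" if "i \<le> n" for i
  proof (cases "i < n")
    case False
    then have "i = n" "Suc j + i = m" using that j by (simp_all add: n_def)
    then show ?thesis using Qm by (simp add: R_def)
  qed (simp add: R_def)
  have Rn': "R (n + i) = Q i" for i by (simp add: R_def)
  have oR: "open_chain S R (n + j)"
    unfolding open_chain_def
  proof (intro conjI allI impI)
    fix i assume "i \<le> n + j"
    then show "contact S (R i)" using oQ j by (auto simp: R_def open_chain_def n_def)
  next
    fix i assume i: "i < n + j"
    show "cstep (R i) (R (Suc i))"
    proof (cases "i < n")
      case True
      then show ?thesis using Rn[of i] Rn[of "Suc i"] oQ j by (simp add: open_chain_def n_def)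
    next
      case False
      then show ?thesis using Rn'[of "i - n"] Rn'[of "Suc i - n"] oQ j i by (simp add: open_chain_def Suc_diff_le)
    qed
  qed
  have sR: "chain_sum R (n + j) = chain_sum (\<lambda>i. Q (Suc j + i)) n + chain_sum Q j"
  proof -
    have "chain_sum R n = chain_sum (\<lambda>i. Q (Suc j + i)) n"
      unfolding chain_sum_def by (intro sum.cong refl) (simp add: Rn)
    then show ?thesis using chain_sum_split[of n "n + j" R] by (simp add: Rn')
  qed
  have sQ: "chain_sum Q m = chain_sum Q j + cell (Q j) (Q (Suc j)) + chain_sum (\<lambda>i. Q (Suc j + i)) n"
    using chain_sum_split[of "Suc j" m Q] j by (simp add: chain_sum_def n_def)
  have "chain_sum R (n + j) \<le> chain_sum C l + of_nat l * \<delta>"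
  proof (rule open_chain_sum_le[OF _ oR _ _ d])
    show "open_chain S C l" using C by (simp add: closed_chain_def)
    have "cle (cshift (-1) (cshift 1 (C 0))) (cshift (-1) (Q (Suc j)))"
      using j(3) by (simp only: cle_cshift)
    then show "cle (C 0) (R 0)" using Rn[of 0] by simp
    show "cle (R (n + j)) (C l)" using j(2) C by (simp add: Rn' closed_chain_def)
    fix i assume i: "i < n + j"
    show "cell (R i) (R (Suc i)) \<le> \<delta>"
    proof (cases "i < n")
      case True
      then show ?thesis using Rn[of i] Rn[of "Suc i"] small[of "Suc j + i"] by (simp add: n_def)
    next
      case False
      then show ?thesis using Rn'[of "i - n"] Rn'[of "Suc i - n"] small[of "i - n"] j i by (simp add: Suc_diff_le)
    qed
  qed
  then show ?thesis using sR sQ small[OF j(1)] Q(2) by (simp add: algebra_simps)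
qed

section \<open>The infimum as the limit of chains with small cells\<close>

definition half_perimeter :: "plane set \<Rightarrow> real" where
  "half_perimeter S = Inf {chain_sum e m | e m. closed_chain S e m}"

lemma half_perimeter_le: "closed_chain S e m \<Longrightarrow> half_perimeter S \<le> chain_sum e m"
  unfolding half_perimeter_def
  by (rule cInf_lower) (auto intro!: bdd_belowI[of _ 0] chain_sum_nonneg simp: closed_chain_def)

text \<open>From below the infimum itself is the bound; from above a fixed nearly optimal chain
  dominates all fine ones up to a fixed multiple of their largest cell. Fineness is measured by
  cells rather than by angles or distances, so corners and line segments in the boundary need no
  separate treatment.\<close>

lemma chain_sums_tendsto:
  assumes P: "eventually (\<lambda>n. closed_chain S (P n) (m n)) sequentially"
    and small: "\<And>\<delta>. \<delta> > 0 \<Longrightarrow> eventually (\<lambda>n. \<forall>i<m n. cell (P n i) (P n (Suc i)) \<le> \<delta>) sequentially"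
  shows "(\<lambda>n. chain_sum (P n) (m n)) \<longlonglongrightarrow> half_perimeter S"
proof (rule order_tendstoI)
  fix a assume a: "a < half_perimeter S"
  show "eventually (\<lambda>n. a < chain_sum (P n) (m n)) sequentially"
    using P by eventually_elim (use a half_perimeter_le in fastforce)
next
  fix a assume a: "half_perimeter S < a"
  obtain n0 where "closed_chain S (P n0) (m n0)" using P by (auto simp: eventually_sequentially)
  then have "{chain_sum e m | e m. closed_chain S e m} \<noteq> {}" by blast
  from cInf_lessD[OF this] a obtain C l where C: "closed_chain S C l" "chain_sum C l < a"
    unfolding half_perimeter_def by blast
  define \<delta> where "\<delta> = (a - chain_sum C l) / (2 * of_nat (Suc l))"
  have d: "\<delta> > 0" using C by (simp add: \<delta>_def)
  have dl: "of_nat (Suc l) * \<delta> = (a - chain_sum C l) / 2" by (simp add: \<delta>_def del: of_nat_Suc)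
  show "eventually (\<lambda>n. chain_sum (P n) (m n) < a) sequentially"
    using P small[OF d]
  proof eventually_elim
    case (elim n)
    have "chain_sum (P n) (m n) \<le> chain_sum C l + of_nat (Suc l) * \<delta>"
      using elim d by (intro closed_chain_sum_le[OF C(1)]) auto
    then show ?case unfolding dl using C(2) by argo
  qed
qed

section \<open>Chains from position angles\<close>

definition cross2 :: "plane \<Rightarrow> plane \<Rightarrow> real" where
  "cross2 v w = v $ 1 * w $ 2 - v $ 2 * w $ 1"

lemma cross2_uvec: "cross2 (uvec a) (uvec b) = sin (b - a)"
  by (simp add: cross2_def sin_diff algebra_simps)

lemma cross2_scale [simp]: "cross2 (k *\<^sub>R v) (l *\<^sub>R w) = k * l * cross2 v w"
  by (simp add: cross2_def algebra_simps)

lemma cross2_mult_sin: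
  "cross2 v w * sin (b - a) = (uvec a \<bullet> v) * (uvec b \<bullet> w) - (uvec b \<bullet> v) * (uvec a \<bullet> w)"
  by (simp add: cross2_def inner_plane sin_diff algebra_simps)

lemma cross2_frame: "cross2 v w = (uvec a \<bullet> v) * (uvec (a + pi/2) \<bullet> w) - (uvec (a + pi/2) \<bullet> v) * (uvec a \<bullet> w)"
  using cross2_mult_sin[of v w "a + pi/2" a] by simp

text \<open>The law of cosines in oblique coordinates: the length of \<open>d\<close> from its
  components along two normals.\<close>

lemma norm_sin_decomp:
  "(sin (b - a))\<^sup>2 * (d \<bullet> d) = (uvec a \<bullet> d)\<^sup>2 + (uvec b \<bullet> d)\<^sup>2 - 2 * (uvec a \<bullet> d) * (uvec b \<bullet> d) * cos (b - a)"
proof -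
  have d: "d \<bullet> d = (uvec a \<bullet> d)\<^sup>2 + (uvec (a + pi/2) \<bullet> d)\<^sup>2"
  proof -
    have e: "uvec a \<bullet> d = cos a * d $ 1 + sin a * d $ 2" "uvec (a + pi/2) \<bullet> d = cos a * d $ 2 - sin a * d $ 1"
      by (simp_all add: inner_plane sin_add cos_add)
    show ?thesis unfolding e inner_plane[of d d] using sin_cos_squared_add[of a] by algebra
  qed
  have b: "uvec b \<bullet> d = cos (b - a) * (uvec a \<bullet> d) + sin (b - a) * (uvec (a + pi/2) \<bullet> d)"
    using inner_uvec_decomp[of "a + pi/2" a b d] by (simp add: sin_diff cos_diff sin_add cos_add algebra_simps)
  show ?thesis unfolding b d using sin_cos_squared_add[of "b - a"] by algebra
qed

lemma measure_triangle: "triangle_area x y z = \<bar>cross2 (z - x) (y - x)\<bar> / 2"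
proof -
  have "convex hull {x, y, z} \<in> sets lborel"
    by (simp add: borel_compact finite_imp_compact_convex_hull)
  then have "triangle_area x y z = measure lborel (convex hull {x, y, z})"
    by (simp add: triangle_area_def)
  also have "\<dots> = \<bar>cross2 (z - x) (y - x)\<bar> / 2"
    by (subst content_triangle) (simp add: cross2_def algebra_simps)
  finally show ?thesis .
qed

lemma triangle_area_swap: "triangle_area x y z = triangle_area z y x"
  by (simp add: triangle_area_def insert_commute)

text \<open>The apex lies on both tangents, so in \<open>cross2_mult_sin\<close> one product
  vanishes and the other is the product of the two gaps.\<close>

lemma triangle_area_cell:
  assumes y: "uvec (fst e) \<bullet> y = uvec (fst e) \<bullet> snd e" "uvec (fst f) \<bullet> y = uvec (fst f) \<bullet> snd f"
    and s: "sin (fst f - fst e) > 0" and g: "gap e f \<ge> 0" "gap f e \<ge> 0"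
  shows "root 3 (triangle_area (snd e) y (snd f)) = cell e f"
proof -
  have "cross2 (snd f - snd e) (y - snd e) * sin (fst f - fst e) = - (gap e f * gap f e)"
    unfolding cross2_mult_sin using y by (simp add: gap_def inner_diff_right algebra_simps)
  then have "cross2 (snd f - snd e) (y - snd e) = - (gap e f * gap f e) / sin (fst f - fst e)"
    using s by (simp add: field_simps)
  then have "\<bar>cross2 (snd f - snd e) (y - snd e)\<bar> = gap e f * gap f e / sin (fst f - fst e)"
    using s g by simp
  then show ?thesis by (simp add: measure_triangle cell_def mult.commute)
qed

text \<open>The inner ball keeps every tangent at distance at least \<open>r\<close> from
  \<open>c\<close>, which prevents nearby contact points from having opposite normals; together with
  the outer ball it makes this quantitative.\<close>

locale fat_body =
  fixes S :: "plane set" and c :: plane and r R :: real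
  assumes compact_S: "compact S" and convex_S: "convex S"
    and r_pos: "r > 0" and inner_ball: "cball c r \<subseteq> S" and outer_ball: "S \<subseteq> cball c R"
begin

lemma contact_height:
  assumes "contact S (t, x)" shows "uvec t \<bullet> (x - c) \<ge> r"
proof -
  have "c + r *\<^sub>R uvec t \<in> S" using inner_ball r_pos by (auto simp: dist_norm)
  then have "uvec t \<bullet> (c + r *\<^sub>R uvec t) \<le> uvec t \<bullet> x" using assms by (auto simp: contact_def)
  then show ?thesis by (simp add: inner_add_right inner_diff_right inner_uvec_uvec)
qed

text \<open>For contact points closer than \<open>r\<close> the sum of the two normals has length at
  least \<open>r / R\<close>, so \<open>1 + C\<close> is bounded away from 0. The law of cosines
  then bounds the product of the gaps by a constant times \<open>s\<^sup>2\<close> and the squared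
  chord; one factor \<open>s\<close> cancels the denominator of the cell, the other is at most
  1.\<close>

lemma cell_small:
  assumes e: "contact S e" "contact S f" and s: "sin (fst f - fst e) \<ge> 0"
    and d: "dist (snd e) (snd f) \<le> d" "d < r"
  shows "cell e f \<le> root 3 (d\<^sup>2 * (R\<^sup>2 / (2 * r\<^sup>2)))"
proof -
  define D where "D = snd f - snd e"
  define p q where "p = gap f e" and "q = gap e f"
  define s C where "s = sin (fst f - fst e)" and "C = cos (fst f - fst e)"
  have pq: "p \<ge> 0" "q \<ge> 0" using e by (auto simp: p_def q_def intro: contact_gap_nonneg)
  have h: "uvec (fst e) \<bullet> (snd e - c) \<ge> r" "uvec (fst f) \<bullet> (snd f - c) \<ge> r"
    using contact_height[of "fst e" "snd e"] contact_height[of "fst f" "snd f"] e by simp_all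
  have d0: "norm D \<le> d" using d by (simp add: D_def dist_norm norm_minus_commute)
  have "uvec (fst f) \<bullet> D \<le> d"
    using norm_cauchy_schwarz[of "uvec (fst f)" D] d0 by simp
  then have "uvec (fst f) \<bullet> (snd e - c) \<ge> r - d" using h(2) by (simp add: D_def inner_diff_right)
  then have "(uvec (fst e) + uvec (fst f)) \<bullet> (snd e - c) \<ge> r"
    using h(1) d by (simp add: inner_add_left)
  moreover have "(uvec (fst e) + uvec (fst f)) \<bullet> (snd e - c) \<le> norm (uvec (fst e) + uvec (fst f)) * norm (snd e - c)"
    by (rule norm_cauchy_schwarz)
  moreover have "snd e \<in> cball c R" using e outer_ball by (auto simp: contact_def)
  then have "norm (uvec (fst e) + uvec (fst f)) * norm (snd e - c) \<le> norm (uvec (fst e) + uvec (fst f)) * R"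
    by (intro mult_left_mono) (auto simp: dist_norm norm_minus_commute)
  ultimately have "r \<le> norm (uvec (fst e) + uvec (fst f)) * R" by linarith
  then have "r\<^sup>2 \<le> (norm (uvec (fst e) + uvec (fst f)) * R)\<^sup>2"
    using r_pos by (intro power_mono) auto
  also have "\<dots> = 2 * (1 + C) * R\<^sup>2"
    unfolding power_mult_distrib power2_norm_eq_inner
    by (simp add: inner_add_left inner_add_right inner_uvec_uvec C_def cos_diff algebra_simps)
  finally have C: "r\<^sup>2 \<le> 2 * (1 + C) * R\<^sup>2" .
  have pid: "uvec (fst e) \<bullet> D = - p" "uvec (fst f) \<bullet> D = q"
    by (simp_all add: p_def q_def gap_def D_def inner_diff_right)
  have sD: "s\<^sup>2 * (D \<bullet> D) = p\<^sup>2 + q\<^sup>2 + 2 * p * q * C"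
    using norm_sin_decomp[of "fst f" "fst e" D] unfolding pid s_def C_def by simp
  have "2 * p * q \<le> p\<^sup>2 + q\<^sup>2" by (rule sum_squares_bound)
  then have le: "2 * p * q * (1 + C) \<le> s\<^sup>2 * (D \<bullet> D)" unfolding sD by (simp add: algebra_simps)
  have s0: "s \<ge> 0" "s \<le> 1" using assms(3) by (simp_all add: s_def)
  have "p * q / (2 * s) \<le> d\<^sup>2 * (R\<^sup>2 / (2 * r\<^sup>2))"
  proof (cases "s = 0")
    case False
    then have s: "s > 0" using s0 by simp
    have "p * q * r\<^sup>2 \<le> p * q * (2 * (1 + C) * R\<^sup>2)" using C pq by (intro mult_left_mono) auto
    also have "\<dots> = (2 * p * q * (1 + C)) * R\<^sup>2" by (simp add: algebra_simps)
    also have "\<dots> \<le> s\<^sup>2 * (D \<bullet> D) * R\<^sup>2" using le by (intro mult_right_mono) auto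
    also have "\<dots> \<le> s * (D \<bullet> D) * R\<^sup>2"
      using s0 by (intro mult_right_mono) (auto simp: power2_eq_square mult_left_le_one_le)
    also have "\<dots> \<le> s * d\<^sup>2 * R\<^sup>2"
    proof -
      have "D \<bullet> D \<le> d\<^sup>2" using d0 by (metis power2_norm_eq_inner norm_ge_zero power_mono)
      then show ?thesis using s0 by (intro mult_right_mono mult_left_mono) auto
    qed
    finally show ?thesis using s r_pos by (simp add: field_simps)
  qed simp
  then show ?thesis by (simp add: cell_def p_def q_def s_def mult.commute)
qed

text \<open>
  The position angles \<open>\<phi>\<close> increase along the boundary; that the normal angles follow comes from the
  Lagrange identity \<open>cross2_mult_sin\<close>: its right-hand side is nonnegative for two contact elements.
\<close>

lemma closed_chain_from_arguments:
  fixes x :: "nat \<Rightarrow> plane" and \<psi> \<phi> :: "nat \<Rightarrow> real"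
  assumes con: "\<And>i. i \<le> m \<Longrightarrow> contact S (\<psi> i, x i)"
    and pol: "\<And>i. i \<le> m \<Longrightarrow> x i - c = norm (x i - c) *\<^sub>R uvec (\<phi> i)"
    and inc: "\<And>i. i < m \<Longrightarrow> \<phi> i < \<phi> (Suc i)" "\<And>i. i < m \<Longrightarrow> \<phi> (Suc i) - \<phi> i < pi"
    and cl: "\<phi> m = \<phi> 0 + 2 * pi" "x m = x 0" "uvec (\<psi> m) = uvec (\<psi> 0)"
    and d: "\<And>i. i < m \<Longrightarrow> dist (x i) (x (Suc i)) < r"
  obtains e where "closed_chain S e m" "\<And>i. i \<le> m \<Longrightarrow> snd (e i) = x i"
    "\<And>i. i \<le> m \<Longrightarrow> uvec (fst (e i)) = uvec (\<psi> i)"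
proof -
  \<comment> \<open>The angle from the position vector to the normal. Tangents have positive height
    over \<open>c\<close>, so its cosine is positive and the arcsine recovers it;
    \<open>\<theta> i\<close> is thus the representative of the normal angle nearest to
    \<open>\<phi> i\<close>.\<close>
  define \<alpha> where "\<alpha> i = arcsin (sin (\<psi> i - \<phi> i))" for i
  define \<theta> where "\<theta> i = \<phi> i + \<alpha> i" for i
  define e where "e i = (\<theta> i, x i)" for i
  have npos: "norm (x i - c) > 0" and cpos: "cos (\<psi> i - \<phi> i) > 0" if i: "i \<le> m" for i
  proof -
    have "uvec (\<psi> i) \<bullet> (x i - c) > 0" using contact_height[OF con[OF i]] r_pos by linarith
    then have "uvec (\<psi> i) \<bullet> (norm (x i - c) *\<^sub>R uvec (\<phi> i)) > 0" using pol[OF i] by simp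
    then have "norm (x i - c) * cos (\<psi> i - \<phi> i) > 0" by (simp add: inner_uvec_uvec)
    then show "norm (x i - c) > 0" "cos (\<psi> i - \<phi> i) > 0"
      by (simp_all add: zero_less_mult_iff)
  qed
  have \<alpha>: "- (pi/2) \<le> \<alpha> i" "\<alpha> i \<le> pi/2" "sin (\<alpha> i) = sin (\<psi> i - \<phi> i)" for i
    using arcsin_lbound[of "sin (\<psi> i - \<phi> i)"] arcsin_ubound[of "sin (\<psi> i - \<phi> i)"] by (simp_all add: \<alpha>_def)
  have c\<alpha>: "cos (\<alpha> i) = cos (\<psi> i - \<phi> i)" if "i \<le> m" for i
  proof -
    have "cos (\<alpha> i) = sqrt (1 - (sin (\<psi> i - \<phi> i))\<^sup>2)" by (simp add: \<alpha>_def cos_arcsin)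
    also have "\<dots> = \<bar>cos (\<psi> i - \<phi> i)\<bar>" by (simp add: cos_squared_eq[symmetric])
    finally show ?thesis using cpos[OF that] by simp
  qed
  have u: "uvec (\<theta> i) = uvec (\<psi> i)" if "i \<le> m" for i
  proof -
    have "uvec (\<theta> i) = uvec (\<phi> i + (\<psi> i - \<phi> i))"
      by (rule plane_eqI) (simp_all only: uvec_nth \<theta>_def cos_add[of _ "\<alpha> i"] sin_add[of _ "\<alpha> i"] 
          \<alpha>(3) c\<alpha>[OF that] cos_add[of _ "\<psi> i - \<phi> i"] sin_add[of _ "\<psi> i - \<phi> i"])
    then show ?thesis by simp
  qed
  have con': "contact S (e i)" if "i \<le> m" for i
    using con[OF that] u[OF that] by (simp add: contact_def e_def)
  have \<alpha>m: "\<alpha> m = \<alpha> 0"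
  proof -
    have "cos (\<psi> m) = cos (\<psi> 0)" "sin (\<psi> m) = sin (\<psi> 0)" using cl(3) uvec_nth by metis+
    then show ?thesis unfolding \<alpha>_def cl(1) by (simp add: sin_diff)
  qed
  have st: "cstep (e i) (e (Suc i))" if i: "i < m" for i
  proof -
    have i': "i \<le> m" "Suc i \<le> m" using i by auto
    define v w where "v = x i - c" and "w = x (Suc i) - c"
    have dd: "norm (w - v) < r" using d[OF i] by (simp add: v_def w_def dist_norm norm_minus_commute)
    have hv: "uvec (\<theta> i) \<bullet> v \<ge> r" and hw: "uvec (\<theta> (Suc i)) \<bullet> w \<ge> r"
      using contact_height[of "\<theta> i" "x i"] contact_height[of "\<theta> (Suc i)" "x (Suc i)"] con'[OF i'(1)] con'[OF i'(2)]
      by (simp_all add: v_def w_def e_def)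
    have "uvec t \<bullet> (w - v) < r" "uvec t \<bullet> (v - w) < r" for t
      using norm_cauchy_schwarz[of "uvec t" "w - v"] norm_cauchy_schwarz[of "uvec t" "v - w"] dd
      by (simp_all add: norm_minus_commute)
    then have hv': "uvec (\<theta> (Suc i)) \<bullet> v > 0" and hw': "uvec (\<theta> i) \<bullet> w > 0"
      using hv hw by (simp_all add: inner_diff_right) (smt (verit))+
    have sv: "uvec (\<theta> i) \<bullet> w \<le> uvec (\<theta> i) \<bullet> v" and sw: "uvec (\<theta> (Suc i)) \<bullet> v \<le> uvec (\<theta> (Suc i)) \<bullet> w"
      using con'[OF i'(1)] con'[OF i'(2)] by (simp_all add: contact_def e_def v_def w_def inner_diff_right)
    have cp: "cross2 v w > 0"
    proof -
      have "cross2 v w = norm v * norm w * sin (\<phi> (Suc i) - \<phi> i)"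
        using pol[OF i'(1)] pol[OF i'(2)] cross2_scale cross2_uvec unfolding v_def w_def by metis
      then show ?thesis using npos i' inc[OF i] by (simp add: v_def w_def sin_gt_zero)
    qed
    have "cross2 v w * sin (\<theta> (Suc i) - \<theta> i) \<ge> 0"
      unfolding cross2_mult_sin using sv sw hv' hw' r_pos hv hw mult_mono[OF sw sv] by (simp add: mult.commute)
    then have sin0: "sin (\<theta> (Suc i) - \<theta> i) \<ge> 0" using cp by (simp add: zero_le_mult_iff)
    \<comment> \<open>In this range a nonnegative sine leaves only the closed interval from 0 to
      \<open>pi\<close>. The value \<open>pi\<close> would make the normals opposite, although both
      have positive inner product with \<open>v\<close>.\<close>
    have rng: "- pi < \<theta> (Suc i) - \<theta> i" "\<theta> (Suc i) - \<theta> i < 2 * pi"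
      using \<alpha>[of i] \<alpha>[of "Suc i"] inc[OF i] by (auto simp: \<theta>_def)
    have le: "\<theta> i \<le> \<theta> (Suc i)"
    proof (rule ccontr)
      assume "\<not> ?thesis"
      then have "sin (\<theta> i - \<theta> (Suc i)) > 0" using rng by (intro sin_gt_zero) auto
      then show False using sin0 sin_minus[of "\<theta> i - \<theta> (Suc i)"] by simp
    qed
    have "\<theta> (Suc i) - \<theta> i \<le> pi"
    proof (rule ccontr)
      assume "\<not> ?thesis"
      then have "sin (\<theta> (Suc i) - \<theta> i) < 0" using rng sin_lt_zero by auto
      then show False using sin0 by simp
    qed
    moreover have "\<theta> (Suc i) - \<theta> i \<noteq> pi"
    proof
      assume "\<theta> (Suc i) - \<theta> i = pi"
      then have "\<theta> (Suc i) = \<theta> i + pi" by simp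
      then have "uvec (\<theta> (Suc i)) = - uvec (\<theta> i)" by (simp only: uvec_add_pi)
      then show False using hv hv' r_pos by simp
    qed
    moreover have "uvec (\<theta> i + pi/2) \<bullet> x i \<le> uvec (\<theta> i + pi/2) \<bullet> x (Suc i)" if eq: "\<theta> i = \<theta> (Suc i)"
    proof -
      have "uvec (\<theta> i) \<bullet> w = uvec (\<theta> i) \<bullet> v" using sv sw eq by simp
      then have "cross2 v w = (uvec (\<theta> i) \<bullet> v) * (uvec (\<theta> i + pi/2) \<bullet> w - uvec (\<theta> i + pi/2) \<bullet> v)"
        using cross2_frame[of v w "\<theta> i"] by (simp add: algebra_simps)
      then have "uvec (\<theta> i + pi/2) \<bullet> w - uvec (\<theta> i + pi/2) \<bullet> v > 0"
        using cp hv r_pos by (simp add: zero_less_mult_iff)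
      then show ?thesis by (simp add: v_def w_def inner_diff_right)
    qed
    ultimately show ?thesis using le by (auto simp: cstep_def cle_def e_def)
  qed
  have "e m = cshift 1 (e 0)" using \<alpha>m cl by (simp add: e_def cshift_def \<theta>_def)
  then have "closed_chain S e m" using con' st by (auto simp: closed_chain_def open_chain_def)
  then show ?thesis using that[of e] u by (simp add: e_def)
qed

section \<open>The boundary as a closed curve around an interior point\<close>

lemma ball_interior: "ball c r \<subseteq> interior S"
  using inner_ball by (meson interior_maximal ball_subset_cball open_ball subset_trans)

lemma c_interior: "c \<in> interior S"
  using ball_interior r_pos by auto

lemma frontier_ray_unique:
  assumes "x \<in> frontier S" "y \<in> frontier S" "x - c = norm (x - c) *\<^sub>R u" "y - c = norm (y - c) *\<^sub>R u"
  shows "x = y"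
proof -
  note c = c_interior
  have False if xy: "x \<in> frontier S" "y \<in> frontier S" "x - c = norm (x - c) *\<^sub>R u" "y - c = norm (y - c) *\<^sub>R u"
     "norm (x - c) < norm (y - c)" for x y
  proof -
    have y0: "norm (y - c) > 0" using xy(5) norm_ge_zero[of "x - c"] by linarith
    have xc: "x \<noteq> c" using xy(1) c by (auto simp: frontier_def)
    have "x - c = (norm (x - c) / norm (y - c)) *\<^sub>R (norm (y - c) *\<^sub>R u)" using y0 xy(3) by simp
    also have "\<dots> = (norm (x - c) / norm (y - c)) *\<^sub>R (y - c)" using xy(4) by simp
    finally have "x - c = (norm (x - c) / norm (y - c)) *\<^sub>R (y - c)" .
    then have "x = (1 - norm (x - c) / norm (y - c)) *\<^sub>R c + (norm (x - c) / norm (y - c)) *\<^sub>R y"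
      by (simp add: algebra_simps)
    moreover have "norm (x - c) / norm (y - c) < 1" "norm (x - c) / norm (y - c) > 0" using y0 xy(5) xc by simp_all
    moreover have "c \<noteq> y" using y0 by auto
    ultimately have "x \<in> open_segment c y" by (auto simp: in_segment)
    moreover have "y \<in> closure S" using xy(2) by (auto simp: frontier_def)
    ultimately have "x \<in> interior S" using in_interior_closure_convex_segment[OF convex_S c] by blast
    then show False using xy(1) by (auto simp: frontier_def)
  qed
  note f = this
  have "norm (x - c) = norm (y - c)"
    using f[OF assms] f[OF assms(2,1,4,3)] by (meson linorder_less_linear)
  then show ?thesis using assms by (metis diff_add_cancel)
qed

lemma frontier_dist_ge: "x \<in> frontier S \<Longrightarrow> norm (x - c) \<ge> r"
proof (rule ccontr)
  assume x: "x \<in> frontier S" "\<not> norm (x - c) \<ge> r"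
  then have "x \<in> ball c r" by (simp add: dist_norm norm_minus_commute)
  then show False using x(1) ball_interior by (auto simp: frontier_def)
qed

text \<open>A continuous argument of \<open>g - c\<close> exists because the parameter interval is
  contractible. A ray from \<open>c\<close> meets the frontier only once, so the argument is
  injective and hence monotone; more than one full turn would cross the initial ray at an interior
  parameter.\<close>

lemma loop_argument:
  assumes g: "simple_path g" "pathfinish g = pathstart g" "path_image g = frontier S"
  obtains \<phi> where "continuous_on {0..1} \<phi>" 
    "\<And>t. t \<in> {0..1} \<Longrightarrow> g t - c = norm (g t - c) *\<^sub>R uvec (\<phi> t)"
    "(\<forall>s t. 0 \<le> s \<longrightarrow> s < t \<longrightarrow> t \<le> 1 \<longrightarrow> \<phi> s < \<phi> t) \<and> \<phi> 1 = \<phi> 0 + 2 * pi \<or>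
     (\<forall>s t. 0 \<le> s \<longrightarrow> s < t \<longrightarrow> t \<le> 1 \<longrightarrow> \<phi> t < \<phi> s) \<and> \<phi> 1 = \<phi> 0 - 2 * pi"
proof -
  have fr: "g t \<in> frontier S" if "t \<in> {0..1}" for t using g(3) that by (auto simp: path_image_def)
  have cg: "continuous_on {0..1} g" and lf: "loop_free g" using g(1) by (auto simp: simple_path_def path_def)
  have g01: "g 1 = g 0" using g(2) by (simp add: pathfinish_def pathstart_def)
  define F where "F t = Complex ((g t - c) $ 1) ((g t - c) $ 2)" for t
  have "continuous_on {0..1} F"
    unfolding F_def Complex_eq by (intro continuous_intros cg)
  moreover have "F t \<noteq> 0" if "t \<in> {0..1}" for t
  proof
    assume "F t = 0"
    then have "g t = c" by (auto simp: F_def complex_eq_iff intro!: plane_eqI)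
    then show False using frontier_dist_ge[OF fr[OF that]] r_pos by simp
  qed
  moreover have "contractible {0..1::real}" by (intro convex_imp_contractible) simp
  ultimately obtain h where h: "continuous_on {0..1} h" "\<And>t. t \<in> {0..1} \<Longrightarrow> F t = exp (h t)"
    using continuous_logarithm_on_contractible[of "{0..1}" F] by auto
  define \<phi> where "\<phi> t = Im (h t)" for t
  have c\<phi>: "continuous_on {0..1} \<phi>" unfolding \<phi>_def by (intro continuous_intros h)
  have pol: "g t - c = norm (g t - c) *\<^sub>R uvec (\<phi> t)" if t: "t \<in> {0..1}" for t
  proof -
    have "g t - c = exp (Re (h t)) *\<^sub>R uvec (\<phi> t)"
      using arg_cong[OF h(2)[OF t], of Re] arg_cong[OF h(2)[OF t], of Im]
      by (intro plane_eqI) (simp_all add: F_def \<phi>_def Re_exp Im_exp)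
    then show ?thesis by simp
  qed
  have inj: "s = t \<or> s = 0 \<and> t = 1 \<or> s = 1 \<and> t = 0"
    if "s \<in> {0..1}" "t \<in> {0..1}" "uvec (\<phi> s) = uvec (\<phi> t)" for s t
  proof -
    have "g s = g t" using frontier_ray_unique[OF fr[OF that(1)] fr[OF that(2)] pol[OF that(1)]] pol[OF that(2)] that(3) by simp
    then show ?thesis using lf that by (auto simp: loop_free_def)
  qed
  \<comment> \<open>An argument returning to its initial value would take the value halfway between
    those at 0 and 1/2 once on each half of the interval.\<close>
  have ne: "\<phi> 0 \<noteq> \<phi> 1"
  proof
    assume eq: "\<phi> 0 = \<phi> 1"
    define v where "v = (\<phi> 0 + \<phi> (1/2)) / 2"
    have half: "\<phi> (1/2) \<noteq> \<phi> 0" using inj[of "1/2" 0] by auto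
    have "\<exists>s. 0 \<le> s \<and> s \<le> 1/2 \<and> \<phi> s = v"
      using IVT'[of \<phi> 0 v "1/2"] IVT2'[of \<phi> "1/2" v 0] continuous_on_subset[OF c\<phi>, of "{0..1/2}"]
      by (cases "\<phi> 0 \<le> \<phi> (1/2)") (auto simp: v_def)
    moreover have "\<exists>s. 1/2 \<le> s \<and> s \<le> 1 \<and> \<phi> s = v"
      using IVT'[of \<phi> "1/2" v 1] IVT2'[of \<phi> 1 v "1/2"] continuous_on_subset[OF c\<phi>, of "{1/2..1}"] eq
      by (cases "\<phi> 0 \<le> \<phi> (1/2)") (auto simp: v_def)
    ultimately obtain s t where st: "0 \<le> s" "s \<le> 1/2" "\<phi> s = v" "1/2 \<le> t" "t \<le> 1" "\<phi> t = v" by blast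
    have "s = t \<or> s = 0 \<and> t = 1 \<or> s = 1 \<and> t = 0" using inj[of s t] st by simp
    moreover have "s = t \<Longrightarrow> s = 1/2" using st by linarith
    ultimately have "v = \<phi> (1/2) \<or> v = \<phi> 0" using st(3,6) by metis
    then show False using half by (auto simp: v_def field_simps)
  qed
  have "inj_on \<phi> {0..1}"
    using inj ne by (auto simp: inj_on_def) metis
  then have injs: "inj_on \<phi> {a..b}" if "0 \<le> a" "b \<le> 1" for a b
    using that by (auto elim!: inj_on_subset)
  have conts: "continuous_on {a..b} \<phi>" if "0 \<le> a" "b \<le> 1" for a b
    using that by (auto intro: continuous_on_subset[OF c\<phi>])
  have btw: "\<phi> a < \<phi> x \<and> \<phi> x < \<phi> b \<or> \<phi> b < \<phi> x \<and> \<phi> x < \<phi> a" if "0 \<le> a" "a < x" "x < b" "b \<le> 1" for a x b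
    using that by (intro continuous_inj_imp_mono conts injs) auto
  have "uvec (\<phi> 1) = uvec (\<phi> 0)"
  proof -
    have "norm (g 0 - c) *\<^sub>R uvec (\<phi> 1) = norm (g 0 - c) *\<^sub>R uvec (\<phi> 0)"
      using pol[of 1] pol[of 0] g01 by simp
    moreover have "norm (g 0 - c) \<noteq> 0" using frontier_dist_ge[OF fr[of 0]] r_pos by auto
    ultimately show ?thesis by simp
  qed
  then have "sin (\<phi> 1) = sin (\<phi> 0) \<and> cos (\<phi> 1) = cos (\<phi> 0)" by (metis uvec_nth)
  then obtain n :: int where n: "\<phi> 1 = \<phi> 0 + 2 * pi * n" unfolding sin_cos_eq_iff by blast
  have notin: "\<phi> t \<noteq> \<phi> 0 + 2 * pi * k" if "0 < t" "t < 1" for t and k :: int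
    using inj[of t 0] that by auto
  show ?thesis
  proof (cases "\<phi> 0 < \<phi> 1")
    case True
    then have "n \<ge> 1" using n by (simp add: zero_less_mult_iff)
    have "n = 1"
    proof (rule ccontr)
      assume "n \<noteq> 1"
      then have "n \<ge> 2" using \<open>n \<ge> 1\<close> by simp
      then have "2 * pi * 1 < 2 * pi * real_of_int n" by (intro mult_strict_left_mono) auto
      then have lt: "\<phi> 0 + 2 * pi < \<phi> 1" using n by simp
      obtain t where t: "0 \<le> t" "t \<le> 1" "\<phi> t = \<phi> 0 + 2 * pi"
        using IVT'[of \<phi> 0 "\<phi> 0 + 2 * pi" 1] c\<phi> lt by auto
      moreover have "t \<noteq> 0" "t \<noteq> 1" using t lt by auto
      ultimately show False using notin[of t 1] by simp
    qed
    moreover have "\<phi> s < \<phi> t" if "0 \<le> s" "s < t" "t \<le> 1" for s t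
      using btw[of 0 s 1] btw[of 0 t 1] btw[of 0 s t] True that by (cases "s = 0"; cases "t = 1") force+
    ultimately show ?thesis using that[of \<phi>] c\<phi> pol n by simp
  next
    case False
    then have lt10: "\<phi> 1 < \<phi> 0" using ne by simp
    then have "n \<le> -1" using n by (simp add: mult_less_0_iff)
    have "n = -1"
    proof (rule ccontr)
      assume "n \<noteq> -1"
      then have "n \<le> -2" using \<open>n \<le> -1\<close> by simp
      then have "2 * pi * real_of_int n < 2 * pi * (-1)" by (intro mult_strict_left_mono) auto
      then have lt: "\<phi> 1 < \<phi> 0 - 2 * pi" using n by simp
      obtain t where t: "0 \<le> t" "t \<le> 1" "\<phi> t = \<phi> 0 - 2 * pi"
        using IVT2'[of \<phi> 1 "\<phi> 0 - 2 * pi" 0] c\<phi> lt by auto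
      moreover have "t \<noteq> 0" "t \<noteq> 1" using t lt by auto
      ultimately show False using notin[of t "-1"] by simp
    qed
    moreover have "\<phi> t < \<phi> s" if "0 \<le> s" "s < t" "t \<le> 1" for s t
      using btw[of 0 s 1] btw[of 0 t 1] btw[of 0 s t] lt10 that by (cases "s = 0"; cases "t = 1") force+
    ultimately show ?thesis using that[of \<phi>] c\<phi> pol n by simp
  qed
qed

end

section \<open>The affine perimeter as an infimum over chains\<close>

definition tangent_line :: "real \<Rightarrow> plane \<Rightarrow> plane set" where
  "tangent_line t x = {p. uvec t \<bullet> p = uvec t \<bullet> x}"

lemma supporting_line_contact:
  assumes "supporting_line S x d"
  obtains t where "contact S (t, x)" "d = tangent_line t x"
proof -
  obtain a where a: "x \<in> S" "a \<noteq> 0" "d = {p. a \<bullet> p = a \<bullet> x}" "\<forall>p\<in>S. a \<bullet> p \<le> a \<bullet> x"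
    using assms by (auto simp: supporting_line_def)
  obtain t where t: "a = norm a *\<^sub>R uvec t" by (rule polar_plane)
  have ae: "a \<bullet> p = norm a * (uvec t \<bullet> p)" for p by (subst t) simp
  have n: "norm a > 0" using a(2) by simp
  then have "contact S (t, x)" using a(1,4) unfolding ae by (simp add: contact_def)
  moreover have "d = tangent_line t x" using a(3) n unfolding ae by (simp add: tangent_line_def)
  ultimately show ?thesis using that by blast
qed

context fat_body
begin

section \<open>From subdivisions to chains\<close>

lemma tangent_line_eq_uvec:
  assumes "contact S (t, x)" "contact S (t', x)" "tangent_line t x = tangent_line t' x"
  shows "uvec t = uvec t'"
proof -
  have "x + uvec (t + pi/2) \<in> tangent_line t x"
    by (simp add: tangent_line_def inner_add_right)
  then have "sin (t' - t) = 0" unfolding assms(3) by (simp add: tangent_line_def inner_add_right)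
  then have "uvec t' = uvec t \<or> uvec t' = - uvec t" by (rule uvec_parallel)
  moreover have "uvec t' \<noteq> - uvec t"
    using contact_height[OF assms(1)] contact_height[OF assms(2)] r_pos by auto
  ultimately show ?thesis by simp
qed

lemma closed_chain_of_sequence:
  fixes x y :: "nat \<Rightarrow> plane" and \<psi> \<phi> :: "nat \<Rightarrow> real"
  assumes con: "\<And>i. i \<le> m \<Longrightarrow> contact S (\<psi> i, x i)"
    and pol: "\<And>i. i \<le> m \<Longrightarrow> x i - c = norm (x i - c) *\<^sub>R uvec (\<phi> i)"
    and inc: "\<And>i. i < m \<Longrightarrow> \<phi> i < \<phi> (Suc i)" "\<And>i. i < m \<Longrightarrow> \<phi> (Suc i) - \<phi> i < pi"
    and cl: "\<phi> m = \<phi> 0 + 2 * pi" "x m = x 0" "uvec (\<psi> m) = uvec (\<psi> 0)"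
    and d: "\<And>i. i < m \<Longrightarrow> dist (x i) (x (Suc i)) \<le> d" "d < r"
    and y: "\<And>i. i < m \<Longrightarrow> if tangent_line (\<psi> i) (x i) = tangent_line (\<psi> (Suc i)) (x (Suc i))
        then y i \<in> closed_segment (x i) (x (Suc i))
        else tangent_line (\<psi> i) (x i) \<inter> tangent_line (\<psi> (Suc i)) (x (Suc i)) = {y i}"
  obtains e where "closed_chain S e m"
    "(\<Sum>i<m. root 3 (triangle_area (x i) (y i) (x (Suc i)))) = chain_sum e m"
    "\<And>i. i < m \<Longrightarrow> cell (e i) (e (Suc i)) \<le> root 3 (d\<^sup>2 * (R\<^sup>2 / (2 * r\<^sup>2)))"
proof -
  obtain e where e: "closed_chain S e m" "\<And>i. i \<le> m \<Longrightarrow> snd (e i) = x i"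
    "\<And>i. i \<le> m \<Longrightarrow> uvec (fst (e i)) = uvec (\<psi> i)"
    using closed_chain_from_arguments[OF con pol inc cl] d by (metis le_less_trans)
  have ce: "contact S (e i)" if "i \<le> m" for i using e(1) that by (auto simp: closed_chain_def open_chain_def)
  have se: "cstep (e i) (e (Suc i))" if "i < m" for i using e(1) that by (auto simp: closed_chain_def open_chain_def)
  have tl: "tangent_line (\<psi> i) (x i) = {p. uvec (fst (e i)) \<bullet> p = uvec (fst (e i)) \<bullet> snd (e i)}" if "i \<le> m" for i
    using e(2,3)[OF that] by (simp add: tangent_line_def)
  have "root 3 (triangle_area (x i) (y i) (x (Suc i))) = cell (e i) (e (Suc i))" if i: "i < m" for i
  proof -
    have i': "i \<le> m" "Suc i \<le> m" using i by auto
    show ?thesis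
    proof (cases "tangent_line (\<psi> i) (x i) = tangent_line (\<psi> (Suc i)) (x (Suc i))")
      \<comment> \<open>The apex is an arbitrary point of the chord here, so the triangle is
        degenerate; the cell vanishes too, because the next point lies on the tangent at the
        previous one.\<close>
      case True
      then have "y i \<in> closed_segment (x i) (x (Suc i))" using y[OF i] by simp
      then obtain u where yi: "y i = (1 - u) *\<^sub>R x i + u *\<^sub>R x (Suc i)" by (auto simp: in_segment)
      have "triangle_area (x i) (y i) (x (Suc i)) = 0"
        unfolding yi by (simp add: measure_triangle cross2_def algebra_simps)
      moreover have "x (Suc i) \<in> tangent_line (\<psi> i) (x i)" unfolding True by (simp add: tangent_line_def)
      then have "gap (e (Suc i)) (e i) = 0" using tl[OF i'(1)] e(2)[OF i'(2)]
        by (simp add: gap_def inner_diff_right)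
      ultimately show ?thesis by (simp add: cell_def)
    next
      case False
      then have yi: "y i \<in> tangent_line (\<psi> i) (x i)" "y i \<in> tangent_line (\<psi> (Suc i)) (x (Suc i))" using y[OF i] by auto
      have "fst (e i) \<noteq> fst (e (Suc i))"
      proof
        assume eq: "fst (e i) = fst (e (Suc i))"
        have "gap (e i) (e (Suc i)) \<ge> 0" "gap (e (Suc i)) (e i) \<ge> 0"
          using ce[OF i'(1)] ce[OF i'(2)] by (simp_all add: contact_gap_nonneg)
        then have "uvec (fst (e i)) \<bullet> snd (e i) = uvec (fst (e i)) \<bullet> snd (e (Suc i))"
          using eq by (simp add: gap_def inner_diff_right)
        then show False using False tl[OF i'(1)] tl[OF i'(2)] eq by simp
      qed
      then have "sin (fst (e (Suc i)) - fst (e i)) > 0"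
        using se[OF i] by (intro sin_gt_zero) (auto simp: cstep_def cle_def)
      then have "root 3 (triangle_area (snd (e i)) (y i) (snd (e (Suc i)))) = cell (e i) (e (Suc i))"
        using yi tl i' ce by (intro triangle_area_cell contact_gap_nonneg[of S]) auto
      then show ?thesis using e(2) i' by simp
    qed
  qed
  then have "(\<Sum>i<m. root 3 (triangle_area (x i) (y i) (x (Suc i)))) = chain_sum e m"
    by (simp add: chain_sum_def)
  moreover have "cell (e i) (e (Suc i)) \<le> root 3 (d\<^sup>2 * (R\<^sup>2 / (2 * r\<^sup>2)))" if "i < m" for i
  proof (rule cell_small)
    show "contact S (e i)" "contact S (e (Suc i))" using ce that by auto
    show "sin (fst (e (Suc i)) - fst (e i)) \<ge> 0"
      using se[OF that] cle_fst[of "e i"] by (intro sin_ge_zero) (auto simp: cstep_def)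
    show "dist (snd (e i)) (snd (e (Suc i))) \<le> d" "d < r" using d e(2) that by auto
  qed
  ultimately show ?thesis using that[OF e(1)] by blast
qed

text \<open>Boundary points in opposite directions from \<open>c\<close> are at least
  \<open>2 * r\<close> apart, so an arc of diameter below \<open>r\<close> contains no such pair,
  and by the intermediate value theorem the position angle turns by less than \<open>pi\<close> on
  it. This needs the whole arc and not only its chord. A clockwise loop is read backwards.\<close>

lemma subdivision_chain:
  assumes P: "subdivision_of S P" and mesh: "mesh P < r"
  obtains e where "closed_chain S e (size_of P)" "triangle_sum P = chain_sum e (size_of P)"
    "\<And>i. i < size_of P \<Longrightarrow> cell (e i) (e (Suc i)) \<le> root 3 ((mesh P)\<^sup>2 * (R\<^sup>2 / (2 * r\<^sup>2)))"
proof -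
  define m x where "m = size_of P" and "x = point P"
  have loop: "simple_path (loop P)" "pathfinish (loop P) = pathstart (loop P)" "path_image (loop P) = frontier S"
    and par: "param P 0 = 0" "param P m = 1" "\<And>i. i < m \<Longrightarrow> param P i < param P (Suc i)"
    and sup: "\<And>i. i \<le> m \<Longrightarrow> supporting_line S (x i) (tangent P i)"
    and tm: "tangent P m = tangent P 0"
    and apex: "\<And>i. i < m \<Longrightarrow> if tangent P i = tangent P (Suc i)
        then apex P i \<in> closed_segment (x i) (x (Suc i))
        else tangent P i \<inter> tangent P (Suc i) = {apex P i}"
    using P by (simp_all add: subdivision_of_def m_def x_def)
  have xm: "x m = x 0" using loop(2) par(1,2) by (simp add: x_def point_def pathfinish_def pathstart_def)
  have "\<forall>i. \<exists>t. i \<le> m \<longrightarrow> contact S (t, x i) \<and> tangent P i = tangent_line t (x i)"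
    using sup supporting_line_contact by metis
  then obtain \<psi> where \<psi>: "\<And>i. i \<le> m \<Longrightarrow> contact S (\<psi> i, x i) \<and> tangent P i = tangent_line (\<psi> i) (x i)" by metis
  have um: "uvec (\<psi> m) = uvec (\<psi> 0)"
    using \<psi>[of m] \<psi>[of 0] xm tm by (intro tangent_line_eq_uvec[of _ "x 0"]) auto
  have parle: "param P i \<le> param P j" if "i \<le> j" "j \<le> m" for i j
    using that
  proof (induction j)
    case (Suc j)
    then show ?case using par(3)[of j] by (cases "i = Suc j") force+
  qed simp
  have par01: "0 \<le> param P i" "param P i \<le> 1" if "i \<le> m" for i
    using parle[of 0 i] parle[of i m] par(1,2) that by auto
  have arc: "dist (loop P s) (loop P t) \<le> mesh P" if "i < m" "s \<in> {param P i..param P (Suc i)}" "t \<in> {param P i..param P (Suc i)}" for i s t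
  proof -
    let ?D = "\<lambda>i. diameter (loop P ` {param P i..param P (Suc i)})"
    have "loop P ` {param P i..param P (Suc i)} \<subseteq> S"
    proof -
      have "{param P i..param P (Suc i)} \<subseteq> {0..1}" using par01[of i] par01[of "Suc i"] that(1) by auto
      then have "loop P ` {param P i..param P (Suc i)} \<subseteq> frontier S" using loop(3) by (auto simp: path_image_def)
      then show ?thesis using compact_S by (meson compact_imp_closed frontier_subset_closed subset_trans)
    qed
    then have "bounded (loop P ` {param P i..param P (Suc i)})"
      using compact_S bounded_subset compact_imp_bounded by blast
    then have "dist (loop P s) (loop P t) \<le> ?D i" using that by (intro diameter_bounded_bound) auto
    also have "\<dots> \<le> mesh P" unfolding mesh_def using that(1) by (intro Max_ge) (auto simp: m_def)
    finally show ?thesis .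
  qed
  obtain \<phi> where \<phi>: "continuous_on {0..1} \<phi>" 
    "\<And>t. t \<in> {0..1} \<Longrightarrow> loop P t - c = norm (loop P t - c) *\<^sub>R uvec (\<phi> t)"
    "(\<forall>s t. 0 \<le> s \<longrightarrow> s < t \<longrightarrow> t \<le> 1 \<longrightarrow> \<phi> s < \<phi> t) \<and> \<phi> 1 = \<phi> 0 + 2 * pi \<or>
     (\<forall>s t. 0 \<le> s \<longrightarrow> s < t \<longrightarrow> t \<le> 1 \<longrightarrow> \<phi> t < \<phi> s) \<and> \<phi> 1 = \<phi> 0 - 2 * pi"
    using loop_argument[OF loop] by blast
  have not_opp: "uvec (\<phi> t) \<noteq> - uvec (\<phi> (param P i))" if i: "i < m" and t: "t \<in> {param P i..param P (Suc i)}" for i t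
  proof
    assume u: "uvec (\<phi> t) = - uvec (\<phi> (param P i))"
    have t01: "t \<in> {0..1}" "param P i \<in> {0..1}" using t par01[of i] par01[of "Suc i"] i by auto
    define a b where "a = norm (loop P t - c)" and "b = norm (loop P (param P i) - c)"
    have ab: "a \<ge> r" "b \<ge> r"
      unfolding a_def b_def using t01 loop(3) by (auto intro!: frontier_dist_ge simp: path_image_def)
    have "loop P t - loop P (param P i) = (loop P t - c) - (loop P (param P i) - c)" by simp
    also have "\<dots> = - ((a + b) *\<^sub>R uvec (\<phi> (param P i)))"
      unfolding \<phi>(2)[OF t01(1), folded a_def] \<phi>(2)[OF t01(2), folded b_def] u by (simp add: algebra_simps)
    finally have "dist (loop P t) (loop P (param P i)) = \<bar>a + b\<bar>" by (simp add: dist_norm)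
    moreover have "dist (loop P t) (loop P (param P i)) \<le> mesh P" using t i par(3)[OF i] by (intro arc[OF i]) auto
    ultimately show False using ab mesh r_pos by linarith
  qed
  have cont: "continuous_on {param P i..param P (Suc i)} \<phi>" if "i < m" for i
    using par01[of i] par01[of "Suc i"] that by (intro continuous_on_subset[OF \<phi>(1)]) auto
  have pol: "x i - c = norm (x i - c) *\<^sub>R uvec (\<phi> (param P i))" if "i \<le> m" for i
    using \<phi>(2)[of "param P i"] par01 that by (simp add: x_def point_def)
  have dx: "dist (x i) (x (Suc i)) \<le> mesh P" if "i < m" for i
    unfolding x_def point_def using par(3)[OF that] by (intro arc[OF that]) auto
  have y: "if tangent_line (\<psi> i) (x i) = tangent_line (\<psi> (Suc i)) (x (Suc i))
        then apex P i \<in> closed_segment (x i) (x (Suc i))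
        else tangent_line (\<psi> i) (x i) \<inter> tangent_line (\<psi> (Suc i)) (x (Suc i)) = {apex P i}" if "i < m" for i
    using apex[OF that] \<psi>[THEN conjunct2, of i] \<psi>[THEN conjunct2, of "Suc i"] that by (simp split: if_splits)
  have ts: "triangle_sum P = (\<Sum>i<m. root 3 (triangle_area (x i) (apex P i) (x (Suc i))))"
    by (simp add: triangle_sum_def m_def x_def)
  from \<phi>(3) show ?thesis
  proof
    assume inc: "(\<forall>s t. 0 \<le> s \<longrightarrow> s < t \<longrightarrow> t \<le> 1 \<longrightarrow> \<phi> s < \<phi> t) \<and> \<phi> 1 = \<phi> 0 + 2 * pi"
    have i1: "\<phi> (param P i) < \<phi> (param P (Suc i))" if "i < m" for i
      using inc par(3)[OF that] par01[of i] par01[of "Suc i"] that by auto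
    have i2: "\<phi> (param P (Suc i)) - \<phi> (param P i) < pi" if im: "i < m" for i
    proof (rule ccontr)
      assume "\<not> ?thesis"
      then obtain t where "t \<in> {param P i..param P (Suc i)}" "\<phi> t = \<phi> (param P i) + pi"
        using IVT'[of \<phi> "param P i" "\<phi> (param P i) + pi" "param P (Suc i)"] cont[OF im] par(3)[OF im] by auto
      then show False using not_opp[OF im] uvec_add_pi by metis
    qed
    obtain e where "closed_chain S e m"
      "(\<Sum>i<m. root 3 (triangle_area (x i) (apex P i) (x (Suc i)))) = chain_sum e m"
      "\<And>i. i < m \<Longrightarrow> cell (e i) (e (Suc i)) \<le> root 3 ((mesh P)\<^sup>2 * (R\<^sup>2 / (2 * r\<^sup>2)))"
      by (rule closed_chain_of_sequence[of m \<psi> x "\<lambda>i. \<phi> (param P i)" "mesh P" "apex P"])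
         (use \<psi> pol i1 i2 inc par(1,2) xm um dx mesh y in auto)
    then show ?thesis using that ts by (auto simp: m_def)
  next
    assume dec: "(\<forall>s t. 0 \<le> s \<longrightarrow> s < t \<longrightarrow> t \<le> 1 \<longrightarrow> \<phi> t < \<phi> s) \<and> \<phi> 1 = \<phi> 0 - 2 * pi"
    have i1: "\<phi> (param P (Suc i)) < \<phi> (param P i)" if "i < m" for i
      using dec par(3)[OF that] par01[of i] par01[of "Suc i"] that by auto
    have i2: "\<phi> (param P i) - \<phi> (param P (Suc i)) < pi" if im: "i < m" for i
    proof (rule ccontr)
      assume "\<not> ?thesis"
      then obtain t where t: "t \<in> {param P i..param P (Suc i)}" "\<phi> t = \<phi> (param P i) - pi"
        using IVT2'[of \<phi> "param P (Suc i)" "\<phi> (param P i) - pi" "param P i"] cont[OF im] par(3)[OF im] by auto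
      then have "uvec (\<phi> (param P i)) = - uvec (\<phi> t)" using uvec_add_pi[of "\<phi> t"] by simp
      then show False using not_opp[OF im t(1)] by simp
    qed
    have S: "m - i = Suc (m - Suc i)" if "i < m" for i using that by simp
    \<comment> \<open>Reversal exchanges the ends of each triangle and sends the one with index
      \<open>m - Suc i\<close> to position \<open>i\<close>.\<close>
    obtain e where e: "closed_chain S e m"
      "(\<Sum>i<m. root 3 (triangle_area (x (m - i)) (apex P (m - Suc i)) (x (m - Suc i)))) = chain_sum e m"
      "\<And>i. i < m \<Longrightarrow> cell (e i) (e (Suc i)) \<le> root 3 ((mesh P)\<^sup>2 * (R\<^sup>2 / (2 * r\<^sup>2)))"
    proof (rule closed_chain_of_sequence[of m "\<lambda>i. \<psi> (m - i)" "\<lambda>i. x (m - i)" "\<lambda>i. \<phi> (param P (m - i))" "mesh P"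
          "\<lambda>i. apex P (m - Suc i)"], goal_cases)
      case (3 i) then show ?case using i1[of "m - Suc i"] S[of i] by simp
    next
      case (4 i) then show ?case using i2[of "m - Suc i"] S[of i] by simp
    next
      case (8 i) then show ?case using dx[of "m - Suc i"] S[of i] by (simp add: dist_commute)
    next
      case (10 i) then show ?case using y[of "m - Suc i"] S[of i] by (simp add: closed_segment_commute Int_commute eq_commute)
    qed (use \<psi> pol dec par(1,2) xm um mesh in auto)
    have "(\<Sum>i<m. root 3 (triangle_area (x (m - i)) (apex P (m - Suc i)) (x (m - Suc i))))
        = (\<Sum>i<m. root 3 (triangle_area (x (Suc (m - Suc i))) (apex P (m - Suc i)) (x (m - Suc i))))"
      by (intro sum.cong refl) (simp add: S)
    also have "\<dots> = (\<Sum>i<m. root 3 (triangle_area (x (Suc i)) (apex P i) (x i)))"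
      by (rule sum.nat_diff_reindex)
    also have "\<dots> = triangle_sum P" unfolding ts by (simp add: triangle_area_swap)
    finally show ?thesis using that e by (auto simp: m_def)
  qed
qed

lemma triangle_sums_tendsto:
  assumes P: "\<And>n. subdivision_of S (P n)" and mesh: "(\<lambda>n. mesh (P n)) \<longlonglongrightarrow> 0"
  shows "(\<lambda>n. triangle_sum (P n)) \<longlonglongrightarrow> half_perimeter S"
proof -
  have fine: "eventually (\<lambda>n. mesh (P n) < r) sequentially"
    using mesh r_pos by (rule order_tendstoD(2))
  have "\<exists>e. mesh (P n) < r \<longrightarrow> closed_chain S e (size_of (P n)) \<and> triangle_sum (P n) = chain_sum e (size_of (P n)) \<and>
    (\<forall>i<size_of (P n). cell (e i) (e (Suc i)) \<le> root 3 ((mesh (P n))\<^sup>2 * (R\<^sup>2 / (2 * r\<^sup>2))))" for n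
    using subdivision_chain[OF P[of n]] by metis
  then obtain e where e: "\<And>n. mesh (P n) < r \<Longrightarrow> closed_chain S (e n) (size_of (P n)) \<and> triangle_sum (P n) = chain_sum (e n) (size_of (P n)) \<and>
    (\<forall>i<size_of (P n). cell (e n i) (e n (Suc i)) \<le> root 3 ((mesh (P n))\<^sup>2 * (R\<^sup>2 / (2 * r\<^sup>2))))"
    by metis
  have "(\<lambda>n. chain_sum (e n) (size_of (P n))) \<longlonglongrightarrow> half_perimeter S"
  proof (rule chain_sums_tendsto)
    show "eventually (\<lambda>n. closed_chain S (e n) (size_of (P n))) sequentially"
      using fine by eventually_elim (use e in blast)
    fix \<delta> :: real assume "\<delta> > 0"
    have "(\<lambda>n. root 3 ((mesh (P n))\<^sup>2 * (R\<^sup>2 / (2 * r\<^sup>2)))) \<longlonglongrightarrow> root 3 (0\<^sup>2 * (R\<^sup>2 / (2 * r\<^sup>2)))"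
      by (intro tendsto_intros mesh)
    then have "eventually (\<lambda>n. root 3 ((mesh (P n))\<^sup>2 * (R\<^sup>2 / (2 * r\<^sup>2))) < \<delta>) sequentially"
      using \<open>\<delta> > 0\<close> by (intro order_tendstoD(2)) auto
    with fine show "eventually (\<lambda>n. \<forall>i<size_of (P n). cell (e n i) (e n (Suc i)) \<le> \<delta>) sequentially"
      by eventually_elim (use e in force)
  qed
  moreover have "eventually (\<lambda>n. chain_sum (e n) (size_of (P n)) = triangle_sum (P n)) sequentially"
    using fine by eventually_elim (use e in auto)
  ultimately show ?thesis by (rule Lim_transform_eventually)
qed

section \<open>Existence of arbitrarily fine subdivisions\<close>

lemma frontier_contact:
  assumes "x \<in> frontier S"
  obtains t where "contact S (t, x)"
proof -
  have cl: "closure S = S" using compact_S by (simp add: compact_imp_closed)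
  have xS: "x \<in> S" using assms cl by (auto simp: frontier_def)
  have "interior S \<noteq> {}" using c_interior by blast
  then have "x \<notin> rel_interior S" using assms by (auto simp: rel_interior_nonempty_interior frontier_def)
  then obtain a where a: "a \<noteq> 0" "\<And>y. y \<in> S \<Longrightarrow> a \<bullet> x \<le> a \<bullet> y"
    using supporting_hyperplane_relative_frontier[OF convex_S, of x] xS cl by metis
  have "supporting_line S x {p. (- a) \<bullet> p = (- a) \<bullet> x}"
    unfolding supporting_line_def using a xS by (intro conjI exI[of _ "- a"]) auto
  then show ?thesis using supporting_line_contact that by blast
qed

lemma boundary_loop:
  obtains g where "simple_path g" "pathfinish g = pathstart g" "path_image g = frontier S"
proof -
  have ne: "interior S \<noteq> {}" using c_interior by blast
  have "rel_frontier (ball 0 1 :: plane set) homeomorphic rel_frontier S"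
    using ne compact_S convex_S
    by (intro homeomorphic_rel_frontiers_convex_bounded_sets)
       (auto simp: compact_imp_bounded aff_dim_nonempty_interior)
  then have "sphere (0::plane) 1 homeomorphic frontier S"
    using ne by (simp add: rel_frontier_nonempty_interior)
  then obtain h k where hk: "homeomorphism (sphere (0::plane) 1) (frontier S) h k"
    by (auto simp: homeomorphic_def)
  define u where "u t = uvec (2 * pi * t)" for t
  define g where "g = h \<circ> u"
  have u1: "u t \<in> sphere 0 1" for t by (simp add: u_def)
  have cu: "continuous_on {0..1} u"
  proof -
    have "u = (\<lambda>t. \<chi> i. if i = 1 then cos (2 * pi * t) else sin (2 * pi * t))"
      by (auto simp: u_def vec_eq_iff forall_2)
    moreover have "continuous_on {0..1} (\<lambda>t. \<chi> i. if i = 1 then cos (2 * pi * t) else sin (2 * pi * t) :: plane)"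
    proof (rule continuous_on_vec_lambda)
      fix i :: 2
      show "continuous_on {0..1} (\<lambda>t. if i = 1 then cos (2 * pi * t) else sin (2 * pi * t))"
        by (cases "i = 1") (auto intro!: continuous_intros)
    qed
    ultimately show ?thesis by simp
  qed
  have us: "u ` {0..1} = sphere 0 1"
  proof
    show "sphere 0 1 \<subseteq> u ` {0..1}"
    proof
      fix v :: plane assume "v \<in> sphere 0 1"
      then have n: "norm v = 1" by simp
      obtain t where t: "0 \<le> t" "t < 2 * pi" "v = norm v *\<^sub>R uvec t" by (rule polar_plane)
      then have "v = u (t / (2 * pi))" "t / (2*pi) \<in> {0..1}" using n by (auto simp: u_def)
      then show "v \<in> u ` {0..1}" by blast
    qed
  qed (use u1 in auto)
  have "path g" unfolding g_def path_def
    using cu hk us by (intro continuous_on_compose) (auto simp: homeomorphism_def)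
  moreover have "loop_free g"
    unfolding loop_free_def
  proof (intro ballI impI)
    fix s t :: real assume st: "s \<in> {0..1}" "t \<in> {0..1}" "g s = g t"
    have "k (g s) = u s" "k (g t) = u t" using hk u1 by (simp_all add: g_def homeomorphism_apply1)
    then have "u s = u t" using st(3) by simp
    then have "sin (2 * pi * s) = sin (2 * pi * t) \<and> cos (2 * pi * s) = cos (2 * pi * t)"
      by (metis u_def uvec_nth)
    then obtain n :: int where "2 * pi * s = 2 * pi * t + 2 * pi * n" unfolding sin_cos_eq_iff by blast
    then have "2 * pi * s = 2 * pi * (t + n)" by (simp add: algebra_simps)
    then have "s = t + n" by simp
    moreover have "n = 0 \<or> n = 1 \<or> n = -1"
    proof -
      have "real_of_int n \<le> 1" "real_of_int n \<ge> -1" using st \<open>s = t + n\<close> by auto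
      then have "n \<le> 1" "n \<ge> -1" by linarith+
      then show ?thesis by linarith
    qed
    ultimately show "s = t \<or> s = 0 \<and> t = 1 \<or> s = 1 \<and> t = 0" using st by auto
  qed
  moreover have "pathfinish g = pathstart g"
    using uvec_periodic[of 0] by (simp add: g_def pathfinish_def pathstart_def u_def)
  moreover have "path_image g = frontier S"
    using us hk by (simp only: g_def path_image_def image_comp[symmetric] homeomorphism_def)
  ultimately show ?thesis using that by (auto simp: simple_path_def)
qed

text \<open>Without any such sequence every number would satisfy the condition in
  \<open>affine_perimeter\<close>, and the description would not single out a value.\<close>

lemma fine_subdivisions:
  obtains P where "\<And>n. subdivision_of S (P n)" "filterlim (\<lambda>n. size_of (P n)) at_top sequentially"
    "(\<lambda>n. mesh (P n)) \<longlonglongrightarrow> 0"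
proof -
  obtain g where g: "simple_path g" "pathfinish g = pathstart g" "path_image g = frontier S"
    by (rule boundary_loop)
  have fr: "g t \<in> frontier S" if "t \<in> {0..1}" for t using g(3) that by (auto simp: path_image_def)
  have g01: "g 1 = g 0" using g(2) by (simp add: pathfinish_def pathstart_def)
  have cg: "continuous_on {0..1} g" using g(1) by (auto simp: simple_path_def path_def)
  have uc: "uniformly_continuous_on {0..1} g" by (rule compact_uniformly_continuous[OF cg]) simp
  have "\<exists>\<tau>. t \<in> {0..1} \<longrightarrow> contact S (\<tau>, g t)" for t using frontier_contact[OF fr] by metis
  then obtain \<tau>0 where \<tau>0: "\<And>t. t \<in> {0..1} \<Longrightarrow> contact S (\<tau>0 t, g t)" by metis
  \<comment> \<open>The parameters 0 and 1 give the same point, and a subdivision has to carry the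
    same tangent at both.\<close>
  define \<tau> where "\<tau> t = (if t = 1 then \<tau>0 0 else \<tau>0 t)" for t :: real
  have \<tau>: "contact S (\<tau> t, g t)" if "t \<in> {0..1}" for t using \<tau>0[OF that] \<tau>0[of 0] g01 by (auto simp: \<tau>_def)
  define L where "L t = tangent_line (\<tau> t) (g t)" for t
  have meet: "\<exists>y. L s \<inter> L t = {y}" if st: "s \<in> {0..1}" "t \<in> {0..1}" "dist (g s) (g t) < r" "L s \<noteq> L t" for s t
  proof -
    define s' where "s' = \<tau> t - \<tau> s"
    have hs: "uvec (\<tau> s) \<bullet> (g s - c) \<ge> r" "uvec (\<tau> t) \<bullet> (g t - c) \<ge> r"
      using contact_height \<tau> st by blast+
    have sn: "sin s' \<noteq> 0"
    proof
      assume "sin s' = 0"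
      then have "uvec (\<tau> t) = uvec (\<tau> s) \<or> uvec (\<tau> t) = - uvec (\<tau> s)" unfolding s'_def by (rule uvec_parallel)
      then show False
      proof
        assume eq: "uvec (\<tau> t) = uvec (\<tau> s)"
        have "uvec (\<tau> s) \<bullet> g s = uvec (\<tau> s) \<bullet> g t"
          using \<tau>[OF st(1)] \<tau>[OF st(2)] eq by (auto simp: contact_def intro: antisym)
        then show False using st(4) eq by (simp add: L_def tangent_line_def)
      next
        assume eq: "uvec (\<tau> t) = - uvec (\<tau> s)"
        have "uvec (\<tau> s) \<bullet> (g s - g t) \<ge> 2 * r" using hs eq by (simp add: inner_diff_right)
        moreover have "uvec (\<tau> s) \<bullet> (g s - g t) \<le> norm (g s - g t)" using norm_cauchy_schwarz[of "uvec (\<tau> s)" "g s - g t"] by simp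
        ultimately show False using st(3) r_pos by (simp add: dist_norm)
      qed
    qed
    define D where "D = g t - g s"
    define y where "y = g s + ((uvec (\<tau> t) \<bullet> D) / sin s') *\<^sub>R uvec (\<tau> s + pi/2)"
    have y1: "uvec (\<tau> s) \<bullet> y = uvec (\<tau> s) \<bullet> g s"
      by (simp add: y_def inner_add_right inner_uvec_uvec)
    have y2: "uvec (\<tau> t) \<bullet> y = uvec (\<tau> t) \<bullet> g t"
      using sn by (simp add: y_def inner_add_right D_def inner_diff_right s'_def)
    have "z = y" if "z \<in> L s \<inter> L t" for z
      using that y1 y2 sn unfolding L_def tangent_line_def s'_def
      by (intro uvec_inner_eqI[of "\<tau> t" "\<tau> s"]) simp_all
    moreover have "y \<in> L s \<inter> L t" using y1 y2 by (simp add: L_def tangent_line_def)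
    ultimately show ?thesis by blast
  qed
  have uc': "\<exists>N>0. \<forall>s\<in>{0..1}. \<forall>t\<in>{0..1}. \<bar>s - t\<bar> \<le> 1 / real N \<longrightarrow> dist (g s) (g t) < \<epsilon>" if "\<epsilon> > 0" for \<epsilon>
  proof -
    obtain d where d: "d > 0" "\<And>s t. s \<in> {0..1} \<Longrightarrow> t \<in> {0..1} \<Longrightarrow> dist s t < d \<Longrightarrow> dist (g s) (g t) < \<epsilon>"
      using uc \<open>\<epsilon> > 0\<close> unfolding uniformly_continuous_on_def by metis
    obtain N :: nat where "N > 0" "inverse (of_nat N) < d" using ex_inverse_of_nat_less[OF d(1)] by auto
    then have "\<bar>s - t\<bar> \<le> 1 / real N \<Longrightarrow> dist s t < d" for s t :: real
      by (simp add: dist_real_def inverse_eq_divide)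
    then show ?thesis using d(2) \<open>N > 0\<close> by blast
  qed
  \<comment> \<open>From \<open>N0\<close> pieces on, neighbouring points are closer than
    \<open>r\<close>, so two different tangents there are not parallel and have a unique common
    point.\<close>
  obtain N0 where N0: "N0 > 0" "\<And>s t. s \<in> {0..1} \<Longrightarrow> t \<in> {0..1} \<Longrightarrow> \<bar>s - t\<bar> \<le> 1 / real N0 \<Longrightarrow> dist (g s) (g t) < r"
    using uc'[OF r_pos] by auto
  define Y where "Y s t = (if L s = L t then g s else (SOME y. L s \<inter> L t = {y}))" for s t
  define P where "P n = \<lparr>loop = g, size_of = N0 + n, param = (\<lambda>i. real i / real (N0 + n)),
     tangent = (\<lambda>i. L (real i / real (N0 + n))), apex = (\<lambda>i. Y (real i / real (N0 + n)) (real (Suc i) / real (N0 + n)))\<rparr>" for n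
  have sz: "size_of (P n) = N0 + n" and pp: "param (P n) i = real i / real (N0 + n)" and lp: "loop (P n) = g" for n i by (simp_all add: P_def)
  have in01: "real i / real (N0 + n) \<in> {0..1}" if "i \<le> N0 + n" for i n
    using that N0(1) by (simp add: divide_le_eq)
  have step: "\<bar>s - t\<bar> \<le> 1 / real (N0 + n)"
    if "s \<in> {real i / real (N0 + n)..real (Suc i) / real (N0 + n)}" "t \<in> {real i / real (N0 + n)..real (Suc i) / real (N0 + n)}" for s t i n
  proof -
    have "real (Suc i) / real (N0 + n) = real i / real (N0 + n) + 1 / real (N0 + n)" by (simp add: add_divide_distrib)
    then show ?thesis using that unfolding atLeastAtMost_iff by linarith
  qed
  have sub: "subdivision_of S (P n)" for n
  proof -
    have A: "real i / real (N0 + n) < real (Suc i) / real (N0 + n)" for i using N0(1) by (simp add: divide_strict_right_mono)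
    have B: "supporting_line S (g t) (L t)" if "t \<in> {0..1}" for t
      using \<tau>[OF that] unfolding supporting_line_def L_def tangent_line_def contact_def
      by (intro conjI exI[of _ "uvec (\<tau> t)"]) auto
    have C: "if L (real i / real (N0 + n)) = L (real (Suc i) / real (N0 + n))
        then Y (real i / real (N0 + n)) (real (Suc i) / real (N0 + n)) \<in> closed_segment (g (real i / real (N0 + n))) (g (real (Suc i) / real (N0 + n)))
        else L (real i / real (N0 + n)) \<inter> L (real (Suc i) / real (N0 + n)) = {Y (real i / real (N0 + n)) (real (Suc i) / real (N0 + n))}" 
      if i: "i < N0 + n" for i
    proof (cases "L (real i / real (N0 + n)) = L (real (Suc i) / real (N0 + n))")
      case False
      have "\<bar>real i / real (N0 + n) - real (Suc i) / real (N0 + n)\<bar> \<le> 1 / real N0"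
      proof -
        have "\<bar>real i / real (N0 + n) - real (Suc i) / real (N0 + n)\<bar> \<le> 1 / real (N0 + n)"
          using A[of i] by (intro step) auto
        also have "\<dots> \<le> 1 / real N0" using N0(1) by (simp add: frac_le)
        finally show ?thesis .
      qed
      then have "dist (g (real i / real (N0 + n))) (g (real (Suc i) / real (N0 + n))) < r"
        using in01[of i n] in01[of "Suc i" n] i by (intro N0(2)) auto
      then have "\<exists>y. L (real i / real (N0 + n)) \<inter> L (real (Suc i) / real (N0 + n)) = {y}"
        using in01[of i n] in01[of "Suc i" n] i False by (intro meet) auto
      then have "L (real i / real (N0 + n)) \<inter> L (real (Suc i) / real (N0 + n)) = {Y (real i / real (N0 + n)) (real (Suc i) / real (N0 + n))}"
        unfolding Y_def using False by (simp only: if_False) (rule someI_ex)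
      then show ?thesis using False by simp
    qed (simp add: Y_def)
    have D: "L 1 = L 0" using g01 by (simp add: L_def \<tau>_def)
    show ?thesis
      unfolding subdivision_of_def point_def
      using g N0(1) A B C D in01 by (auto simp: P_def simp del: of_nat_add of_nat_Suc)
  qed
  have "(\<lambda>n. mesh (P n)) \<longlonglongrightarrow> 0"
  proof (rule LIMSEQ_I)
    fix \<epsilon> :: real assume e: "\<epsilon> > 0"
    obtain N where N: "N > 0" "\<And>s t. s \<in> {0..1} \<Longrightarrow> t \<in> {0..1} \<Longrightarrow> \<bar>s - t\<bar> \<le> 1 / real N \<Longrightarrow> dist (g s) (g t) < \<epsilon> / 2"
      using uc'[of "\<epsilon> / 2"] e by auto
    have "norm (mesh (P n) - 0) < \<epsilon>" if n: "n \<ge> N" for n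
    proof -
      let ?A = "\<lambda>i. g ` {real i / real (N0 + n)..real (Suc i) / real (N0 + n)}"
      have mesh: "mesh (P n) = Max ((\<lambda>i. diameter (?A i)) ` {..<N0 + n})" by (simp add: mesh_def sz pp lp)
      have dA: "diameter (?A i) \<le> \<epsilon> / 2" if i: "i < N0 + n" for i
      proof (rule diameter_le)
        show "?A i \<noteq> {} \<or> 0 \<le> \<epsilon> / 2" using e by simp
        fix x y assume "x \<in> ?A i" "y \<in> ?A i"
        then obtain s t where st: "x = g s" "y = g t" "s \<in> {real i / real (N0 + n)..real (Suc i) / real (N0 + n)}"
          "t \<in> {real i / real (N0 + n)..real (Suc i) / real (N0 + n)}" by blast
        have "s \<in> {0..1}" "t \<in> {0..1}" using st(3,4) in01[of i n] in01[of "Suc i" n] i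
          unfolding atLeastAtMost_iff by linarith+
        moreover have "\<bar>s - t\<bar> \<le> 1 / real N"
        proof -
          have "1 / real (N0 + n) \<le> 1 / real N" using N(1) n by (simp add: frac_le)
          then show ?thesis using step[OF st(3,4)] by linarith
        qed
        ultimately show "norm (x - y) \<le> \<epsilon> / 2" using N(2)[of s t] st by (simp add: dist_norm)
      qed
      have "mesh (P n) \<le> \<epsilon> / 2" unfolding mesh using dA N0(1) by (intro Max.boundedI) auto
      moreover have "mesh (P n) \<ge> 0"
      proof -
        have "0 \<le> diameter (?A 0)"
        proof (rule diameter_ge_0)
          have "{real 0 / real (N0 + n)..real (Suc 0) / real (N0 + n)} \<subseteq> {0..1}" using in01[of "Suc 0" n] N0(1) by auto
          then have "?A 0 \<subseteq> frontier S" using fr by auto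
          then show "bounded (?A 0)" using compact_imp_bounded[OF compact_frontier[OF compact_S]] bounded_subset by blast
        qed
        also have "\<dots> \<le> mesh (P n)" unfolding mesh
          using N0(1) by (intro Max_ge imageI) (simp_all del: of_nat_add of_nat_Suc)
        finally show ?thesis .
      qed
      ultimately show ?thesis using e by simp
    qed
    then show "\<exists>N. \<forall>n\<ge>N. norm (mesh (P n) - 0) < \<epsilon>" by blast
  qed
  moreover have "filterlim (\<lambda>n. size_of (P n)) at_top sequentially"
    unfolding sz filterlim_at_top eventually_sequentially by (meson trans_le_add2)
  ultimately show ?thesis using that sub by blast
qed

lemma affine_perimeter_eq_half: "affine_perimeter S = 2 * half_perimeter S"
proof -
  obtain P where P: "\<And>n. subdivision_of S (P n)" "filterlim (\<lambda>n. size_of (P n)) at_top sequentially"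
    "(\<lambda>n. mesh (P n)) \<longlonglongrightarrow> 0"
    using fine_subdivisions by blast
  have "(THE L. \<forall>P :: nat \<Rightarrow> subdivision. (\<forall>n. subdivision_of S (P n)) \<longrightarrow>
     filterlim (\<lambda>n. size_of (P n)) at_top sequentially \<longrightarrow>
     (\<lambda>n. mesh (P n)) \<longlonglongrightarrow> 0 \<longrightarrow> (\<lambda>n. triangle_sum (P n)) \<longlonglongrightarrow> L) = half_perimeter S"
  proof (rule the_equality)
    fix L assume "\<forall>P :: nat \<Rightarrow> subdivision. (\<forall>n. subdivision_of S (P n)) \<longrightarrow>
     filterlim (\<lambda>n. size_of (P n)) at_top sequentially \<longrightarrow>
     (\<lambda>n. mesh (P n)) \<longlonglongrightarrow> 0 \<longrightarrow> (\<lambda>n. triangle_sum (P n)) \<longlonglongrightarrow> L"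
    then have "(\<lambda>n. triangle_sum (P n)) \<longlonglongrightarrow> L" using P by blast
    then show "L = half_perimeter S" using triangle_sums_tendsto[OF P(1,3)] LIMSEQ_unique by blast
  qed (use triangle_sums_tendsto in blast)
  then show ?thesis by (simp add: affine_perimeter_def)
qed

end

lemma convex_body_fat:
  assumes "convex_body S"
  obtains c r R where "fat_body S c r R"
proof -
  obtain c where "c \<in> interior S" using assms by (auto simp: convex_body_def)
  then obtain r where r: "r > 0" "cball c r \<subseteq> S" by (auto simp: mem_interior_cball)
  obtain R where "S \<subseteq> cball c R" using assms bounded_subset_cball compact_imp_bounded
    by (metis convex_body_def bounded_any_center mem_cball subsetI)
  then have "fat_body S c r R" using r assms by unfold_locales (auto simp: convex_body_def)
  then show ?thesis by (rule that)
qed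

lemma affine_perimeter_eq: "convex_body S \<Longrightarrow> affine_perimeter S = 2 * half_perimeter S"
  using convex_body_fat fat_body.affine_perimeter_eq_half by metis

section \<open>Contact configurations with prescribed normals\<close>

lemma mult_strict_mono_disj:
  fixes a b a' b' :: real
  assumes "0 < a" "0 < b" "a \<le> a'" "b \<le> b'" "a < a' \<or> b < b'"
  shows "a * b < a' * b'"
  using assms(5)
proof
  assume "a < a'"
  then show ?thesis using assms by (intro mult_less_le_imp_less) auto
next
  assume "b < b'"
  then show ?thesis using assms by (intro mult_le_less_imp_less) auto
qed

locale fan =
  fixes k :: nat and \<theta> :: "nat \<Rightarrow> real"
  assumes k3: "3 \<le> k" and \<theta>_closed: "\<theta> k = \<theta> 0 + 2 * pi"
    and \<theta>_less: "i < k \<Longrightarrow> \<theta> i < \<theta> (Suc i)" and \<theta>_gap: "i < k \<Longrightarrow> \<theta> (Suc i) - \<theta> i < pi"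
begin

abbreviation u :: "nat \<Rightarrow> plane" where "u i \<equiv> uvec (\<theta> i)"

text \<open>Only the points are read modulo \<open>k\<close>: node \<open>k\<close> is the first
  contact element after one full turn, so the nodes form a closed chain.\<close>

definition node :: "(nat \<Rightarrow> plane) \<Rightarrow> nat \<Rightarrow> real \<times> plane" where
  "node x i = (\<theta> i, x (i mod k))"

definition Phi :: "(nat \<Rightarrow> plane) \<Rightarrow> real" where
  "Phi x = chain_sum (node x) k"

text \<open>Equivalently, the points \<open>x i\<close> are contact points of their own convex hull
  with normals \<open>u i\<close>.\<close>

definition config :: "(nat \<Rightarrow> plane) \<Rightarrow> bool" where
  "config x \<longleftrightarrow> (\<forall>i<k. \<forall>j<k. u i \<bullet> x j \<le> u i \<bullet> x i)"

definition admissible :: "nat set \<Rightarrow> (nat \<Rightarrow> real) \<Rightarrow> (nat \<Rightarrow> plane) \<Rightarrow> bool" where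
  "admissible I h x \<longleftrightarrow> config x \<and> (\<forall>i\<in>I. u i \<bullet> x i \<le> h i)"

definition maximal :: "nat set \<Rightarrow> (nat \<Rightarrow> real) \<Rightarrow> (nat \<Rightarrow> plane) \<Rightarrow> bool" where
  "maximal I h x \<longleftrightarrow> admissible I h x \<and> (\<forall>y. admissible I h y \<longrightarrow> Phi y \<le> Phi x)"

definition nondeg :: "(nat \<Rightarrow> plane) \<Rightarrow> bool" where
  "nondeg x \<longleftrightarrow> (\<forall>i<k. gap (node x i) (node x (Suc i)) > 0 \<and> gap (node x (Suc i)) (node x i) > 0)"

definition mix :: "real \<Rightarrow> (nat \<Rightarrow> plane) \<Rightarrow> (nat \<Rightarrow> plane) \<Rightarrow> nat \<Rightarrow> plane" where
  "mix t x y i = (1 - t) *\<^sub>R x i + t *\<^sub>R y i"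

lemma k_pos [simp]: "0 < k"
  using k3 by simp

lemma sin_gap: "i < k \<Longrightarrow> sin (\<theta> (Suc i) - \<theta> i) > 0"
  using \<theta>_less \<theta>_gap by (intro sin_gt_zero) auto

lemma u_k [simp]: "u k = u 0"
  using \<theta>_closed by simp

lemma u_mod: "i \<le> k \<Longrightarrow> u (i mod k) = u i"
  by (cases "i = k") auto

lemma \<theta>_mono: "i \<le> j \<Longrightarrow> j \<le> k \<Longrightarrow> \<theta> i \<le> \<theta> j"
proof (induction j)
  case (Suc j)
  then show ?case using \<theta>_less[of j] by (cases "i = Suc j") force+
qed simp

lemma \<theta>_strict_mono: "i < j \<Longrightarrow> j \<le> k \<Longrightarrow> \<theta> i < \<theta> j"
  using \<theta>_less[of i] \<theta>_mono[of "Suc i" j] by simp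

lemma fst_node [simp]: "fst (node x i) = \<theta> i" and snd_node [simp]: "snd (node x i) = x (i mod k)"
  by (simp_all add: node_def)

lemma u_decomp: "sin (\<theta> (Suc i) - \<theta> i) * (uvec t \<bullet> v) = sin (\<theta> (Suc i) - t) * (u i \<bullet> v) + sin (t - \<theta> i) * (u (Suc i) \<bullet> v)"
  by (rule inner_uvec_decomp)

lemma angle_cell:
  obtains i and n :: int where "i < k" "\<theta> i \<le> t + 2 * pi * n" "t + 2 * pi * n < \<theta> (Suc i)"
proof -
  obtain n where "cle (\<theta> 0, 0) (cshift n (t, 0))" "cle (cshift n (t, 0)) (cshift 1 (\<theta> 0, 0))"
    by (rule cle_cshift_between)
  then have "\<theta> 0 \<le> t + 2 * pi * n" "t + 2 * pi * n \<le> \<theta> 0 + 2 * pi" by (auto simp: cle_def)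
  then obtain n :: int where n: "\<theta> 0 \<le> t + 2 * pi * n" "t + 2 * pi * n < \<theta> 0 + 2 * pi"
  proof (cases "t + 2 * pi * n = \<theta> 0 + 2 * pi")
    case True
    then have "\<theta> 0 \<le> t + 2 * pi * of_int (n - 1)" "t + 2 * pi * of_int (n - 1) < \<theta> 0 + 2 * pi"
      by (simp_all add: algebra_simps)
    then show ?thesis using that by blast
  qed (use that in force)
  define i where "i = Max {j. j < k \<and> \<theta> j \<le> t + 2 * pi * n}"
  have "i \<in> {j. j < k \<and> \<theta> j \<le> t + 2 * pi * n}" unfolding i_def by (rule Max_in) (use n in \<open>auto intro: exI[of _ 0]\<close>)
  then have i: "i < k" "\<theta> i \<le> t + 2 * pi * n" by auto
  have "t + 2 * pi * n < \<theta> (Suc i)"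
  proof (rule ccontr)
    assume H: "\<not> ?thesis"
    then have "Suc i \<noteq> k" using n \<theta>_closed by auto
    then have "Suc i \<in> {j. j < k \<and> \<theta> j \<le> t + 2 * pi * n}" using H i by auto
    then have "Suc i \<le> i" unfolding i_def by (intro Max_ge) auto
    then show False by simp
  qed
  then show ?thesis using that i by blast
qed

text \<open>The direction of \<open>w\<close> lies in the cone of two consecutive normals. As a
  nonnegative combination of them has positive inner product with \<open>w\<close>, so has one of
  the two.\<close>

lemma spanning:
  assumes "w \<noteq> 0" obtains i where "i < k" "u i \<bullet> w > 0"
proof -
  obtain t where t: "w = norm w *\<^sub>R uvec t" by (rule polar_plane)
  obtain i n where i: "i < k" "\<theta> i \<le> t + 2 * pi * of_int n" "t + 2 * pi * of_int n < \<theta> (Suc i)" by (rule angle_cell)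
  define s where "s = t + 2 * pi * of_int n"
  have s: "w = norm w *\<^sub>R uvec s" using t by (simp add: s_def)
  have "uvec s \<bullet> (norm w *\<^sub>R uvec s) = norm w" by (simp add: inner_uvec_uvec)
  then have "uvec s \<bullet> w > 0" using s assms by simp
  then have "sin (\<theta> (Suc i) - s) * (u i \<bullet> w) + sin (s - \<theta> i) * (u (Suc i) \<bullet> w) > 0"
    using u_decomp[of i s w] sin_gap[OF i(1)] by (metis mult_pos_pos)
  moreover have "sin (\<theta> (Suc i) - s) \<ge> 0" "sin (s - \<theta> i) \<ge> 0"
    using i \<theta>_gap[OF i(1)] by (auto simp: s_def intro!: sin_ge_zero)
  ultimately have "u i \<bullet> w > 0 \<or> u (Suc i) \<bullet> w > 0"
    by (smt (verit) mult_nonneg_nonpos)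
  then show ?thesis
  proof
    assume "u (Suc i) \<bullet> w > 0"
    then show ?thesis using i(1) that[of "Suc i"] that[of 0] by (cases "Suc i = k") auto
  qed (use i that in blast)
qed

lemma config_gap_nonneg:
  assumes "config x" "i \<le> k" "j \<le> k" shows "gap (node x i) (node x j) \<ge> 0"
  using assms u_mod[of j] by (auto simp: config_def gap_def inner_diff_right) (metis k_pos mod_less_divisor)

lemma cell_node: "cell (node x i) (node x (Suc i)) =
    root 3 (gap (node x i) (node x (Suc i)) * gap (node x (Suc i)) (node x i)) / root 3 (2 * sin (\<theta> (Suc i) - \<theta> i))"
  by (simp add: cell_def real_root_divide)

lemma node_cstep: "i < k \<Longrightarrow> cstep (node x i) (node x (Suc i))"
  using \<theta>_less \<theta>_gap by (simp add: cstep_def cle_def)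

lemma config_cell_nonneg: "config x \<Longrightarrow> i < k \<Longrightarrow> cell (node x i) (node x (Suc i)) \<ge> 0"
  by (intro cell_nonneg config_gap_nonneg node_cstep) auto

lemma contact_config: "(\<And>i. i < k \<Longrightarrow> contact S (\<theta> i, x i)) \<Longrightarrow> config x"
  by (auto simp: config_def contact_def)

lemma contact_node: "(\<And>i. i < k \<Longrightarrow> contact S (\<theta> i, x i)) \<Longrightarrow> i \<le> k \<Longrightarrow> contact S (node x i)"
proof -
  assume a: "\<And>i. i < k \<Longrightarrow> contact S (\<theta> i, x i)" "i \<le> k"
  have "contact S (\<theta> (i mod k), x (i mod k))" using a(1) by simp
  then show ?thesis using u_mod[OF a(2)] by (simp add: contact_def node_def)
qed

lemma contact_closed_chain: "(\<And>i. i < k \<Longrightarrow> contact S (\<theta> i, x i)) \<Longrightarrow> closed_chain S (node x) k"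
  unfolding closed_chain_def open_chain_def
  by (auto simp: contact_node node_cstep) (simp add: node_def cshift_def \<theta>_closed)

lemma half_perimeter_le_Phi: "(\<And>i. i < k \<Longrightarrow> contact S (\<theta> i, x i)) \<Longrightarrow> half_perimeter S \<le> Phi x"
  unfolding Phi_def by (intro half_perimeter_le contact_closed_chain)

lemma gap_mix: "gap (node (mix t x y) i) (node (mix t x y) j) = (1 - t) * gap (node x i) (node x j) + t * gap (node y i) (node y j)"
  by (simp add: gap_def mix_def inner_diff_right inner_add_right algebra_simps)

lemma config_mix:
  assumes "config x" "config y" "0 \<le> t" "t \<le> 1" shows "config (mix t x y)"
  using assms by (auto simp: config_def mix_def inner_add_right intro!: add_mono mult_left_mono)

lemma cell_mix:
  assumes "config x" "config y" "0 < t" "t < 1" "i < k"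
  shows "(1 - t) * cell (node x i) (node x (Suc i)) + t * cell (node y i) (node y (Suc i))
       \<le> cell (node (mix t x y) i) (node (mix t x y) (Suc i))"
    and "(1 - t) * cell (node x i) (node x (Suc i)) + t * cell (node y i) (node y (Suc i))
       = cell (node (mix t x y) i) (node (mix t x y) (Suc i)) \<Longrightarrow>
       gap (node (mix t x y) i) (node (mix t x y) (Suc i)) > 0 \<Longrightarrow> gap (node (mix t x y) (Suc i)) (node (mix t x y) i) > 0 \<Longrightarrow>
       gap (node x i) (node x (Suc i)) = gap (node y i) (node y (Suc i)) \<and> gap (node x (Suc i)) (node x i) = gap (node y (Suc i)) (node y i)"
proof -
  have nn: "gap (node x i) (node x (Suc i)) \<ge> 0" "gap (node x (Suc i)) (node x i) \<ge> 0"
     "gap (node y i) (node y (Suc i)) \<ge> 0" "gap (node y (Suc i)) (node y i) \<ge> 0"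
    using assms by (auto intro: config_gap_nonneg)
  have s: "root 3 (2 * sin (\<theta> (Suc i) - \<theta> i)) > 0" using sin_gap[OF assms(5)] by simp
  have e: "(1 - t) * (a / c) + t * (b / c) = ((1 - t) * a + t * b) / c" for a b c :: real
    by (simp add: add_divide_distrib)
  show "(1 - t) * cell (node x i) (node x (Suc i)) + t * cell (node y i) (node y (Suc i))
       \<le> cell (node (mix t x y) i) (node (mix t x y) (Suc i))"
    unfolding cell_node e gap_mix using s by (intro divide_right_mono root3_mult_concave(1) nn assms) auto
  assume "(1 - t) * cell (node x i) (node x (Suc i)) + t * cell (node y i) (node y (Suc i))
       = cell (node (mix t x y) i) (node (mix t x y) (Suc i))"
    and pos: "gap (node (mix t x y) i) (node (mix t x y) (Suc i)) > 0" "gap (node (mix t x y) (Suc i)) (node (mix t x y) i) > 0"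
  then show "gap (node x i) (node x (Suc i)) = gap (node y i) (node y (Suc i)) \<and> gap (node x (Suc i)) (node x i) = gap (node y (Suc i)) (node y i)"
    using s unfolding cell_node e gap_mix by (intro root3_mult_concave(2)[OF nn assms(3,4)]) auto
qed

lemma Phi_mix:
  assumes "config x" "config y" "0 < t" "t < 1"
  shows "(1 - t) * Phi x + t * Phi y \<le> Phi (mix t x y)"
  unfolding Phi_def chain_sum_def sum_distrib_left sum.distrib[symmetric]
  by (intro sum_mono cell_mix assms) auto

lemma Phi_mix_eq:
  assumes "config x" "config y" "0 < t" "t < 1" "(1 - t) * Phi x + t * Phi y = Phi (mix t x y)"
    and "nondeg (mix t x y)" "i < k"
  shows "gap (node x i) (node x (Suc i)) = gap (node y i) (node y (Suc i)) \<and> gap (node x (Suc i)) (node x i) = gap (node y (Suc i)) (node y i)"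
proof -
  have "(\<Sum>i<k. (1 - t) * cell (node x i) (node x (Suc i)) + t * cell (node y i) (node y (Suc i)))
     = (\<Sum>i<k. cell (node (mix t x y) i) (node (mix t x y) (Suc i)))"
    using assms(5) by (simp add: Phi_def chain_sum_def sum_distrib_left sum.distrib)
  then have "(1 - t) * cell (node x i) (node x (Suc i)) + t * cell (node y i) (node y (Suc i))
      = cell (node (mix t x y) i) (node (mix t x y) (Suc i))"
    by (rule sum_mono_inv) (use cell_mix(1)[OF assms(1-4)] assms(7) in auto)
  then show ?thesis using cell_mix(2)[OF assms(1-4,7)] assms(6,7) by (auto simp: nondeg_def)
qed

lemma admissible_mix:
  assumes "admissible I h x" "admissible I h y" "0 \<le> t" "t \<le> 1" shows "admissible I h (mix t x y)"
proof -
  have "(1 - t) * (u i \<bullet> x i) + t * (u i \<bullet> y i) \<le> h i" if "i \<in> I" for i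
  proof -
    have "(1 - t) * (u i \<bullet> x i) + t * (u i \<bullet> y i) \<le> (1 - t) * h i + t * h i"
      using assms that by (intro add_mono mult_left_mono) (auto simp: admissible_def)
    then show ?thesis by (simp add: algebra_simps)
  qed
  then show ?thesis using assms config_mix by (auto simp: admissible_def mix_def inner_add_right)
qed

section \<open>Nondegeneracy and uniqueness of maximisers\<close>

text \<open>
  Moving a distance \<open>t\<close> towards a nondegenerate configuration costs \<open>O(t)\<close> but gains a multiple of
  \<open>t powr (2/3)\<close> in a degenerate cell.
\<close>

lemma maximal_nondeg:
  assumes max: "maximal I h x" and y: "admissible I h y" "nondeg y"
  shows "nondeg x"
proof (rule ccontr)
  assume "\<not> nondeg x"
  have cx: "config x" and cy: "config y" using max y by (auto simp: maximal_def admissible_def)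
  obtain i0 where i0: "i0 < k" "gap (node x i0) (node x (Suc i0)) \<le> 0 \<or> gap (node x (Suc i0)) (node x i0) \<le> 0"
    using \<open>\<not> nondeg x\<close> by (auto simp: nondeg_def not_less)
  then have "gap (node x i0) (node x (Suc i0)) = 0 \<or> gap (node x (Suc i0)) (node x i0) = 0"
    using config_gap_nonneg[OF cx, of i0 "Suc i0"] config_gap_nonneg[OF cx, of "Suc i0" i0] by auto
  then have x0: "cell (node x i0) (node x (Suc i0)) = 0" by (auto simp: cell_node)
  define f where "f = cell (node y i0) (node y (Suc i0))"
  have f: "f > 0" using y(2) i0(1) sin_gap[OF i0(1)] by (auto simp: f_def cell_node nondeg_def)
  have P0: "Phi x \<ge> 0" unfolding Phi_def chain_sum_def using config_cell_nonneg[OF cx] by (intro sum_nonneg) auto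
  \<comment> \<open>With \<open>t = s ^ 3\<close> the gain in the degenerate cell is at least
    \<open>s\<^sup>2 * f\<close> and the loss elsewhere at most \<open>s ^ 3 * Phi x\<close>, so
    \<open>s * Phi x < f\<close> is what is wanted. The bound 1/2 keeps \<open>t\<close> below 1,
    and the summand 1 covers \<open>Phi x = 0\<close>.\<close>
  define s where "s = min (1/2) (f / (2 * (Phi x + 1)))"
  have s: "s > 0" "s < 1" using f P0 by (auto simp: s_def)
  have "s * Phi x \<le> f / (2 * (Phi x + 1)) * Phi x" using P0 by (intro mult_right_mono) (auto simp: s_def)
  also have "\<dots> < f" using f P0 by (simp add: field_simps add_pos_nonneg)
  finally have sf: "s * Phi x < f" .
  define t where "t = s ^ 3"
  have t: "0 < t" "t < 1" using s by (auto simp: t_def power_less_one_iff)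
  define z where "z = mix t x y"
  have small: "s\<^sup>2 * f \<le> cell (node z i0) (node z (Suc i0))"
  proof -
    have nn: "gap (node x i0) (node x (Suc i0)) \<ge> 0" "gap (node x (Suc i0)) (node x i0) \<ge> 0"
       "gap (node y i0) (node y (Suc i0)) \<ge> 0" "gap (node y (Suc i0)) (node y i0) \<ge> 0"
      using cx cy i0(1) by (auto intro: config_gap_nonneg)
    have "t * gap (node y i0) (node y (Suc i0)) * (t * gap (node y (Suc i0)) (node y i0)) \<le>
       gap (node z i0) (node z (Suc i0)) * gap (node z (Suc i0)) (node z i0)"
      unfolding z_def gap_mix using t nn by (intro mult_mono) auto
    then have "root 3 (t * gap (node y i0) (node y (Suc i0)) * (t * gap (node y (Suc i0)) (node y i0))) \<le>
       root 3 (gap (node z i0) (node z (Suc i0)) * gap (node z (Suc i0)) (node z i0))" by simp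
    moreover have "root 3 (t * gap (node y i0) (node y (Suc i0)) * (t * gap (node y (Suc i0)) (node y i0)))
       = s\<^sup>2 * root 3 (gap (node y i0) (node y (Suc i0)) * gap (node y (Suc i0)) (node y i0))"
      using s by (simp add: t_def real_root_mult real_root_power power2_eq_square real_root_pos2)
    moreover have "s\<^sup>2 * f = s\<^sup>2 * root 3 (gap (node y i0) (node y (Suc i0)) * gap (node y (Suc i0)) (node y i0)) / root 3 (2 * sin (\<theta> (Suc i0) - \<theta> i0))"
      by (simp add: f_def cell_node)
    ultimately show ?thesis
      using sin_gap[OF i0(1)] unfolding cell_node[of z] by (simp only: divide_right_mono real_root_ge_zero)
  qed
  have split: "Phi v = cell (node v i0) (node v (Suc i0)) + (\<Sum>i\<in>{..<k} - {i0}. cell (node v i) (node v (Suc i)))" for v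
    unfolding Phi_def chain_sum_def using i0(1) by (simp add: sum.remove)
  have "(\<Sum>i\<in>{..<k} - {i0}. (1 - t) * cell (node x i) (node x (Suc i))) \<le> (\<Sum>i\<in>{..<k} - {i0}. cell (node z i) (node z (Suc i)))"
  proof (rule sum_mono)
    fix i assume "i \<in> {..<k} - {i0}"
    then have i: "i < k" by simp
    have "0 \<le> t * cell (node y i) (node y (Suc i))" using t config_cell_nonneg[OF cy i] by simp
    then show "(1 - t) * cell (node x i) (node x (Suc i)) \<le> cell (node z i) (node z (Suc i))"
      using cell_mix(1)[OF cx cy t i] unfolding z_def by linarith
  qed
  then have "(1 - t) * Phi x + s\<^sup>2 * f \<le> Phi z"
    using small split[of x] split[of z] x0 by (simp add: sum_distrib_left[symmetric])
  moreover have "t * Phi x < s\<^sup>2 * f"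
    using mult_strict_left_mono[OF sf, of "s\<^sup>2"] s by (simp add: t_def power3_eq_cube power2_eq_square mult.assoc)
  ultimately have "Phi z > Phi x" by (simp add: algebra_simps)
  moreover have "admissible I h z" unfolding z_def using max y t by (intro admissible_mix) (auto simp: maximal_def)
  ultimately show False using max by (auto simp: maximal_def)
qed

text \<open>Up to sign, the two gaps of a cell are the components of the difference of consecutive
  points along two independent normals, so equal gaps leave only a common translation.\<close>

lemma nondeg_translate_unique:
  assumes "\<And>i. i < k \<Longrightarrow> gap (node x i) (node x (Suc i)) = gap (node y i) (node y (Suc i)) \<and> gap (node x (Suc i)) (node x i) = gap (node y (Suc i)) (node y i)"
  obtains w where "\<And>i. i < k \<Longrightarrow> y i = x i + w"
proof -
  define w where "w = y 0 - x 0"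
  have step: "y (Suc i mod k) - x (Suc i mod k) = y i - x i" if i: "i < k" for i
  proof -
    have "x (Suc i mod k) - x i = y (Suc i mod k) - y i"
    proof (rule uvec_inner_eqI[of "\<theta> (Suc i)" "\<theta> i"])
      show "sin (\<theta> (Suc i) - \<theta> i) \<noteq> 0" using sin_gap[OF i] by simp
      show "u i \<bullet> (x (Suc i mod k) - x i) = u i \<bullet> (y (Suc i mod k) - y i)"
           "u (Suc i) \<bullet> (x (Suc i mod k) - x i) = u (Suc i) \<bullet> (y (Suc i mod k) - y i)"
        using assms[OF i] i by (simp_all add: gap_def inner_diff_right)
    qed
    then show ?thesis by (simp add: algebra_simps)
  qed
  have "y i - x i = w" if "i < k" for i using that
  proof (induction i)
    case (Suc i)
    then show ?case using step[of i] by simp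
  qed (simp add: w_def)
  then show ?thesis using that[of w] by (metis add.commute diff_add_cancel)
qed

text \<open>
  By strict concavity two maximisers differ by a translation \<open>w\<close>. If \<open>w \<noteq> 0\<close>, their midpoint leaves
  room to push the contact points apart along \<open>w\<close>, which increases the sum.
\<close>

lemma maximal_unique:
  assumes x: "maximal I h x" and y: "maximal I h y" and z: "admissible I h z" "nondeg z" and I: "I \<subseteq> {..<k}"
    and i: "i < k"
  shows "x i = y i"
proof -
  have ax: "admissible I h x" and ay: "admissible I h y" and cx: "config x" and cy: "config y"
    using x y by (auto simp: maximal_def admissible_def)
  have eq: "Phi x = Phi y" using x y by (auto simp: maximal_def intro: antisym)
  define M where "M = mix (1/2) x y"
  have aM: "admissible I h M" unfolding M_def using ax ay by (intro admissible_mix) auto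
  have "Phi M \<le> Phi x" using x aM by (auto simp: maximal_def)
  moreover have "(1 - 1/2) * Phi x + 1/2 * Phi y \<le> Phi M" unfolding M_def using cx cy by (intro Phi_mix) auto
  ultimately have PM: "Phi M = Phi x" using eq by simp
  then have mM: "maximal I h M" using aM x by (auto simp: maximal_def)
  then have nM: "nondeg M" using maximal_nondeg z by blast
  obtain w where w: "\<And>i. i < k \<Longrightarrow> y i = x i + w"
  proof (rule nondeg_translate_unique[of x y])
    fix i assume "i < k"
    then show "gap (node x i) (node x (Suc i)) = gap (node y i) (node y (Suc i)) \<and> gap (node x (Suc i)) (node x i) = gap (node y (Suc i)) (node y i)"
      using PM eq nM cx cy unfolding M_def by (intro Phi_mix_eq[of x y "1/2"]) auto
  qed blast
  have "w = 0"
  proof (rule ccontr)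
    assume "w \<noteq> 0"
    \<comment> \<open>\<open>N i\<close> is \<open>x i\<close> or \<open>y i\<close>, whichever lies
      farther out along \<open>u i\<close>, and the midpoint in case of a tie; therefore it
      satisfies every constraint that both of them satisfy.\<close>
    define \<sigma> where "\<sigma> i = sgn (u i \<bullet> w)" for i
    define N where "N i = M i + (\<sigma> i / 2) *\<^sub>R w" for i
    have \<sigma>le: "\<sigma> j * (u i \<bullet> w) \<le> \<sigma> i * (u i \<bullet> w)" for i j
      unfolding \<sigma>_def by (auto simp: sgn_if mult_less_0_iff)
    have cM: "config M" using aM by (simp add: admissible_def)
    have cN: "config N"
      unfolding config_def
    proof (intro allI impI)
      fix i j assume "i < k" "j < k"
      then have "u i \<bullet> M j \<le> u i \<bullet> M i" using cM by (auto simp: config_def)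
      then show "u i \<bullet> N j \<le> u i \<bullet> N i" using \<sigma>le[of j i] by (simp add: N_def inner_add_right)
    qed
    have "u i \<bullet> N i \<le> h i" if i: "i \<in> I" for i
    proof -
      have ik: "i < k" using i I by auto
      have "u i \<bullet> x i \<le> h i" "u i \<bullet> y i \<le> h i" using ax ay i by (auto simp: admissible_def)
      moreover have "M i = x i + (1/2) *\<^sub>R w" using w[OF ik] by (simp add: M_def mix_def algebra_simps flip: scaleR_left_distrib)
      moreover have "\<sigma> i * (u i \<bullet> w) = \<bar>u i \<bullet> w\<bar>" by (simp add: \<sigma>_def mult_sgn_abs abs_sgn mult.commute)
      ultimately show ?thesis using w[OF ik] by (simp add: N_def inner_add_right abs_if split: if_splits)
    qed
    then have aN: "admissible I h N" using cN by (simp add: admissible_def)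
    have \<sigma>k: "\<sigma> (i mod k) = \<sigma> i" if "i \<le> k" for i using u_mod[OF that] by (simp add: \<sigma>_def)
    have g1: "gap (node N i) (node N (Suc i)) = gap (node M i) (node M (Suc i)) + (\<sigma> (Suc i) - \<sigma> i) * (u (Suc i) \<bullet> w) / 2"
     and g2: "gap (node N (Suc i)) (node N i) = gap (node M (Suc i)) (node M i) + (\<sigma> i - \<sigma> (Suc i)) * (u i \<bullet> w) / 2" if "i < k" for i
      using that \<sigma>k[of "Suc i"] by (simp_all add: gap_def N_def inner_diff_right inner_add_right algebra_simps diff_divide_distrib)
    have ge: "(\<sigma> (Suc i) - \<sigma> i) * (u (Suc i) \<bullet> w) \<ge> 0" "(\<sigma> i - \<sigma> (Suc i)) * (u i \<bullet> w) \<ge> 0" for i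
      using \<sigma>le[of i "Suc i"] \<sigma>le[of "Suc i" i] by (simp_all add: algebra_simps)
    have cell_le: "cell (node M i) (node M (Suc i)) \<le> cell (node N i) (node N (Suc i))" if i: "i < k" for i
    proof -
      have "gap (node M i) (node M (Suc i)) * gap (node M (Suc i)) (node M i) \<le> gap (node N i) (node N (Suc i)) * gap (node N (Suc i)) (node N i)"
        using g1[OF i] g2[OF i] ge[of i] config_gap_nonneg[OF cM, of i "Suc i"] config_gap_nonneg[OF cM, of "Suc i" i] i
        by (intro mult_mono) auto
      then show ?thesis unfolding cell_node using sin_gap[OF i] by (intro divide_right_mono) auto
    qed
    obtain a where a: "a < k" "u a \<bullet> w > 0" using spanning[OF \<open>w \<noteq> 0\<close>] by blast
    obtain b where b: "b < k" "u b \<bullet> (- w) > 0" using spanning[of "- w"] \<open>w \<noteq> 0\<close> by auto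
    \<comment> \<open>The normals positively span the plane, so \<open>\<sigma>\<close> takes both
      signs and changes between some neighbours. There a gap grows, and since both gaps of
      \<open>M\<close> are positive, their product grows strictly.\<close>
    have "\<exists>i<k. \<sigma> i \<noteq> \<sigma> (Suc i)"
    proof (rule ccontr)
      assume H: "\<not> ?thesis"
      have "\<sigma> j = \<sigma> 0" if "j < k" for j using that
      proof (induction j)
        case (Suc j) then show ?case using H by auto
      qed simp
      then have "\<sigma> a = \<sigma> b" using a b by metis
      then show False using a b by (simp add: \<sigma>_def)
    qed
    then obtain i where i: "i < k" "\<sigma> i \<noteq> \<sigma> (Suc i)" by blast
    have "(\<sigma> (Suc i) - \<sigma> i) * (u (Suc i) \<bullet> w) > 0 \<or> (\<sigma> i - \<sigma> (Suc i)) * (u i \<bullet> w) > 0"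
    proof (rule ccontr)
      assume "\<not> ?thesis"
      then have "(\<sigma> (Suc i) - \<sigma> i) * (u (Suc i) \<bullet> w) = 0" "(\<sigma> i - \<sigma> (Suc i)) * (u i \<bullet> w) = 0"
        using ge[of i] by auto
      then have "u (Suc i) \<bullet> w = 0" "u i \<bullet> w = 0" using i(2) by auto
      then show False using i(2) by (simp add: \<sigma>_def)
    qed
    then have "gap (node M i) (node M (Suc i)) * gap (node M (Suc i)) (node M i) < gap (node N i) (node N (Suc i)) * gap (node N (Suc i)) (node N i)"
      using g1[OF i(1)] g2[OF i(1)] ge[of i] nM i(1) unfolding nondeg_def
      by (intro mult_strict_mono_disj) auto
    then have "cell (node M i) (node M (Suc i)) < cell (node N i) (node N (Suc i))"
      unfolding cell_node using sin_gap[OF i(1)] by (intro divide_strict_right_mono) auto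
    then have "Phi M < Phi N"
      unfolding Phi_def chain_sum_def using cell_le i(1) by (intro sum_strict_mono_ex1) auto
    then show False using mM aN by (auto simp: maximal_def) 
  qed
  then show ?thesis using w[OF i] by simp
qed

section \<open>Dropping the constraints that are not touched\<close>

definition touched :: "nat set \<Rightarrow> (nat \<Rightarrow> real) \<Rightarrow> (nat \<Rightarrow> plane) \<Rightarrow> nat set" where
  "touched I h x = {i \<in> I. u i \<bullet> x i = h i}"

lemma slack_pos:
  fixes a b h :: "nat \<Rightarrow> real"
  assumes "finite J" "\<And>i. i \<in> J \<Longrightarrow> a i < h i"
  obtains \<epsilon> where "0 < \<epsilon>" "\<epsilon> < 1" "\<And>i. i \<in> J \<Longrightarrow> (1 - \<epsilon>) * a i + \<epsilon> * b i \<le> h i"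
proof -
  have "\<forall>i\<in>J. eventually (\<lambda>\<epsilon>. (1 - \<epsilon>) * a i + \<epsilon> * b i < h i) (at_right 0)"
  proof
    fix i assume "i \<in> J"
    have "((\<lambda>\<epsilon>. (1 - \<epsilon>) * a i + \<epsilon> * b i) \<longlongrightarrow> (1 - 0) * a i + 0 * b i) (at_right 0)"
      by (intro tendsto_intros)
    then show "eventually (\<lambda>\<epsilon>. (1 - \<epsilon>) * a i + \<epsilon> * b i < h i) (at_right 0)"
      using assms(2)[OF \<open>i \<in> J\<close>] by (intro order_tendstoD(2)) auto
  qed
  then have "eventually (\<lambda>\<epsilon>. \<forall>i\<in>J. (1 - \<epsilon>) * a i + \<epsilon> * b i < h i) (at_right 0)"
    using assms(1) by (simp add: eventually_ball_finite)
  moreover have "eventually (\<lambda>\<epsilon>::real. 0 < \<epsilon> \<and> \<epsilon> < 1) (at_right 0)"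
    unfolding eventually_at_right_field by (intro exI[of _ 1]) auto
  ultimately have "eventually (\<lambda>\<epsilon>. (\<forall>i\<in>J. (1 - \<epsilon>) * a i + \<epsilon> * b i < h i) \<and> 0 < \<epsilon> \<and> \<epsilon> < 1) (at_right 0)"
    by (rule eventually_conj)
  then obtain \<epsilon> where "(\<forall>i\<in>J. (1 - \<epsilon>) * a i + \<epsilon> * b i < h i) \<and> 0 < \<epsilon> \<and> \<epsilon> < 1"
    using eventually_happens'[OF trivial_limit_at_right_real] by blast
  then show ?thesis using that by (meson less_imp_le)
qed

text \<open>The constraints that \<open>x\<close> satisfies strictly survive a small step towards
  any \<open>y\<close>, and the touched ones hold on the whole segment. By concavity, a better
  \<open>y\<close> under the touched constraints alone would then improve on \<open>x\<close> under
  all of them.\<close>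

lemma touched_mix_admissible:
  assumes x: "admissible I h x" and y: "admissible (touched I h x) h y" and I: "finite I"
  obtains \<epsilon> where "0 < \<epsilon>" "\<epsilon> < 1" "admissible I h (mix \<epsilon> x y)"
proof -
  have lt: "u i \<bullet> x i < h i" if "i \<in> I - touched I h x" for i
    using that x by (auto simp: touched_def admissible_def less_le)
  obtain \<epsilon> where e: "0 < \<epsilon>" "\<epsilon> < 1" "\<And>i. i \<in> I - touched I h x \<Longrightarrow> (1 - \<epsilon>) * (u i \<bullet> x i) + \<epsilon> * (u i \<bullet> y i) \<le> h i"
    by (rule slack_pos[where J = "I - touched I h x" and a = "\<lambda>i. u i \<bullet> x i" and b = "\<lambda>i. u i \<bullet> y i" and h = h])
       (use I lt in auto)
  have "admissible (touched I h x) h x" using x by (auto simp: admissible_def touched_def)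
  then have "admissible (touched I h x) h (mix \<epsilon> x y)" using y e by (intro admissible_mix) auto
  then have "admissible I h (mix \<epsilon> x y)"
    using e(3) unfolding admissible_def by (auto simp: mix_def inner_add_right)
  then show ?thesis using that e by blast
qed

lemma maximal_touched:
  assumes x: "maximal I h x" and I: "I \<subseteq> {..<k}" and z: "admissible I h z" "nondeg z"
  shows "maximal (touched I h x) h x"
    and "maximal (touched I h x) h y \<Longrightarrow> i < k \<Longrightarrow> y i = x i"
proof -
  have fI: "finite I" using I finite_subset by blast
  have ax: "admissible I h x" and cx: "config x" using x by (auto simp: maximal_def admissible_def)
  have T: "touched I h x \<subseteq> I" by (auto simp: touched_def)
  have sub: "admissible (touched I h x) h v" if "admissible I h v" for v
    using that T by (auto simp: admissible_def)
  show m: "maximal (touched I h x) h x"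
    unfolding maximal_def
  proof (intro conjI allI impI sub ax)
    fix y assume y: "admissible (touched I h x) h y"
    then obtain \<epsilon> where e: "0 < \<epsilon>" "\<epsilon> < 1" "admissible I h (mix \<epsilon> x y)"
      using touched_mix_admissible[OF ax _ fI] by blast
    have cy: "config y" using y by (simp add: admissible_def)
    have "(1 - \<epsilon>) * Phi x + \<epsilon> * Phi y \<le> Phi x"
      using Phi_mix[OF cx cy e(1,2)] x e(3) by (auto simp: maximal_def intro: order_trans)
    then have "\<epsilon> * Phi y \<le> \<epsilon> * Phi x" by (simp add: algebra_simps)
    then show "Phi y \<le> Phi x" using e by simp
  qed
  assume "maximal (touched I h x) h y" "i < k"
  then show "y i = x i"
    using maximal_unique[OF _ m sub[OF z(1)] z(2)] T I by blast
qed

text \<open>Otherwise a translation by \<open>w\<close> keeps \<open>Phi\<close> and all touched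
  constraints and yields a second maximiser. The touched normals therefore do not fit into a closed
  half-plane, which makes the polygon of the touched sides bounded.\<close>

lemma touched_spanning:
  assumes x: "maximal I h x" and I: "I \<subseteq> {..<k}" and z: "admissible I h z" "nondeg z" and "w \<noteq> 0"
  obtains i where "i \<in> touched I h x" "u i \<bullet> w > 0"
proof (rule ccontr)
  assume "\<not> thesis"
  then have H: "u i \<bullet> w \<le> 0" if "i \<in> touched I h x" for i using that \<open>\<And>i. _ \<Longrightarrow> _ \<Longrightarrow> thesis\<close> by force
  define y where "y i = x i + w" for i
  have ax: "admissible I h x" using x by (auto simp: maximal_def)
  have "admissible (touched I h x) h y"
    using ax H by (auto simp: admissible_def config_def y_def inner_add_right touched_def intro: order_trans[OF add_left_mono])
  moreover have "Phi y = Phi x"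
    by (simp add: Phi_def chain_sum_def cell_def gap_def y_def)
  ultimately have "maximal (touched I h x) h y"
    using maximal_touched(1)[OF x I z] by (simp add: maximal_def)
  then have "y 0 = x 0" using maximal_touched(2)[OF x I z] by simp
  then show False using \<open>w \<noteq> 0\<close> by (simp add: y_def)
qed

text \<open>A point that supports two normals less than \<open>pi\<close> apart supports all normals
  between them, in particular the neighbouring one, whose gap would then vanish. Of the two ways
  around from \<open>i\<close> to \<open>j\<close> one is shorter than \<open>pi\<close>, unless the
  normals are opposite; in that case all points lie on one line and a gap vanishes as well.\<close>

lemma nondeg_distinct:
  assumes c: "config x" and nd: "nondeg x" and ij: "i < k" "j < k" "x i = x j"
  shows "i = j"
proof -
  have False if ij: "i < j" "j < k" "x i = x j" for i j
  proof -
    have pos: "gap (node x a) (node x (Suc a)) > 0" "gap (node x (Suc a)) (node x a) > 0" if "a < k" for a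
      using nd that by (auto simp: nondeg_def)
    have cf: "u a \<bullet> x b \<le> u a \<bullet> x a" if "a < k" "b < k" for a b using c that by (auto simp: config_def)
    define d where "d = \<theta> j - \<theta> i"
    have d: "0 < d" "d < 2 * pi"
      using \<theta>_strict_mono[OF ij(1)] ij \<theta>_strict_mono[of j k] \<theta>_mono[of 0 i] \<theta>_closed by (auto simp: d_def)
    have betw: False if ab: "a < k" "b < k" "x a = x b" and l: "l < k" "u l = u (Suc a)"
       "\<theta>' - \<theta> a < pi" "\<theta> (Suc a) \<le> \<theta>'" "uvec \<theta>' = u b" and la: "l = Suc a mod k" for a b l \<theta>'
    proof -
      have s: "sin (\<theta>' - \<theta> a) > 0" using that \<theta>_less[OF ab(1)] by (intro sin_gt_zero) auto
      have "sin (\<theta>' - \<theta> a) * (u (Suc a) \<bullet> (x l - x a)) = sin (\<theta>' - \<theta> (Suc a)) * (u a \<bullet> (x l - x a)) + sin (\<theta> (Suc a) - \<theta> a) * (u b \<bullet> (x l - x a))"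
        using inner_uvec_decomp[of \<theta>' "\<theta> a" "\<theta> (Suc a)" "x l - x a"] l by simp
      also have "\<dots> \<le> 0"
      proof -
        have "u a \<bullet> (x l - x a) \<le> 0" using cf[of a l] ab l by (simp add: inner_diff_right)
        moreover have "u b \<bullet> (x l - x a) \<le> 0" unfolding ab(3) using cf[of b l] ab l by (simp add: inner_diff_right)
        moreover have "sin (\<theta>' - \<theta> (Suc a)) \<ge> 0" using l \<theta>_less[OF ab(1)] by (intro sin_ge_zero) auto
        moreover have "sin (\<theta> (Suc a) - \<theta> a) \<ge> 0" using sin_gap[OF ab(1)] by simp
        ultimately show ?thesis by (simp add: mult_nonneg_nonpos add_nonpos_nonpos)
      qed
      finally have "u (Suc a) \<bullet> (x l - x a) \<le> 0" using s by (simp add: mult_le_0_iff)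
      then show False using pos(1)[OF ab(1)] la ab(1) by (simp add: gap_def)
    qed
    consider "d < pi" | "d = pi" | "d > pi" by linarith
    then show False
    proof cases
      case 1
      then show False using ij \<theta>_mono[of "Suc i" j]
        by (intro betw[of i j "Suc i" "\<theta> j"]) (auto simp: d_def)
    next
      case 2
      then have "u j = - u i" using uvec_add_pi[of "\<theta> i"] by (simp add: d_def algebra_simps)
      moreover have "Suc i < k" using ij by simp
      ultimately have "u i \<bullet> x (Suc i) \<ge> u i \<bullet> x i" using cf[of j "Suc i"] ij by simp
      then show False using pos(2)[of i] ij by (simp add: gap_def inner_diff_right)
    next
      case 3
      have "\<theta> (Suc j) \<le> \<theta> i + 2 * pi"
        using \<theta>_mono[of "Suc j" k] \<theta>_mono[of 0 i] ij \<theta>_closed by auto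
      then show False using 3 ij u_mod[of "Suc j"]
        by (intro betw[of j i "Suc j mod k" "\<theta> i + 2 * pi"]) (auto simp: d_def)
    qed
  qed
  then show ?thesis using ij by (metis linorder_neqE_nat)
qed

lemma maximal_exists:
  fixes I h
  defines "K \<equiv> {q. \<forall>i\<in>I. u i \<bullet> q \<le> h i}"
  assumes K: "compact K" and I: "I \<subseteq> {..<k}" and r: "r > 0" "cball c r \<subseteq> K"
  obtains x z where "maximal I h x" "admissible I h z" "nondeg z"
proof -
  \<comment> \<open>The contact points of the inscribed ball: a configuration in \<open>K\<close>
    with all gaps positive.\<close>
  define z where "z i = c + r *\<^sub>R u i" for i
  have zK: "z i \<in> K" for i using r by (auto simp: z_def dist_norm)
  have "config z" using r by (simp add: config_def z_def inner_add_right inner_uvec_uvec)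
  then have az: "admissible I h z" using zK by (auto simp: admissible_def K_def)
  have nz: "nondeg z"
    unfolding nondeg_def
  proof (intro allI impI)
    fix i assume i: "i < k"
    have "u (Suc i mod k) = u (Suc i)" using i by (intro u_mod) auto
    then have d: "z (Suc i mod k) - z (i mod k) = r *\<^sub>R (u (Suc i) - u i)" "z (i mod k) - z (Suc i mod k) = r *\<^sub>R (u i - u (Suc i))"
      using i by (simp_all add: z_def scaleR_diff_right)
    have "cos (\<theta> i - \<theta> (Suc i)) = cos (\<theta> (Suc i) - \<theta> i)" by (metis cos_minus minus_diff_eq)
    then have g: "gap (node z i) (node z (Suc i)) = r * (1 - cos (\<theta> (Suc i) - \<theta> i))" "gap (node z (Suc i)) (node z i) = r * (1 - cos (\<theta> (Suc i) - \<theta> i))"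
      unfolding gap_def fst_node snd_node d by (simp_all add: inner_diff_right inner_uvec_uvec)
    have "cos (\<theta> (Suc i) - \<theta> i) < cos 0" using \<theta>_less[OF i] \<theta>_gap[OF i] by (intro cos_monotone_0_pi) auto
    then show "gap (node z i) (node z (Suc i)) > 0 \<and> gap (node z (Suc i)) (node z i) > 0" unfolding g using r by simp
  qed
  \<comment> \<open>Configurations are functions on all indices, so compactness is that of an
    infinite product of copies of \<open>K\<close>.\<close>
  define C :: "(nat \<Rightarrow> plane) set" where "C = Pi\<^sub>E UNIV (\<lambda>_. K)"
  have "compactin (product_topology (\<lambda>_. euclidean) UNIV) C"
    unfolding C_def compactin_PiE using K by simp
  then have cC: "compact C" by (simp add: euclidean_product_topology)
  have cont: "continuous_on UNIV (\<lambda>x::nat \<Rightarrow> plane. a \<bullet> x i)" for a i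
    by (intro continuous_intros continuous_on_product_coordinates)
  have "closed {x. config x}"
  proof -
    have "{x. config x} = (\<Inter>i\<in>{..<k}. \<Inter>j\<in>{..<k}. {x. u i \<bullet> x j \<le> u i \<bullet> x i})" by (auto simp: config_def)
    moreover have "closed \<dots>" by (intro closed_INT ballI closed_Collect_le cont)
    ultimately show ?thesis by simp
  qed
  moreover have "closed {x. \<forall>i\<in>I. u i \<bullet> x i \<le> h i}"
  proof -
    have "{x. \<forall>i\<in>I. u i \<bullet> x i \<le> h i} = (\<Inter>i\<in>I. {x. u i \<bullet> x i \<le> h i})" by auto
    moreover have "closed \<dots>" by (intro closed_INT ballI closed_Collect_le cont continuous_on_const)
    ultimately show ?thesis by simp
  qed
  ultimately have "closed ({x. config x} \<inter> {x. \<forall>i\<in>I. u i \<bullet> x i \<le> h i})" by (rule closed_Int)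
  moreover have "{x. config x} \<inter> {x. \<forall>i\<in>I. u i \<bullet> x i \<le> h i} = {x. admissible I h x}" by (auto simp: admissible_def)
  ultimately have "compact (C \<inter> {x. admissible I h x})" using compact_Int_closed[OF cC] by simp
  moreover have "C \<inter> {x. admissible I h x} \<noteq> {}" using az zK by (auto simp: C_def)
  moreover have "continuous_on (C \<inter> {x. admissible I h x}) Phi"
  proof -
    have "continuous_on UNIV (\<lambda>x. \<Sum>i<k. root 3 (u (Suc i) \<bullet> (x (Suc i mod k) - x (i mod k)) * (u i \<bullet> (x (i mod k) - x (Suc i mod k))) / (2 * sin (\<theta> (Suc i) - \<theta> i))))"
      unfolding inner_diff_right
    proof (intro continuous_intros continuous_on_product_coordinates)
      show "\<forall>x\<in>UNIV. 2 * sin (\<theta> (Suc i) - \<theta> i) \<noteq> 0" if "i \<in> {..<k}" for i using sin_gap[of i] that by auto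
    qed
    moreover have "Phi = (\<lambda>x. \<Sum>i<k. root 3 (u (Suc i) \<bullet> (x (Suc i mod k) - x (i mod k)) * (u i \<bullet> (x (i mod k) - x (Suc i mod k))) / (2 * sin (\<theta> (Suc i) - \<theta> i))))"
      by (simp add: fun_eq_iff Phi_def chain_sum_def cell_def gap_def)
    ultimately have "continuous_on UNIV Phi" by (simp only:)
    then show ?thesis by (rule continuous_on_subset) simp
  qed
  ultimately have "\<exists>x\<in>C \<inter> {x. admissible I h x}. \<forall>y\<in>C \<inter> {x. admissible I h x}. Phi y \<le> Phi x"
    by (rule continuous_attains_sup)
  then obtain x where x: "x \<in> C \<inter> {x. admissible I h x}" "\<And>y. y \<in> C \<inter> {x. admissible I h x} \<Longrightarrow> Phi y \<le> Phi x"
    by blast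
  have "Phi y \<le> Phi x" if y: "admissible I h y" for y
  proof -
    \<comment> \<open>The values of \<open>y\<close> at indices from \<open>k\<close> on are
      arbitrary and may leave \<open>K\<close>; periodic continuation moves \<open>y\<close> into
      \<open>C\<close> and changes neither constraints nor \<open>Phi\<close>.\<close>
    define y' where "y' i = y (i mod k)" for i
    have "y j \<in> K" if "j < k" for j
      unfolding K_def mem_Collect_eq
    proof
      fix i assume "i \<in> I"
      then have "u i \<bullet> y j \<le> u i \<bullet> y i" "u i \<bullet> y i \<le> h i" using y I that by (auto simp: admissible_def config_def)
      then show "u i \<bullet> y j \<le> h i" by linarith
    qed
    then have "y' \<in> C" by (auto simp: C_def y'_def)
    moreover have "config y'" using y by (simp add: admissible_def config_def y'_def)
    moreover have "i mod k = i" if "i \<in> I" for i using that I by auto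
    ultimately have "y' \<in> C" "admissible I h y'" using y by (simp_all add: admissible_def y'_def)
    moreover have "Phi y' = Phi y" by (simp add: Phi_def node_def y'_def chain_sum_def)
    ultimately show ?thesis using x(2)[of y'] by simp
  qed
  then have "maximal I h x" using x(1) by (auto simp: maximal_def)
  then show ?thesis using that az nz by blast
qed

end

section \<open>Bodies bounded by parabola arcs\<close>

text \<open>A polar angle lying in the given interval, not merely modulo full turns: it is a zero of
  the component of the vector perpendicular to \<open>uvec \<omega>\<close>, which changes sign
  between \<open>a\<close> and \<open>b\<close>.\<close>

lemma cone_angle:
  assumes ab: "a < b" "b - a < pi" and nn: "\<alpha> \<ge> 0" "\<beta> \<ge> 0" "\<alpha> > 0 \<or> \<beta> > 0"
  obtains \<omega> \<rho> where "a \<le> \<omega>" "\<omega> \<le> b" "\<rho> > 0" "\<alpha> *\<^sub>R uvec a + \<beta> *\<^sub>R uvec b = \<rho> *\<^sub>R uvec \<omega>"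
proof -
  define v where "v = \<alpha> *\<^sub>R uvec a + \<beta> *\<^sub>R uvec b"
  have s: "sin (b - a) > 0" using ab by (intro sin_gt_zero) auto
  define f where "f \<omega> = uvec (\<omega> + pi/2) \<bullet> v" for \<omega>
  have f: "f \<omega> = \<beta> * sin (b - \<omega>) - \<alpha> * sin (\<omega> - a)" for \<omega>
    by (simp add: f_def v_def inner_add_right inner_uvec_uvec cos_add cos_diff sin_diff sin_add algebra_simps)
  have "continuous_on {a..b} f" unfolding f by (intro continuous_intros)
  moreover have "f b \<le> 0" "0 \<le> f a" using nn s by (auto simp: f)
  ultimately obtain \<omega> where \<omega>: "a \<le> \<omega>" "\<omega> \<le> b" "f \<omega> = 0"
    using IVT2'[of f b 0 a] ab by auto
  define \<rho> where "\<rho> = uvec \<omega> \<bullet> v"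
  have v: "v = \<rho> *\<^sub>R uvec \<omega>"
    using \<omega>(3) by (intro uvec_inner_eqI[of "\<omega> + pi/2" \<omega>]) (simp_all add: \<rho>_def f_def inner_uvec_uvec)
  have "cross2 (uvec a) v = \<beta> * sin (b - a)" "cross2 v (uvec b) = \<alpha> * sin (b - a)"
    by (simp_all add: v_def cross2_def sin_diff algebra_simps)
  then have r: "\<rho> * sin (\<omega> - a) = \<beta> * sin (b - a)" "\<rho> * sin (b - \<omega>) = \<alpha> * sin (b - a)"
    using cross2_scale[of 1 "uvec a" \<rho> "uvec \<omega>"] cross2_scale[of \<rho> "uvec \<omega>" 1 "uvec b"]
    by (simp_all add: v cross2_uvec)
  have "sin (\<omega> - a) \<ge> 0" "sin (b - \<omega>) \<ge> 0" using \<omega> ab by (auto intro!: sin_ge_zero)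
  moreover have "\<rho> * sin (\<omega> - a) > 0 \<or> \<rho> * sin (b - \<omega>) > 0" unfolding r using nn s by auto
  ultimately have "\<rho> > 0" by (auto simp: zero_less_mult_iff)
  then show ?thesis using that \<omega> v by (auto simp: v_def)
qed

text \<open>
  In coordinates \<open>(X, Y)\<close> along the normals of two consecutive tangents, based at the first contact
  point: a point that is supported by a third tangent whose normal \<open>(\<alpha>, \<beta>)\<close> lies outside the cone
  of the first two cannot be beyond the chord \<open>p X + q Y = 0\<close> of the contact points.
\<close>

lemma not_beyond_chord:
  fixes p q X Y \<alpha> \<beta> :: real
  assumes pq: "p > 0" "q > 0" and X: "X \<le> 0" and Y: "Y \<le> p" and ab: "\<alpha> < 0 \<or> \<beta> < 0"
    and 1: "\<alpha> * X + \<beta> * Y \<ge> 0" and 2: "\<alpha> * (X + q) + \<beta> * (Y - p) \<ge> 0"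
  shows "p * X + q * Y \<le> 0"
proof (rule ccontr)
  assume "\<not> ?thesis"
  then have H: "p * X + q * Y > 0" by simp
  have "q * Y > 0" using H X pq mult_nonneg_nonpos[of p X] by linarith
  then have Y0: "Y > 0" using pq by (simp add: zero_less_mult_iff)
  have H2: "p * (X + q) + q * (Y - p) > 0" using H by (simp add: algebra_simps)
  then have "p * (X + q) > 0" using Y pq mult_nonneg_nonpos[of q "Y - p"] by linarith
  then have X0: "X + q > 0" using pq by (simp add: zero_less_mult_iff)
  show False
  proof (cases "\<alpha> < 0")
    case True
    have a: "\<alpha> * (X + q) < 0" using True X0 by (simp add: mult_neg_pos)
    have b0: "\<beta> < 0"
    proof (rule ccontr)
      assume "\<not> \<beta> < 0"
      then have "\<beta> * (Y - p) \<le> 0" using Y by (simp add: mult_nonneg_nonpos)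
      then show False using a 2 by linarith
    qed
    \<comment> \<open>The two support inequalities would place the normal
      \<open>(\<alpha>, \<beta>)\<close> on opposite sides of the direction \<open>(p, q)\<close>
      normal to the chord.\<close>
    have "p * (\<alpha> * X + \<beta> * Y) = \<alpha> * (p * X + q * Y) + (p * \<beta> - q * \<alpha>) * Y" by (simp add: algebra_simps)
    moreover have "\<alpha> * (p * X + q * Y) < 0" using True H by (simp add: mult_neg_pos)
    moreover have "p * (\<alpha> * X + \<beta> * Y) \<ge> 0" using 1 pq by simp
    ultimately have "(p * \<beta> - q * \<alpha>) * Y > 0" by linarith
    then have c1: "p * \<beta> - q * \<alpha> > 0" using Y0 by (simp add: zero_less_mult_iff)
    have "q * (\<alpha> * (X + q) + \<beta> * (Y - p)) = \<beta> * (p * (X + q) + q * (Y - p)) - (p * \<beta> - q * \<alpha>) * (X + q)" by (simp add: algebra_simps)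
    moreover have "\<beta> * (p * (X + q) + q * (Y - p)) < 0" using b0 H2 by (simp only: mult_neg_pos)
    moreover have "(p * \<beta> - q * \<alpha>) * (X + q) > 0" using c1 X0 by simp
    moreover have "q * (\<alpha> * (X + q) + \<beta> * (Y - p)) \<ge> 0" using 2 pq by simp
    ultimately show False by linarith
  next
    case False
    then have "\<beta> * Y < 0" "\<alpha> * X \<le> 0" using ab Y0 X by (simp_all add: mult_neg_pos mult_nonneg_nonpos)
    then show False using 1 by linarith
  qed
qed

text \<open>The left-hand side is a nonnegative combination of the chord functional
  \<open>p * X + q * Y\<close> and of one tangent functional, \<open>X\<close> for \<open>l\<close>
  up to 1/2 and \<open>Y\<close> beyond. The right-hand side is its value at the point with
  parameter \<open>l\<close> of the inscribed parabola.\<close>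

lemma below_parabola:
  fixes p q X Y l :: real
  assumes pq: "p > 0" "q > 0" and X: "X \<le> 0" and Y: "Y \<le> p" and c: "p * X + q * Y \<le> 0" and l: "0 \<le> l" "l \<le> 1"
  shows "(1 - l) * p * X + l * q * Y \<le> p * q * l\<^sup>2"
proof (cases "l \<le> 1/2")
  case True
  have "(1 - l) * p * X + l * q * Y = l * (p * X + q * Y) + (1 - 2 * l) * (p * X)" by (simp add: algebra_simps)
  also have "\<dots> \<le> 0"
  proof -
    have "l * (p * X + q * Y) \<le> 0" "p * X \<le> 0" using l c X pq by (simp_all add: mult_nonneg_nonpos)
    moreover from this have "(1 - 2 * l) * (p * X) \<le> 0" using True by (simp add: mult_nonneg_nonpos)
    ultimately show ?thesis by linarith
  qed
  also have "\<dots> \<le> p * q * l\<^sup>2" using pq by simp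
  finally show ?thesis .
next
  case False
  have "(1 - l) * p * X + l * q * Y = (1 - l) * (p * X + q * Y) + (2 * l - 1) * (q * Y)" by (simp add: algebra_simps)
  also have "\<dots> \<le> 0 + (2 * l - 1) * (q * p)"
    using False l c Y pq by (intro add_mono mult_left_mono) (auto simp: mult_nonneg_nonpos)
  also have "\<dots> \<le> l\<^sup>2 * (q * p)"
  proof -
    have "(l - 1)\<^sup>2 \<ge> 0" by simp
    then have "2 * l - 1 \<le> l\<^sup>2" by (simp add: power2_eq_square algebra_simps)
    then have "(2 * l - 1) * (q * p) \<le> l\<^sup>2 * (q * p)" using pq by (intro mult_right_mono) auto
    then show ?thesis by simp
  qed
  finally show ?thesis by (simp add: mult.commute mult.left_commute)
qed

lemma half_perimeter_insert:
  assumes e: "closed_chain S e m" and i: "i < m" and f: "contact S f" "cstep (e i) f" "cstep f (e (Suc i))"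
  shows "half_perimeter S \<le> chain_sum e m - cell (e i) (e (Suc i)) + cell (e i) f + cell f (e (Suc i))"
proof -
  define e' where "e' j = (if j \<le> i then e j else if j = Suc i then f else e (j - 1))" for j
  have "closed_chain S e' (Suc m)"
    unfolding closed_chain_def open_chain_def
  proof (intro conjI allI impI)
    fix j assume "j \<le> Suc m"
    then show "contact S (e' j)" using e f i by (auto simp: closed_chain_def open_chain_def e'_def)
  next
    fix j assume "j < Suc m"
    then consider "j < i" | "j = i" | "j = Suc i" | "j > Suc i" "j - 1 < m" by linarith
    then show "cstep (e' j) (e' (Suc j))"
    proof cases
      case 4
      then have "cstep (e (j - 1)) (e (Suc (j - 1)))" using e by (auto simp: closed_chain_def open_chain_def)
      then show ?thesis using 4 by (simp add: e'_def)
    qed (use e f i in \<open>auto simp: closed_chain_def open_chain_def e'_def\<close>)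
  next
    show "e' (Suc m) = cshift 1 (e' 0)" using e i by (simp add: closed_chain_def e'_def)
  qed
  then have "half_perimeter S \<le> chain_sum e' (Suc m)" by (rule half_perimeter_le)
  also have "chain_sum e' (Suc m) = chain_sum e' (Suc (Suc i)) + chain_sum (\<lambda>l. e' (Suc (Suc i) + l)) (Suc m - Suc (Suc i))"
    using i by (intro chain_sum_split) auto
  also have "(\<lambda>l. e' (Suc (Suc i) + l)) = (\<lambda>l. e (Suc i + l))" by (auto simp: e'_def)
  also have "chain_sum e' (Suc (Suc i)) = chain_sum e i + cell (e i) f + cell f (e (Suc i))"
    by (simp add: chain_sum_def e'_def)
  also have "chain_sum e i + cell (e i) f + cell f (e (Suc i)) + chain_sum (\<lambda>l. e (Suc i + l)) (Suc m - Suc (Suc i))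
     = chain_sum e m - cell (e i) (e (Suc i)) + cell (e i) f + cell f (e (Suc i))"
    using chain_sum_split[of "Suc i" m e] i by (simp add: chain_sum_def)
  finally show ?thesis .
qed

lemma subset_of_support_le:
  assumes S': "convex_body S'" and le: "\<And>t c c'. contact S (t, c) \<Longrightarrow> contact S' (t, c') \<Longrightarrow> uvec t \<bullet> c \<le> uvec t \<bullet> c'"
    and S: "convex_body S"
  shows "S \<subseteq> S'"
proof (rule ccontr)
  assume "\<not> S \<subseteq> S'"
  then obtain z where z: "z \<in> S" "z \<notin> S'" by blast
  have "convex S'" "closed S'" using S' by (auto simp: convex_body_def compact_imp_closed)
  then obtain a b where ab: "a \<bullet> z < b" "\<And>x. x \<in> S' \<Longrightarrow> a \<bullet> x > b"
    using separating_hyperplane_closed_point[of S' z] z(2) by blast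
  obtain t where t: "- a = norm (- a) *\<^sub>R uvec t" by (rule polar_plane)
  have ne: "S \<noteq> {}" "S' \<noteq> {}" using S S' by (auto simp: convex_body_def)
  obtain c where c: "contact S (t, c)" using contact_exists[of S] S ne by (auto simp: convex_body_def)
  obtain c' where c': "contact S' (t, c')" using contact_exists[of S'] S' ne by (auto simp: convex_body_def)
  have "uvec t \<bullet> z \<le> uvec t \<bullet> c" using c z by (auto simp: contact_def)
  then have "uvec t \<bullet> z \<le> uvec t \<bullet> c'" using le[OF c c'] by linarith
  then have "norm (- a) * (uvec t \<bullet> z) \<le> norm (- a) * (uvec t \<bullet> c')" by (rule mult_left_mono) simp
  then have "(- a) \<bullet> z \<le> (- a) \<bullet> c'" by (subst (1 2) t) simp
  moreover have "a \<bullet> c' > b" using ab(2) c' by (auto simp: contact_def)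
  ultimately show False using ab(1) by simp
qed

context fan
begin

text \<open>A tangent with arbitrary normal is inserted into the chain of \<open>x\<close>. The sum
  cannot fall below \<open>Phi x\<close>, so nothing is lost in the cut cell and
  \<open>cell_cut_facts\<close> expresses the position of the tangent by \<open>x\<close> alone.
  Both bodies then have the same support function.\<close>

lemma maximal_body_unique:
  assumes nd: "nondeg x"
    and S: "convex_body S" "\<And>i. i < k \<Longrightarrow> contact S (\<theta> i, x i)" "Phi x \<le> half_perimeter S"
    and S': "convex_body S'" "\<And>i. i < k \<Longrightarrow> contact S' (\<theta> i, x i)" "Phi x \<le> half_perimeter S'"
  shows "S = S'"
proof -
  have key: "uvec t \<bullet> c = uvec t \<bullet> c'" if c: "contact S (t, c)" and c': "contact S' (t, c')" for t c c'
  proof -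
    obtain i n where i: "i < k" "\<theta> i \<le> t + 2 * pi * of_int n" "t + 2 * pi * of_int n < \<theta> (Suc i)" by (rule angle_cell)
    define \<tau> where "\<tau> = t + 2 * pi * of_int n"
    have ut: "uvec \<tau> = uvec t" by (simp add: \<tau>_def)
    have c\<tau>: "contact S (\<tau>, c)" "contact S' (\<tau>, c')" using c c' ut by (simp_all add: contact_def)
    show ?thesis
    proof (cases "\<tau> = \<theta> i")
      case True
      have "u i \<bullet> c = u i \<bullet> x i" using S(2)[OF i(1)] c\<tau>(1) True by (auto simp: contact_def intro: antisym)
      moreover have "u i \<bullet> c' = u i \<bullet> x i" using S'(2)[OF i(1)] c\<tau>(2) True by (auto simp: contact_def intro: antisym)
      ultimately show ?thesis using ut True by simp
    next
      case False
      then have \<tau>: "\<theta> i < \<tau>" "\<tau> < \<theta> (Suc i)" using i by (auto simp: \<tau>_def)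
      define rhs where "rhs = sin (\<tau> - \<theta> i) * (gap (node x i) (node x (Suc i)) / sin (\<theta> (Suc i) - \<theta> i) - 
          sin (\<theta> (Suc i) - \<tau>) * ((gap (node x i) (node x (Suc i)) / sin (\<theta> (Suc i) - \<theta> i)) * (gap (node x (Suc i)) (node x i) / sin (\<theta> (Suc i) - \<theta> i)) 
           / (sin (\<theta> (Suc i) - \<tau>) * (gap (node x (Suc i)) (node x i) / sin (\<theta> (Suc i) - \<theta> i)) +
              sin (\<tau> - \<theta> i) * (gap (node x i) (node x (Suc i)) / sin (\<theta> (Suc i) - \<theta> i)))))"
      have "gap (node x i) (\<tau>, d) = rhs"
        if C: "\<And>i. i < k \<Longrightarrow> contact C (\<theta> i, x i)" "Phi x \<le> half_perimeter C" and d: "contact C (\<tau>, d)" for C d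
      proof -
        have e: "contact C (node x i)" "contact C (node x (Suc i))" using i(1) by (auto intro!: contact_node C)
        have "cstep (node x i) (\<tau>, d)" "cstep (\<tau>, d) (node x (Suc i))"
          using \<tau> \<theta>_gap[OF i(1)] by (auto simp: cstep_def cle_def)
        then have "half_perimeter C \<le> Phi x - cell (node x i) (node x (Suc i)) + cell (node x i) (\<tau>, d) + cell (\<tau>, d) (node x (Suc i))"
          unfolding Phi_def by (intro half_perimeter_insert contact_closed_chain C(1) i(1) d)
        then have ge: "cell (node x i) (node x (Suc i)) \<le> cell (node x i) (\<tau>, d) + cell (\<tau>, d) (node x (Suc i))" using C(2) by linarith
        note facts = cell_cut_facts[OF contact_gap_nonneg[OF e(1) d] contact_gap_nonneg[OF d e(1)] contact_gap_nonneg[OF d e(2)]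
            contact_gap_nonneg[OF e(2) d] contact_gap_nonneg[OF e(1,2)] contact_gap_nonneg[OF e(2,1)]]
        have "cell (node x i) (\<tau>, d) + cell (\<tau>, d) (node x (Suc i)) = cell (node x i) (node x (Suc i))"
          using ge facts(1) \<tau> \<theta>_gap[OF i(1)] by (intro antisym) auto
        then show ?thesis
          using facts(2) \<tau> \<theta>_gap[OF i(1)] nd i(1) unfolding rhs_def nondeg_def by simp
      qed
      from this[OF S(2,3) c\<tau>(1)] this[OF S'(2,3) c\<tau>(2)]
      have "gap (node x i) (\<tau>, c) = gap (node x i) (\<tau>, c')" by simp
      then show ?thesis using ut by (simp add: gap_def inner_diff_right)
    qed
  qed
  show ?thesis
    by (intro subset_antisym subset_of_support_le S S') (use key in fastforce)+
qed

section \<open>Parametrised arcs and their normals\<close>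

definition rise :: "(nat \<Rightarrow> plane) \<Rightarrow> nat \<Rightarrow> real" where
  "rise x i = gap (node x i) (node x (Suc i))"

definition fall :: "(nat \<Rightarrow> plane) \<Rightarrow> nat \<Rightarrow> real" where
  "fall x i = gap (node x (Suc i)) (node x i)"

definition apex_pt :: "(nat \<Rightarrow> plane) \<Rightarrow> nat \<Rightarrow> plane" where
  "apex_pt x i = x (i mod k) + (rise x i / sin (\<theta> (Suc i) - \<theta> i)) *\<^sub>R uvec (\<theta> i + pi / 2)"

text \<open>The quadratic Bezier curve with the apex as middle control point, that is, the parabola
  touching the two tangents at the two contact points.\<close>

definition arc :: "(nat \<Rightarrow> plane) \<Rightarrow> nat \<Rightarrow> real \<Rightarrow> plane" where
  "arc x i l = (1 - l)\<^sup>2 *\<^sub>R x (i mod k) + (2 * l * (1 - l)) *\<^sub>R apex_pt x i + l\<^sup>2 *\<^sub>R x (Suc i mod k)"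

text \<open>Orthogonal to the derivative of \<open>arc\<close>, whose components along
  \<open>u i\<close> and \<open>u (Suc i)\<close> are \<open>- 2 * l * fall x i\<close> and
  \<open>2 * (1 - l) * rise x i\<close>.\<close>

definition arc_normal :: "(nat \<Rightarrow> plane) \<Rightarrow> nat \<Rightarrow> real \<Rightarrow> plane" where
  "arc_normal x i l = ((1 - l) * rise x i) *\<^sub>R u i + (l * fall x i) *\<^sub>R u (Suc i)"

definition parabola_body :: "(nat \<Rightarrow> plane) \<Rightarrow> plane set" where
  "parabola_body x = convex hull (\<Union>i<k. arc x i ` {0..1})"

lemma next_inner: "u i \<bullet> (x (Suc i mod k) - x (i mod k)) = - fall x i" "u (Suc i) \<bullet> (x (Suc i mod k) - x (i mod k)) = rise x i"
  by (simp_all add: rise_def fall_def gap_def inner_diff_right)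

lemma apex_inner:
  assumes "i < k"
  shows "u i \<bullet> (apex_pt x i - x (i mod k)) = 0" "u (Suc i) \<bullet> (apex_pt x i - x (i mod k)) = rise x i"
  using sin_gap[OF assms] by (simp_all add: apex_pt_def)

lemma arc_diff: "arc x i l - x (i mod k) = (2 * l * (1 - l)) *\<^sub>R (apex_pt x i - x (i mod k)) + l\<^sup>2 *\<^sub>R (x (Suc i mod k) - x (i mod k))"
proof -
  have "(1 - l)\<^sup>2 = 1 - 2 * l * (1 - l) - l\<^sup>2" by (simp add: power2_eq_square algebra_simps)
  then show ?thesis by (simp only: arc_def scaleR_diff_left) (simp add: algebra_simps)
qed

lemma arc_inner:
  assumes "i < k"
  shows "u i \<bullet> (arc x i l - x (i mod k)) = - (l\<^sup>2 * fall x i)"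
    and "u (Suc i) \<bullet> (arc x i l - x (i mod k)) = (2 * l - l\<^sup>2) * rise x i"
  unfolding arc_diff inner_add_right inner_scaleR_right apex_inner[OF assms] next_inner
  by (simp_all add: power2_eq_square algebra_simps)

lemma arc_0 [simp]: "arc x i 0 = x (i mod k)" and arc_1 [simp]: "arc x i 1 = x (Suc i mod k)"
  by (simp_all add: arc_def)

lemma arc_normal_inner:
  assumes "i < k"
  shows "arc_normal x i l \<bullet> (arc x i m - x (i mod k)) = rise x i * fall x i * (2 * l * m - m\<^sup>2)"
  unfolding arc_normal_def inner_add_left inner_scaleR_left arc_inner[OF assms]
  by (simp add: power2_eq_square algebra_simps)

text \<open>By \<open>u_decomp\<close> the two sines are, up to a positive factor, the coefficients
  of \<open>u l\<close> in the basis \<open>u i\<close>, \<open>u (Suc i)\<close>; a normal outside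
  their cone has a negative one.\<close>

lemma outside_cone:
  assumes "i < k" "l < k" "l \<noteq> i" "l \<noteq> Suc i mod k"
  shows "sin (\<theta> (Suc i) - \<theta> l) < 0 \<or> sin (\<theta> l - \<theta> i) < 0"
proof (cases "l < i")
  case True
  have d: "0 < \<theta> i - \<theta> l" "\<theta> (Suc i) - \<theta> l \<le> 2 * pi"
    using \<theta>_strict_mono[of l i] \<theta>_mono[of "Suc i" k] \<theta>_mono[of 0 l] \<theta>_closed True assms by auto
  have ne: "\<theta> (Suc i) - \<theta> l \<noteq> 2 * pi"
  proof
    assume eq: "\<theta> (Suc i) - \<theta> l = 2 * pi"
    have "Suc i = k"
    proof (rule ccontr)
      assume "Suc i \<noteq> k"
      then have "\<theta> (Suc i) < \<theta> k" using assms by (intro \<theta>_strict_mono) auto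
      then show False using eq \<theta>_closed \<theta>_mono[of 0 l] assms by auto
    qed
    moreover have "l = 0"
    proof (rule ccontr)
      assume "l \<noteq> 0"
      then have "\<theta> 0 < \<theta> l" using assms by (intro \<theta>_strict_mono) auto
      then show False using eq \<theta>_closed \<theta>_mono[of "Suc i" k] assms by auto
    qed
    ultimately show False using assms by simp
  qed
  show ?thesis
  proof (cases "\<theta> i - \<theta> l < pi")
    case True
    then have "sin (\<theta> i - \<theta> l) > 0" using d by (intro sin_gt_zero) auto
    then show ?thesis using sin_minus[of "\<theta> i - \<theta> l"] by simp
  next
    case False
    then have "sin (\<theta> (Suc i) - \<theta> l) < 0" using d ne \<theta>_less[OF assms(1)] by (intro sin_lt_zero) auto
    then show ?thesis by simp
  qed
next
  case False
  then have l: "Suc i < l" using assms by (cases "l = Suc i") auto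
  have d: "\<theta> (Suc i) < \<theta> l" "\<theta> l - \<theta> i < 2 * pi"
    using \<theta>_strict_mono[of "Suc i" l] \<theta>_strict_mono[of l k] \<theta>_mono[of 0 i] \<theta>_closed l assms by auto
  show ?thesis
  proof (cases "\<theta> l - \<theta> i \<le> pi")
    case True
    then have "sin (\<theta> l - \<theta> (Suc i)) > 0" using d \<theta>_less[OF assms(1)] by (intro sin_gt_zero) auto
    then show ?thesis using sin_minus[of "\<theta> l - \<theta> (Suc i)"] by simp
  next
    case False
    then show ?thesis using d by (intro disjI2 sin_lt_zero) auto
  qed
qed

end

locale nondeg_config = fan +
  fixes x :: "nat \<Rightarrow> plane"
  assumes cx: "config x" and nx: "nondeg x"
begin

lemma pq_pos: "i < k \<Longrightarrow> rise x i > 0" "i < k \<Longrightarrow> fall x i > 0"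
  using nx by (simp_all add: nondeg_def rise_def fall_def)

lemma config_le: "i \<le> k \<Longrightarrow> j \<le> k \<Longrightarrow> u i \<bullet> x (j mod k) \<le> u i \<bullet> x (i mod k)"
  using config_gap_nonneg[OF cx, of j i] by (simp add: gap_def inner_diff_right)

text \<open>For a normal outside the cone, the step from one of the two contact points to the apex
  decreases the inner product, and the contact point already satisfies the inequality.\<close>

lemma apex_le:
  assumes "i < k" "l < k"
  shows "u l \<bullet> apex_pt x i \<le> u l \<bullet> x l"
proof -
  have eq: "u i \<bullet> apex_pt x i = u i \<bullet> x i" "u (Suc i) \<bullet> apex_pt x i = u (Suc i) \<bullet> x (Suc i mod k)"
    using apex_inner[OF assms(1), of x] next_inner[of i x] assms by (simp_all add: inner_diff_right)
  consider "l = i" | "l = Suc i mod k" | "l \<noteq> i" "l \<noteq> Suc i mod k" by blast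
  then show ?thesis
  proof cases
    case 2
    then have "u l = u (Suc i)" using u_mod[of "Suc i"] assms by simp
    then show ?thesis using eq 2 by simp
  next
    case 3
    have s: "sin (\<theta> (Suc i) - \<theta> i) > 0" by (rule sin_gap[OF assms(1)])
    from outside_cone[OF assms 3] show ?thesis
    proof
      assume a: "sin (\<theta> (Suc i) - \<theta> l) < 0"
      have "sin (\<theta> (Suc i) - \<theta> i) * (u l \<bullet> (apex_pt x i - x (Suc i mod k))) = sin (\<theta> (Suc i) - \<theta> l) * fall x i"
        using u_decomp[of i "\<theta> l" "apex_pt x i - x (Suc i mod k)"] eq next_inner(1)[of i x] assms
        by (simp add: inner_diff_right)
      also have "\<dots> < 0" using a pq_pos(2)[OF assms(1)] by (simp add: mult_neg_pos)
      finally have "u l \<bullet> (apex_pt x i - x (Suc i mod k)) < 0" using s by (simp add: mult_less_0_iff)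
      then show ?thesis using config_le[of l "Suc i"] assms by (simp add: inner_diff_right)
    next
      assume a: "sin (\<theta> l - \<theta> i) < 0"
      have "sin (\<theta> (Suc i) - \<theta> i) * (u l \<bullet> (apex_pt x i - x i)) = sin (\<theta> l - \<theta> i) * rise x i"
        using u_decomp[of i "\<theta> l" "apex_pt x i - x i"] apex_inner[OF assms(1), of x] assms by simp
      also have "\<dots> < 0" using a pq_pos(1)[OF assms(1)] by (simp add: mult_neg_pos)
      finally have "u l \<bullet> (apex_pt x i - x i) < 0" using s by (simp add: mult_less_0_iff)
      then show ?thesis using config_le[of l i] assms by (simp add: inner_diff_right)
    qed
  qed (use eq in simp)
qed

text \<open>The alternatives cover the control points of all other arcs: each is an end of arc
  \<open>i\<close> or lies on a third tangent. In either case it is not beyond the chord, and the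
  parabola arc is.\<close>

lemma vertex_below:
  assumes "i < k" and P: "\<And>l. l < k \<Longrightarrow> u l \<bullet> P \<le> u l \<bullet> x l"
    and l: "P = x i \<or> P = x (Suc i mod k) \<or> (\<exists>l<k. l \<noteq> i \<and> l \<noteq> Suc i mod k \<and> u l \<bullet> P = u l \<bullet> x l)"
    and t: "0 \<le> t" "t \<le> 1"
  shows "arc_normal x i t \<bullet> (P - arc x i t) \<le> 0"
proof -
  define X Y where "X = u i \<bullet> (P - x i)" and "Y = u (Suc i) \<bullet> (P - x i)"
  have Si: "Suc i mod k < k" "u (Suc i mod k) = u (Suc i)" using u_mod[of "Suc i"] assms(1) by auto
  have X0: "X \<le> 0" using P[OF assms(1)] by (simp add: X_def inner_diff_right)
  have Yp: "Y \<le> rise x i" using P[OF Si(1)] Si(2) next_inner(2)[of i x] assms(1) by (simp add: Y_def inner_diff_right)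
  have XY': "u i \<bullet> (P - x (Suc i mod k)) = X + fall x i" "u (Suc i) \<bullet> (P - x (Suc i mod k)) = Y - rise x i"
    using next_inner[of i x] assms(1) by (simp_all add: X_def Y_def inner_diff_right)
  have "rise x i * X + fall x i * Y \<le> 0"
    using l
  proof (elim disjE exE conjE)
    assume "P = x (Suc i mod k)"
    then have "X = - fall x i" "Y = rise x i" using XY' by simp_all
    then show ?thesis by simp
  next
    fix l assume l: "l < k" "l \<noteq> i" "l \<noteq> Suc i mod k" "u l \<bullet> P = u l \<bullet> x l"
    have s: "sin (\<theta> (Suc i) - \<theta> i) > 0" by (rule sin_gap[OF assms(1)])
    show ?thesis
    proof (rule not_beyond_chord[OF pq_pos[OF assms(1)] X0 Yp outside_cone[OF assms(1) l(1-3)]])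
      have "u l \<bullet> (P - x i) \<ge> 0" using config_le[of l i] l assms(1) by (simp add: inner_diff_right)
      then show "sin (\<theta> (Suc i) - \<theta> l) * X + sin (\<theta> l - \<theta> i) * Y \<ge> 0"
        using u_decomp[of i "\<theta> l" "P - x i"] s by (simp add: X_def Y_def) (metis less_eq_real_def mult_nonneg_nonneg)
      have "u l \<bullet> (P - x (Suc i mod k)) \<ge> 0" using config_le[of l "Suc i"] l assms(1) by (simp add: inner_diff_right)
      then show "sin (\<theta> (Suc i) - \<theta> l) * (X + fall x i) + sin (\<theta> l - \<theta> i) * (Y - rise x i) \<ge> 0"
        using u_decomp[of i "\<theta> l" "P - x (Suc i mod k)"] s unfolding XY' by (metis less_eq_real_def mult_nonneg_nonneg)
    qed
  qed (simp add: X_def Y_def)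
  then have "(1 - t) * rise x i * X + t * fall x i * Y \<le> rise x i * fall x i * t\<^sup>2"
    using t by (intro below_parabola pq_pos assms(1) X0 Yp)
  moreover have "arc_normal x i t \<bullet> (arc x i t - x i) = rise x i * fall x i * t\<^sup>2"
    using arc_normal_inner[OF assms(1), of x t t] assms(1) by (simp add: power2_eq_square)
  moreover have "arc_normal x i t \<bullet> (P - x i) = (1 - t) * rise x i * X + t * fall x i * Y"
    by (simp add: arc_normal_def X_def Y_def inner_add_left)
  ultimately show ?thesis by (simp add: inner_diff_right)
qed

lemma x_below:
  assumes "i < k" "j < k" "0 \<le> t" "t \<le> 1" shows "arc_normal x i t \<bullet> (x j - arc x i t) \<le> 0"
proof (rule vertex_below[OF assms(1) _ _ assms(3,4)])
  show "u l \<bullet> x j \<le> u l \<bullet> x l" if "l < k" for l using config_le[of l j] that assms by simp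
qed (use assms in blast)

lemma apex_below:
  assumes "i < k" "j < k" "j \<noteq> i" "0 \<le> t" "t \<le> 1" shows "arc_normal x i t \<bullet> (apex_pt x j - arc x i t) \<le> 0"
proof (rule vertex_below[OF assms(1) _ _ assms(4,5)])
  show "u l \<bullet> apex_pt x j \<le> u l \<bullet> x l" if "l < k" for l using apex_le[OF assms(2) that] .
  have eq: "u j \<bullet> apex_pt x j = u j \<bullet> x j" "u (Suc j) \<bullet> apex_pt x j = u (Suc j) \<bullet> x (Suc j mod k)"
    using apex_inner[OF assms(2), of x] next_inner[of j x] assms by (simp_all add: inner_diff_right)
  have "\<exists>l<k. l \<noteq> i \<and> l \<noteq> Suc i mod k \<and> u l \<bullet> apex_pt x j = u l \<bullet> x l"
  proof (cases "j = Suc i mod k")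
    case True
    \<comment> \<open>The apex of the next arc lies on the tangents \<open>j\<close> and
      \<open>Suc j\<close>; with at least three normals the latter is a third tangent.\<close>
    have "Suc j mod k \<noteq> i" "Suc j mod k \<noteq> Suc i mod k" using True k3 assms(1) by (auto simp: mod_Suc split: if_splits)
    moreover have "u (Suc j mod k) = u (Suc j)" using u_mod[of "Suc j"] assms by simp
    ultimately show ?thesis using eq(2) by (intro exI[of _ "Suc j mod k"]) simp
  next
    case False
    then show ?thesis using eq(1) assms by blast
  qed
  then show "apex_pt x j = x i \<or> apex_pt x j = x (Suc i mod k) \<or> (\<exists>l<k. l \<noteq> i \<and> l \<noteq> Suc i mod k \<and> u l \<bullet> apex_pt x j = u l \<bullet> x l)"
    by blast
qed

text \<open>Within one arc the inner product is minus a multiple of the squared parameter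
  difference. Any other arc consists of convex combinations of its three control points.\<close>

lemma arc_below:
  assumes "i < k" "j < k" "0 \<le> t" "t \<le> 1" "0 \<le> m" "m \<le> 1"
  shows "arc_normal x i t \<bullet> (arc x j m - arc x i t) \<le> 0"
proof (cases "j = i")
  case True
  have "arc_normal x i t \<bullet> (arc x i m - arc x i t) = arc_normal x i t \<bullet> (arc x i m - x (i mod k)) - arc_normal x i t \<bullet> (arc x i t - x (i mod k))"
    by (simp add: inner_diff_right)
  also have "\<dots> = - (rise x i * fall x i * (t - m)\<^sup>2)"
    unfolding arc_normal_inner[OF assms(1)] by (simp add: power2_eq_square algebra_simps)
  also have "\<dots> \<le> 0" using pq_pos assms(1) by (simp add: less_imp_le)
  finally show ?thesis using True by simp
next
  case False
  have "(1 - m)\<^sup>2 + 2 * m * (1 - m) + m\<^sup>2 = 1" by (simp add: power2_eq_square algebra_simps)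
  then have "((1 - m)\<^sup>2 + 2 * m * (1 - m) + m\<^sup>2) *\<^sub>R A = A" for A :: plane by simp
  then have e: "(1 - m)\<^sup>2 *\<^sub>R A + (2 * m * (1 - m)) *\<^sub>R A + m\<^sup>2 *\<^sub>R A = A" for A :: plane
    unfolding scaleR_left_distrib .
  have "arc x j m - A = (1 - m)\<^sup>2 *\<^sub>R (x (j mod k) - A) + (2 * m * (1 - m)) *\<^sub>R (apex_pt x j - A)
      + m\<^sup>2 *\<^sub>R (x (Suc j mod k) - A)" for A
  proof -
    have "arc x j m - ((1 - m)\<^sup>2 *\<^sub>R A + (2 * m * (1 - m)) *\<^sub>R A + m\<^sup>2 *\<^sub>R A) = (1 - m)\<^sup>2 *\<^sub>R (x (j mod k) - A) + (2 * m * (1 - m)) *\<^sub>R (apex_pt x j - A)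
      + m\<^sup>2 *\<^sub>R (x (Suc j mod k) - A)"
      unfolding arc_def scaleR_diff_right by (simp only: diff_conv_add_uminus minus_add_distrib ac_simps)
    then show ?thesis unfolding e .
  qed
  from this[of "arc x i t"] have "arc x j m - arc x i t = (1 - m)\<^sup>2 *\<^sub>R (x (j mod k) - arc x i t) + (2 * m * (1 - m)) *\<^sub>R (apex_pt x j - arc x i t)
      + m\<^sup>2 *\<^sub>R (x (Suc j mod k) - arc x i t)" .
  moreover have "arc_normal x i t \<bullet> ((1 - m)\<^sup>2 *\<^sub>R (x (j mod k) - arc x i t) + (2 * m * (1 - m)) *\<^sub>R (apex_pt x j - arc x i t)
      + m\<^sup>2 *\<^sub>R (x (Suc j mod k) - arc x i t)) \<le> 0"
    unfolding inner_add_right inner_scaleR_right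
    using assms False by (intro add_nonpos_nonpos mult_nonneg_nonpos x_below apex_below) auto
  ultimately show ?thesis by simp
qed

text \<open>Chosen within the angular interval of the cell, so that the angles increase from arc to
  arc without reduction modulo full turns.\<close>

definition arc_angle :: "nat \<Rightarrow> real \<Rightarrow> real" where
  "arc_angle i t = (SOME \<omega>. \<theta> i \<le> \<omega> \<and> \<omega> \<le> \<theta> (Suc i) \<and> (\<exists>\<rho>>0. arc_normal x i t = \<rho> *\<^sub>R uvec \<omega>))"

lemma arc_angle:
  assumes "i < k" "0 \<le> t" "t \<le> 1"
  obtains \<rho> where "\<theta> i \<le> arc_angle i t" "arc_angle i t \<le> \<theta> (Suc i)" "\<rho> > 0" "arc_normal x i t = \<rho> *\<^sub>R uvec (arc_angle i t)"
proof -
  have "(1 - t) * rise x i > 0 \<or> t * fall x i > 0" using pq_pos[OF assms(1)] assms by (cases "t = 0") auto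
  moreover have "(1 - t) * rise x i \<ge> 0" "t * fall x i \<ge> 0" using pq_pos[OF assms(1)] assms by (auto intro: mult_nonneg_nonneg less_imp_le)
  ultimately obtain \<omega> \<rho> where "\<theta> i \<le> \<omega>" "\<omega> \<le> \<theta> (Suc i)" "\<rho> > 0" "arc_normal x i t = \<rho> *\<^sub>R uvec \<omega>"
    using cone_angle[OF \<theta>_less[OF assms(1)] \<theta>_gap[OF assms(1)], of "(1 - t) * rise x i" "t * fall x i"] unfolding arc_normal_def by blast
  then have "\<exists>\<omega>. \<theta> i \<le> \<omega> \<and> \<omega> \<le> \<theta> (Suc i) \<and> (\<exists>\<rho>>0. arc_normal x i t = \<rho> *\<^sub>R uvec \<omega>)" by blast
  from someI_ex[OF this, folded arc_angle_def] show ?thesis using that by blast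
qed

lemma arc_angle_ends:
  assumes "i < k" shows "arc_angle i 0 = \<theta> i" "arc_angle i 1 = \<theta> (Suc i)"
proof -
  obtain \<rho> where r: "\<theta> i \<le> arc_angle i 0" "arc_angle i 0 \<le> \<theta> (Suc i)" "\<rho> > 0" "arc_normal x i 0 = \<rho> *\<^sub>R uvec (arc_angle i 0)"
    using arc_angle[OF assms, of 0] by auto
  have "cross2 (u i) (arc_normal x i 0) = 0" by (simp add: arc_normal_def cross2_def)
  then have "\<rho> * sin (arc_angle i 0 - \<theta> i) = 0" unfolding r(4) using cross2_scale[of 1 "u i" \<rho>] by (simp add: cross2_uvec)
  then have "\<not> sin (arc_angle i 0 - \<theta> i) > 0" using r(3) by simp
  then have "\<not> 0 < arc_angle i 0 - \<theta> i" using sin_gt_zero[of "arc_angle i 0 - \<theta> i"] r \<theta>_gap[OF assms] by linarith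
  then show "arc_angle i 0 = \<theta> i" using r(1) by simp
  obtain \<rho> where r: "\<theta> i \<le> arc_angle i 1" "arc_angle i 1 \<le> \<theta> (Suc i)" "\<rho> > 0" "arc_normal x i 1 = \<rho> *\<^sub>R uvec (arc_angle i 1)"
    using arc_angle[OF assms, of 1] by auto
  have "cross2 (arc_normal x i 1) (u (Suc i)) = 0" by (simp add: arc_normal_def cross2_def)
  then have "\<rho> * sin (\<theta> (Suc i) - arc_angle i 1) = 0" unfolding r(4) using cross2_scale[of \<rho> _ 1 "u (Suc i)"] by (simp add: cross2_uvec)
  then have "\<not> sin (\<theta> (Suc i) - arc_angle i 1) > 0" using r(3) by simp
  then have "\<not> 0 < \<theta> (Suc i) - arc_angle i 1" using sin_gt_zero[of "\<theta> (Suc i) - arc_angle i 1"] r \<theta>_gap[OF assms] by linarith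
  then show "arc_angle i 1 = \<theta> (Suc i)" using r(2) by simp
qed

section \<open>Chains along the parabola arcs\<close>

definition arc_node :: "nat \<Rightarrow> real \<Rightarrow> real \<times> plane" where
  "arc_node i t = (arc_angle i t, arc x i t)"

lemma arc_node_ends: "i < k \<Longrightarrow> arc_node i 0 = node x i" "i < k \<Longrightarrow> arc_node i 1 = node x (Suc i)"
  by (simp_all add: arc_node_def node_def arc_angle_ends)

lemma arc_node_contact:
  assumes "i < k" "0 \<le> t" "t \<le> 1" shows "contact (parabola_body x) (arc_node i t)"
proof -
  obtain \<rho> where r: "\<rho> > 0" "arc_normal x i t = \<rho> *\<^sub>R uvec (arc_angle i t)" using arc_angle[OF assms] by blast
  have "arc x i t \<in> parabola_body x" unfolding parabola_body_def using assms by (intro hull_inc UN_I[of i] imageI) auto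
  moreover have "parabola_body x \<subseteq> {q. uvec (arc_angle i t) \<bullet> q \<le> uvec (arc_angle i t) \<bullet> arc x i t}"
    unfolding parabola_body_def
  proof (rule hull_minimal)
    show "(\<Union>j<k. arc x j ` {0..1}) \<subseteq> {q. uvec (arc_angle i t) \<bullet> q \<le> uvec (arc_angle i t) \<bullet> arc x i t}"
    proof
      fix q assume "q \<in> (\<Union>j<k. arc x j ` {0..1})"
      then obtain j m where "j < k" "0 \<le> m" "m \<le> 1" "q = arc x j m" by auto
      then have "arc_normal x i t \<bullet> (q - arc x i t) \<le> 0" using arc_below assms by auto
      then show "q \<in> {q. uvec (arc_angle i t) \<bullet> q \<le> uvec (arc_angle i t) \<bullet> arc x i t}"
        unfolding r(2) using r(1) by (simp add: inner_diff_right mult_le_0_iff)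
    qed
  qed (rule convex_halfspace_le)
  ultimately show ?thesis by (auto simp: contact_def arc_node_def)
qed

text \<open>With the normals scaled as in \<open>arc_normal\<close>, both gaps are proportional to
  the square of \<open>m - t\<close> and the sine to \<open>m - t\<close> itself. The area thus
  scales like the cube of the parameter length, and the cells along an arc add up exactly: this is
  why parabolas attain the bound.\<close>

lemma arc_node_cell:
  assumes "i < k" "0 \<le> t" "t < m" "m \<le> 1"
  shows "cstep (arc_node i t) (arc_node i m)" "cell (arc_node i t) (arc_node i m) = (m - t) * cell (node x i) (node x (Suc i))"
proof -
  obtain \<rho> where r: "\<theta> i \<le> arc_angle i t" "arc_angle i t \<le> \<theta> (Suc i)" "\<rho> > 0" "arc_normal x i t = \<rho> *\<^sub>R uvec (arc_angle i t)"
    using arc_angle[of i t] assms by auto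
  obtain \<sigma> where s: "\<theta> i \<le> arc_angle i m" "arc_angle i m \<le> \<theta> (Suc i)" "\<sigma> > 0" "arc_normal x i m = \<sigma> *\<^sub>R uvec (arc_angle i m)"
    using arc_angle[of i m] assms by auto
  define p q z where "p = rise x i" and "q = fall x i" and "z = sin (\<theta> (Suc i) - \<theta> i)"
  have pos: "p > 0" "q > 0" "z > 0" using pq_pos sin_gap assms(1) by (auto simp: p_def q_def z_def)
  define w where "w = sin (arc_angle i m - arc_angle i t)"
  have "\<rho> * \<sigma> * w = cross2 (arc_normal x i t) (arc_normal x i m)"
    unfolding r(4) s(4) by (simp add: cross2_uvec w_def)
  also have "\<dots> = p * q * z * (m - t)"
    unfolding arc_normal_def p_def q_def z_def by (simp add: cross2_def sin_diff algebra_simps)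
  finally have rsw: "\<rho> * \<sigma> * w = p * q * z * (m - t)" .
  then have "\<rho> * \<sigma> * w > 0" using pos assms by simp
  then have w: "w > 0" using zero_less_mult_pos[OF _ mult_pos_pos[OF r(3) s(3)]] by blast
  have "arc_angle i t < arc_angle i m"
  proof (rule ccontr)
    assume "\<not> ?thesis"
    then have "sin (arc_angle i t - arc_angle i m) \<ge> 0" using r s \<theta>_gap[OF assms(1)] by (intro sin_ge_zero) auto
    then show False using w sin_minus[of "arc_angle i t - arc_angle i m"] by (simp add: w_def)
  qed
  then show "cstep (arc_node i t) (arc_node i m)" using r s \<theta>_gap[OF assms(1)] by (auto simp: cstep_def cle_def arc_node_def)
  have n: "arc_normal x i a \<bullet> (arc x i a - arc x i b) = p * q * (a - b)\<^sup>2" for a b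
  proof -
    have "arc_normal x i a \<bullet> (arc x i a - arc x i b) = arc_normal x i a \<bullet> (arc x i a - x (i mod k)) - arc_normal x i a \<bullet> (arc x i b - x (i mod k))"
      by (simp add: inner_diff_right)
    then show ?thesis unfolding arc_normal_inner[OF assms(1)] by (simp add: p_def q_def power2_eq_square algebra_simps)
  qed
  have g: "\<sigma> * gap (arc_node i t) (arc_node i m) = p * q * (m - t)\<^sup>2" "\<rho> * gap (arc_node i m) (arc_node i t) = p * q * (m - t)\<^sup>2"
    using n[of m t] n[of t m] unfolding r(4) s(4) by (simp_all add: gap_def arc_node_def power2_commute)
  have "gap (arc_node i t) (arc_node i m) * gap (arc_node i m) (arc_node i t) / (2 * w)
     = (\<sigma> * gap (arc_node i t) (arc_node i m)) * (\<rho> * gap (arc_node i m) (arc_node i t)) / (2 * (\<rho> * \<sigma> * w))"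
    using r(3) s(3) by simp
  also have "\<dots> = (m - t) ^ 3 * (p * q / (2 * z))"
    unfolding g rsw using pos assms by (simp add: power2_eq_square power3_eq_cube field_simps)
  finally have "gap (arc_node i t) (arc_node i m) * gap (arc_node i m) (arc_node i t) / (2 * w) = (m - t) ^ 3 * (p * q / (2 * z))" .
  then have "cell (arc_node i t) (arc_node i m) = root 3 ((m - t) ^ 3) * root 3 (p * q / (2 * z))"
    by (simp add: cell_def arc_node_def w_def real_root_mult[symmetric])
  then show "cell (arc_node i t) (arc_node i m) = (m - t) * cell (node x i) (node x (Suc i))"
    using assms by (simp add: real_root_pos2 cell_def p_def q_def z_def rise_def fall_def)
qed

lemma parabola_convex_body: "convex_body (parabola_body x)"
proof -
  have "continuous_on {0..1} (arc x i)" for i unfolding arc_def by (intro continuous_intros)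
  then have "compact (\<Union>i<k. arc x i ` {0..1})" by (intro compact_UN compact_continuous_image) auto
  then have "compact (parabola_body x)" unfolding parabola_body_def by (rule compact_convex_hull)
  moreover have cv: "convex (parabola_body x)" by (simp add: parabola_body_def)
  moreover have "interior (parabola_body x) \<noteq> {}"
  proof
    assume "interior (parabola_body x) = {}"
    then obtain a b where ab: "a \<noteq> 0" "parabola_body x \<subseteq> {v. a \<bullet> v = b}"
      using empty_interior_subset_hyperplane[OF cv] by blast
    have mem: "arc x 0 t \<in> parabola_body x" if "t \<in> {0..1}" for t
      unfolding parabola_body_def using that by (intro hull_inc UN_I[of 0] imageI) auto
    \<comment> \<open>The ends and the midpoint of a single arc are not collinear.\<close>
    define d e where "d = arc x 0 1 - arc x 0 0" and "e = arc x 0 (1/2) - arc x 0 0"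
    have de: "a \<bullet> d = 0" "a \<bullet> e = 0"
    proof -
      have "a \<bullet> arc x 0 t = b" if "t \<in> {0..1}" for t using ab(2) mem[OF that] by blast
      from this[of 0] this[of 1] this[of "1/2"] show "a \<bullet> d = 0" "a \<bullet> e = 0"
        by (simp_all add: d_def e_def inner_diff_right del: arc_0 arc_1)
    qed
    have d: "d = arc x 0 1 - x (0 mod k)" and e: "e = arc x 0 (1/2) - x (0 mod k)"
      by (simp_all only: d_def e_def arc_0)
    have "cross2 d e * sin (\<theta> (Suc 0) - \<theta> 0) = - (rise x 0 * fall x 0 / 2)"
      unfolding cross2_mult_sin d e arc_inner[OF k_pos] by (simp add: power2_eq_square)
    then have "cross2 d e \<noteq> 0" using pq_pos[of 0] by auto
    moreover have "a $ 1 * cross2 d e = 0" "a $ 2 * cross2 d e = 0"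
      using de unfolding cross2_def inner_plane by algebra+
    ultimately have "a = 0" by (intro plane_eqI) auto
    then show False using ab by simp
  qed
  ultimately show ?thesis by (simp add: convex_body_def)
qed

text \<open>Each arc is divided into \<open>N\<close> equal parameter steps. The last index is
  separate because arcs are numbered below \<open>k\<close>, while the chain has to end with the
  first normal one full turn later.\<close>

definition fine_chain :: "nat \<Rightarrow> nat \<Rightarrow> real \<times> plane" where
  "fine_chain N l = (if l = k * N then node x k else arc_node (l div N) (real (l mod N) / real N))"

lemma fine_chain_Suc:
  assumes "N > 0" "l < k * N"
  shows "fine_chain N (Suc l) = arc_node (l div N) (real (Suc (l mod N)) / real N)"
proof -
  have i: "l div N < k" using assms by (simp add: less_mult_imp_div_less)
  show ?thesis
  proof (cases "Suc (l mod N) = N")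
    case True
    then have sd: "Suc l div N = Suc (l div N)" "Suc l mod N = 0" by (simp_all add: div_Suc mod_Suc)
    have "arc_node (l div N) (real (Suc (l mod N)) / real N) = node x (Suc (l div N))"
      using True assms arc_node_ends(2)[OF i] by simp
    moreover have "fine_chain N (Suc l) = node x (Suc (l div N))"
    proof (cases "Suc l = k * N")
      case True
      then have "Suc (l div N) = k" using sd assms by (metis nonzero_mult_div_cancel_right not_gr0)
      then show ?thesis using True by (simp add: fine_chain_def)
    next
      case False
      then have "Suc l div N < k" using assms by (simp add: less_mult_imp_div_less)
      then show ?thesis using False sd arc_node_ends(1) by (simp add: fine_chain_def)
    qed
    ultimately show ?thesis by simp
  next
    case False
    then have sd: "Suc l div N = l div N" "Suc l mod N = Suc (l mod N)" by (simp_all add: div_Suc mod_Suc)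
    then have "Suc l \<noteq> k * N" using False by auto
    then show ?thesis using sd by (simp add: fine_chain_def)
  qed
qed

lemma fine_chain_cell:
  assumes "N > 0" "l < k * N"
  shows "cstep (fine_chain N l) (fine_chain N (Suc l))"
    and "cell (fine_chain N l) (fine_chain N (Suc l)) = cell (node x (l div N)) (node x (Suc (l div N))) / real N"
proof -
  have i: "l div N < k" using assms by (simp add: less_mult_imp_div_less)
  have "Suc (l mod N) \<le> N" using assms by (simp add: Suc_leI)
  then have "real (Suc (l mod N)) \<le> real N" by (simp only: of_nat_le_iff)
  then have t: "0 \<le> real (l mod N) / real N" "real (l mod N) / real N < real (Suc (l mod N)) / real N" "real (Suc (l mod N)) / real N \<le> 1"
    using assms by (simp_all add: divide_strict_right_mono)
  have e: "fine_chain N l = arc_node (l div N) (real (l mod N) / real N)" using assms by (simp add: fine_chain_def)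
  show "cstep (fine_chain N l) (fine_chain N (Suc l))"
    unfolding fine_chain_Suc[OF assms] e by (rule arc_node_cell(1)[OF i t])
  have "real (Suc (l mod N)) / real N - real (l mod N) / real N = 1 / real N" by (simp add: diff_divide_distrib[symmetric])
  then show "cell (fine_chain N l) (fine_chain N (Suc l)) = cell (node x (l div N)) (node x (Suc (l div N))) / real N"
    unfolding fine_chain_Suc[OF assms] e arc_node_cell(2)[OF i t] by simp
qed

lemma fine_chain_closed:
  assumes "N > 0"
  shows "closed_chain (parabola_body x) (fine_chain N) (k * N)" "chain_sum (fine_chain N) (k * N) = Phi x"
proof -
  have "contact (parabola_body x) (fine_chain N l)" if "l \<le> k * N" for l
  proof (cases "l = k * N")
    case True
    have "contact (parabola_body x) (node x (Suc (k - 1)))"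
      using arc_node_contact[of "k - 1" 1] arc_node_ends(2)[of "k - 1"] k3 by simp
    then show ?thesis using True k3 by (simp add: fine_chain_def)
  next
    case False
    then have "l div N < k" "l mod N < N" using that assms by (simp_all add: less_mult_imp_div_less)
    then show ?thesis using False by (simp add: fine_chain_def arc_node_contact)
  qed
  moreover have "fine_chain N (k * N) = cshift 1 (fine_chain N 0)"
    using assms k3 \<theta>_closed by (simp add: fine_chain_def arc_node_ends) (simp add: node_def cshift_def)
  ultimately show "closed_chain (parabola_body x) (fine_chain N) (k * N)"
    using fine_chain_cell(1)[OF assms] by (simp add: closed_chain_def open_chain_def)
  have "chain_sum (fine_chain N) (k * N) = (\<Sum>l<k * N. cell (node x (l div N)) (node x (Suc (l div N))) / real N)"
    unfolding chain_sum_def by (intro sum.cong refl fine_chain_cell(2) assms) auto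
  also have "\<dots> = (\<Sum>i<k. \<Sum>l\<in>{i * N..<i * N + N}. cell (node x (l div N)) (node x (Suc (l div N))) / real N)"
    by (rule sum.nat_group[symmetric])
  also have "\<dots> = (\<Sum>i<k. \<Sum>l\<in>{i * N..<i * N + N}. cell (node x i) (node x (Suc i)) / real N)"
  proof (intro sum.cong refl)
    fix i l assume "l \<in> {i * N..<i * N + N}"
    then have "l div N = i" by (intro div_nat_eqI) (auto simp: algebra_simps)
    then show "cell (node x (l div N)) (node x (Suc (l div N))) / real N = cell (node x i) (node x (Suc i)) / real N" by simp
  qed
  also have "\<dots> = Phi x" using assms by (simp add: Phi_def chain_sum_def)
  finally show "chain_sum (fine_chain N) (k * N) = Phi x" .
qed

text \<open>Refinement leaves the chain sum constantly \<open>Phi x\<close> while the single cells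
  tend to 0, so this constant is the limit.\<close>

lemma half_perimeter_parabola_body: "half_perimeter (parabola_body x) = Phi x"
proof -
  have "(\<lambda>n. chain_sum (fine_chain (Suc n)) (k * Suc n)) \<longlonglongrightarrow> half_perimeter (parabola_body x)"
  proof (rule chain_sums_tendsto)
    show "eventually (\<lambda>n. closed_chain (parabola_body x) (fine_chain (Suc n)) (k * Suc n)) sequentially"
      by (intro always_eventually allI fine_chain_closed(1)) simp
    fix \<delta> :: real assume d: "\<delta> > 0"
    have "(\<lambda>n. Phi x * inverse (real (Suc n))) \<longlonglongrightarrow> Phi x * 0"
      by (intro tendsto_mult_left LIMSEQ_inverse_real_of_nat)
    then have "eventually (\<lambda>n. Phi x * inverse (real (Suc n)) < \<delta>) sequentially"
      using d by (intro order_tendstoD(2)) auto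
    then show "eventually (\<lambda>n. \<forall>i<k * Suc n. cell (fine_chain (Suc n) i) (fine_chain (Suc n) (Suc i)) \<le> \<delta>) sequentially"
    proof eventually_elim
      case (elim n)
      show ?case
      proof (intro allI impI)
        fix l assume l: "l < k * Suc n"
        have i: "l div Suc n < k" using l less_mult_imp_div_less by blast
        have "cell (node x (l div Suc n)) (node x (Suc (l div Suc n))) \<le> Phi x"
          unfolding Phi_def chain_sum_def
          using i by (intro member_le_sum[of "l div Suc n" "{..<k}" "\<lambda>i. cell (node x i) (node x (Suc i))"] config_cell_nonneg[OF cx]) auto
        then have "cell (node x (l div Suc n)) (node x (Suc (l div Suc n))) / real (Suc n) \<le> Phi x * inverse (real (Suc n))"
          unfolding divide_inverse by (intro mult_right_mono) auto
        then show "cell (fine_chain (Suc n) l) (fine_chain (Suc n) (Suc l)) \<le> \<delta>"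
          using fine_chain_cell(2)[of "Suc n" l] l elim by simp
      qed
    qed
  qed
  moreover have "(\<lambda>n. chain_sum (fine_chain (Suc n)) (k * Suc n)) = (\<lambda>_. Phi x)"
    by (intro ext fine_chain_closed(2)) simp
  ultimately have "(\<lambda>_::nat. Phi x) \<longlonglongrightarrow> half_perimeter (parabola_body x)" by (simp only:)
  then show ?thesis by (simp add: LIMSEQ_const_iff)
qed

lemma parabola_body_contact: "i < k \<Longrightarrow> contact (parabola_body x) (\<theta> i, x i)"
  using arc_node_contact[of i 0] arc_node_ends(1)[of i] by (simp add: node_def)

end

section \<open>Polygons and the limit shape\<close>

definition support_value :: "plane set \<Rightarrow> real \<Rightarrow> real" where
  "support_value K t = (SUP q\<in>K. uvec t \<bullet> q)"

definition side_at :: "plane set \<Rightarrow> real \<Rightarrow> plane set" where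
  "side_at K t = K \<inter> {q. uvec t \<bullet> q = support_value K t}"

text \<open>Sides are encoded by the angles of their outer normals, which makes sides of different
  polygons comparable.\<close>

definition side_angles :: "plane set \<Rightarrow> real set" where
  "side_angles K = {t \<in> {0..<2 * pi}. side_at K t edge_of K}"

lemma support_value_contact: "contact K (t, x) \<Longrightarrow> support_value K t = uvec t \<bullet> x"
  unfolding support_value_def by (rule cSup_eq_maximum) (auto simp: contact_def)

lemma support_value_ge:
  assumes "compact K" "q \<in> K" shows "uvec t \<bullet> q \<le> support_value K t"
proof -
  obtain x where x: "contact K (t, x)" using contact_exists[OF assms(1)] assms(2) by blast
  then show ?thesis using support_value_contact[OF x] assms(2) by (simp add: contact_def)
qed

lemma contact_frontier:
  assumes "contact S (t, x)" shows "x \<in> frontier S"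
proof -
  have "x \<notin> interior S"
  proof
    assume "x \<in> interior S"
    then obtain e where e: "e > 0" "cball x e \<subseteq> S" by (auto simp: mem_interior_cball)
    have "x + e *\<^sub>R uvec t \<in> cball x e" using e by (simp add: dist_norm)
    then have "uvec t \<bullet> (x + e *\<^sub>R uvec t) \<le> uvec t \<bullet> x" using assms e by (auto simp: contact_def)
    then show False using e by (simp add: inner_add_right inner_uvec_uvec)
  qed
  moreover have "x \<in> closure S" using assms closure_subset by (auto simp: contact_def)
  ultimately show ?thesis by (simp add: frontier_def)
qed

lemma interior_support_less:
  assumes "compact K" "c \<in> interior K" shows "uvec t \<bullet> c < support_value K t"
proof -
  have cK: "c \<in> K" using assms interior_subset by blast
  have "uvec t \<bullet> c \<noteq> support_value K t"
  proof
    assume "uvec t \<bullet> c = support_value K t"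
    then have "contact K (t, c)" using support_value_ge[OF assms(1)] cK by (auto simp: contact_def)
    then show False using contact_frontier assms(2) by (auto simp: frontier_def)
  qed
  then show ?thesis using support_value_ge[OF assms(1) cK, of t] by linarith
qed

lemma uvec_inj:
  assumes "uvec s = uvec t" "s \<in> {0..<2*pi}" "t \<in> {0..<2*pi}" shows "s = t"
proof -
  have "sin s = sin t \<and> cos s = cos t" using assms(1) by (metis uvec_nth)
  then obtain n :: int where n: "s = t + 2 * pi * n" unfolding sin_cos_eq_iff by blast
  have "\<bar>2 * pi * n\<bar> < 2 * pi * 1" using n assms by auto
  then have "\<bar>real_of_int n\<bar> < 1" by (simp only: abs_mult mult_less_cancel_left) auto
  then have "n = 0" by linarith
  then show ?thesis using n by simp
qed

lemma convex_polygonD: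
  assumes "convex_polygon K" 
  shows "compact K" "convex K" "polyhedron K" "aff_dim K = 2" "K \<noteq> {}"
  using assms by (auto simp: convex_polygon_def polytope_imp_compact polytope_imp_convex polytope_imp_polyhedron
      aff_dim_nonempty_interior)

lemma edge_at_angle:
  assumes K: "convex_polygon K" and F: "F \<in> sides K"
  obtains t where "t \<in> side_angles K" "F = side_at K t"
proof -
  note K' = convex_polygonD[OF K]
  have edge: "F face_of K" "aff_dim F = 1" using F by (auto simp: sides_def edge_of_def)
  have "F exposed_face_of K" using exposed_face_of_polyhedron[OF K'(3)] edge by blast
  moreover have ne: "F \<noteq> {}" "F \<noteq> K" using edge K'(4) by auto
  ultimately obtain a b where ab: "a \<noteq> 0" "K \<subseteq> {x. a \<bullet> x \<le> b}" "F = K \<inter> {x. a \<bullet> x = b}"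
    unfolding exposed_face_of by blast
  obtain t where t: "0 \<le> t" "t < 2 * pi" "a = norm a *\<^sub>R uvec t" by (rule polar_plane)
  have ae: "a \<bullet> p = norm a * (uvec t \<bullet> p)" for p by (subst t(3)) simp
  have n: "norm a > 0" using ab by simp
  obtain p where p: "p \<in> F" using ne by blast
  have "contact K (t, p)" using p ab n by (auto simp: contact_def ae subset_iff mult_le_cancel_left_pos)
  then have "support_value K t = uvec t \<bullet> p" by (rule support_value_contact)
  then have "F = side_at K t" using p ab n by (auto simp: side_at_def ae)
  then show ?thesis using that t F by (auto simp: side_angles_def sides_def)
qed

lemma side_at_inj:
  assumes K: "convex_polygon K" and s: "s \<in> side_angles K" and t: "t \<in> side_angles K" and eq: "side_at K s = side_at K t"
  shows "s = t"
proof -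
  note K' = convex_polygonD[OF K]
  have "aff_dim (side_at K t) = 1" using t by (simp add: side_angles_def edge_of_def)
  then have "\<not> (\<exists>a. side_at K t = {a}) \<and> side_at K t \<noteq> {}" by auto
  then obtain p p' where p: "p \<in> side_at K t" "p' \<in> side_at K t" "p \<noteq> p'" by blast
  then have in0: "uvec t \<bullet> (p - p') = 0" "uvec s \<bullet> (p - p') = 0"
  proof -
    have "p \<in> side_at K s" "p' \<in> side_at K s" using p eq by simp_all
    then show "uvec s \<bullet> (p - p') = 0" by (simp add: side_at_def inner_diff_right)
  qed (use p in \<open>simp add: side_at_def inner_diff_right\<close>)
  have s0: "sin (t - s) = 0"
    using uvec_inner_eqI[of t s "p - p'" 0] in0 p(3) by auto
  have "uvec t = uvec s \<or> uvec t = - uvec s" using s0 by (rule uvec_parallel)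
  moreover have "uvec t \<noteq> - uvec s"
  proof
    assume opp: "uvec t = - uvec s"
    obtain c where c: "c \<in> interior K" using K by (auto simp: convex_polygon_def)
    have "uvec t \<bullet> c < uvec t \<bullet> p" "uvec s \<bullet> c < uvec s \<bullet> p"
    proof -
      have "p \<in> side_at K s" using p(1) eq by simp
      then show "uvec s \<bullet> c < uvec s \<bullet> p" using interior_support_less[OF K'(1) c, of s] by (simp add: side_at_def)
    qed (use interior_support_less[OF K'(1) c, of t] p(1) in \<open>simp add: side_at_def\<close>)
    then show False using opp by simp
  qed
  ultimately have "uvec s = uvec t" by simp
  then show ?thesis using uvec_inj s t by (auto simp: side_angles_def)
qed

lemma bij_betw_sides: "convex_polygon K \<Longrightarrow> bij_betw (side_at K) (side_angles K) (sides K)"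
  unfolding bij_betw_def
proof (intro conjI subset_antisym subsetI)
  assume K: "convex_polygon K"
  show "inj_on (side_at K) (side_angles K)" by (intro inj_onI side_at_inj[OF K])
  show "F \<in> sides K" if "F \<in> side_at K ` side_angles K" for F using that by (auto simp: side_angles_def sides_def)
  show "F \<in> side_at K ` side_angles K" if "F \<in> sides K" for F using edge_at_angle[OF K that] by blast
qed

lemma finite_side_angles: "convex_polygon K \<Longrightarrow> finite (side_angles K)"
proof -
  assume K: "convex_polygon K"
  have "finite (sides K)"
    using K by (intro finite_subset[OF _ finite_polytope_faces[of K]]) (auto simp: sides_def edge_of_def convex_polygon_def)
  then show ?thesis using bij_betw_sides[OF K] bij_betw_finite by blast
qed

text \<open>The segment from an interior point to a point outside crosses the frontier on some side.
  The interior point lies strictly below the line of that side and the outer one weakly, so the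
  crossing point could not lie on it.\<close>

lemma convex_polygon_eq_halfplanes:
  assumes K: "convex_polygon K"
  shows "K = {q. \<forall>t\<in>side_angles K. uvec t \<bullet> q \<le> support_value K t}"
proof
  note K' = convex_polygonD[OF K]
  show "K \<subseteq> {q. \<forall>t\<in>side_angles K. uvec t \<bullet> q \<le> support_value K t}" using support_value_ge[OF K'(1)] by auto
  show "{q. \<forall>t\<in>side_angles K. uvec t \<bullet> q \<le> support_value K t} \<subseteq> K"
  proof (rule subsetI, rule ccontr)
    fix q assume q: "q \<in> {q. \<forall>t\<in>side_angles K. uvec t \<bullet> q \<le> support_value K t}" "q \<notin> K"
    obtain c where c: "c \<in> interior K" using K by (auto simp: convex_polygon_def)
    then have cK: "c \<in> K" using interior_subset by blast
    have "closed_segment c q \<inter> frontier K \<noteq> {}"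
      using cK q(2) by (intro connected_Int_frontier) auto
    then obtain p where p: "p \<in> closed_segment c q" "p \<in> frontier K" by blast
    have "frontier K = \<Union>{F. F facet_of K}"
      using rel_frontier_of_polyhedron[OF K'(3)] K by (simp add: rel_frontier_nonempty_interior convex_polygon_def)
    then obtain F where F: "F facet_of K" "p \<in> F" using p by blast
    then have "F \<in> sides K" using K'(4) by (simp add: facet_of_def sides_def edge_of_def)
    then obtain t where t: "t \<in> side_angles K" "F = side_at K t" using edge_at_angle[OF K] by blast
    have pt: "uvec t \<bullet> p = support_value K t" "p \<in> K" using F t by (auto simp: side_at_def)
    obtain s where s: "0 \<le> s" "s \<le> 1" "p = (1 - s) *\<^sub>R c + s *\<^sub>R q" using p(1) by (auto simp: in_segment)
    have "s \<noteq> 1" using s pt(2) q(2) by auto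
    then have "(1 - s) * (uvec t \<bullet> c) < (1 - s) * support_value K t"
      using s interior_support_less[OF K'(1) c, of t] by simp
    moreover have "s * (uvec t \<bullet> q) \<le> s * support_value K t" using q(1) t(1) s by (intro mult_left_mono) auto
    ultimately have "(1 - s) * (uvec t \<bullet> c) + s * (uvec t \<bullet> q) < support_value K t" by (simp add: algebra_simps)
    then show False using pt(1) s(3) by (simp add: inner_add_right)
  qed
qed

lemma fan_exists:
  assumes A: "finite A" "A \<subseteq> {0..<2*pi}" "{0, pi/2, pi, 3*pi/2} \<subseteq> A"
  obtains k \<theta> where "fan k \<theta>" "\<theta> ` {..<k} = A" "inj_on \<theta> {..<k}"
proof -
  define xs where "xs = sorted_list_of_set A"
  define k where "k = length xs"
  define \<theta> where "\<theta> i = (if i < k then xs ! i else 2 * pi)" for i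
  have xs: "set xs = A" "sorted_wrt (<) xs" using A by (simp_all add: xs_def)
  have im: "\<theta> ` {..<k} = A" using xs by (auto simp: \<theta>_def k_def set_conv_nth)
  have k: "k = card A" by (simp add: k_def xs_def)
  have inj: "inj_on \<theta> {..<k}" using im k by (intro eq_card_imp_inj_on) auto
  have "card {0, pi/2, pi, 3*pi/2} \<le> k" unfolding k using A by (intro card_mono)
  moreover have "card {0, pi/2, pi, 3*pi/2} = 4" by (simp add: card_insert_if)
  ultimately have k3: "3 \<le> k" by simp
  have rng: "0 \<le> \<theta> i" "\<theta> i < 2*pi" if "i < k" for i using im A(2) that by force+
  have mono: "\<theta> i < \<theta> j" if "i < j" "j \<le> k" for i j
    using that rng[of i] sorted_wrt_nth_less[OF xs(2), of i j] by (auto simp: \<theta>_def k_def)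
  have "\<theta> 0 = 0"
  proof -
    obtain j where j: "j < k" "\<theta> j = 0" using im A(3) by (metis image_iff insert_subset lessThan_iff)
    then show ?thesis using mono[of 0 j] rng[of 0] k3 by (cases "j = 0") auto
  qed
  have nobetw: False if "i < k" "a \<in> A" "\<theta> i < a" "a < \<theta> (Suc i)" for i a
  proof -
    have "a \<in> \<theta> ` {..<k}" using im that(2) by simp
    then obtain j where j: "j < k" "\<theta> j = a" by blast
    have "i < j" using that j mono[of j i] by (cases "j < i"; cases "j = i") auto
    then have "Suc i = j \<or> \<theta> (Suc i) < \<theta> j" using mono[of "Suc i" j] j by (cases "Suc i = j") auto
    then show False using that j by auto
  qed
  have "fan k \<theta>"
  proof
    show "3 \<le> k" by (rule k3)
    show "\<theta> k = \<theta> 0 + 2 * pi" using \<open>\<theta> 0 = 0\<close> by (simp add: \<theta>_def)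
    fix i assume i: "i < k"
    show "\<theta> i < \<theta> (Suc i)" using mono i by simp
    show "\<theta> (Suc i) - \<theta> i < pi"
    proof (rule ccontr)
      assume H: "\<not> ?thesis"
      have le: "\<theta> (Suc i) \<le> 2 * pi" using rng[of "Suc i"] i by (cases "Suc i < k") (auto simp: \<theta>_def)
      have "\<theta> i < pi/2 \<or> pi/2 \<le> \<theta> i \<and> \<theta> i < pi \<or> pi \<le> \<theta> i \<and> \<theta> i < 3*pi/2 \<or> 3*pi/2 \<le> \<theta> i" by linarith
      then show False
      proof (elim disjE conjE)
        assume "3*pi/2 \<le> \<theta> i" then show False using H le pi_gt_zero by linarith
      next
        assume "\<theta> i < pi/2" then show False using nobetw[OF i, of "pi/2"] H A(3) pi_gt_zero rng[OF i] by auto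
      next
        assume "pi/2 \<le> \<theta> i" "\<theta> i < pi" then show False using nobetw[OF i, of "pi"] H A(3) pi_gt_zero rng[OF i] by auto
      next
        assume "pi \<le> \<theta> i" "\<theta> i < 3*pi/2" then show False using nobetw[OF i, of "3*pi/2"] H A(3) pi_gt_zero rng[OF i] by auto
      qed
    qed
  qed
  then show ?thesis using that im inj by blast
qed

context fan
begin

section \<open>The limit shape of an intersection of half-planes\<close>

definition region :: "nat set \<Rightarrow> (nat \<Rightarrow> real) \<Rightarrow> plane set" where
  "region I h = {q. \<forall>i\<in>I. u i \<bullet> q \<le> h i}"

text \<open>Contact points of a body in the region form an admissible configuration, so
  \<open>Phi x\<close> bounds half its perimeter. A body attaining the bound has a maximal
  configuration, which is \<open>x\<close> by \<open>uniq\<close>, and is then the parabola body.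
  The assumption \<open>uniq\<close> is supplied both for all sides of a polygon and for its touched
  sides.\<close>

lemma Dom_region:
  assumes max: "maximal I h x" and nd: "nondeg x" and I: "I \<subseteq> {..<k}"
    and uniq: "\<And>y i. maximal I h y \<Longrightarrow> i < k \<Longrightarrow> y i = x i"
  shows "Dom (region I h) = parabola_body x"
    and "contact (parabola_body x) (\<theta> i, p) \<Longrightarrow> i < k \<Longrightarrow> p = x i"
proof -
  have ax: "admissible I h x" and cx: "config x" using max by (auto simp: maximal_def admissible_def)
  interpret nondeg_config k \<theta> x by unfold_locales (use cx nd in auto)
  let ?D = "parabola_body x"
  have adm: "admissible I h y" if "\<And>i. i < k \<Longrightarrow> contact S (\<theta> i, y i)" "S \<subseteq> region I h" for S y
  proof -
    have "u i \<bullet> y i \<le> h i" if "i \<in> I" for i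
    proof -
      have "y i \<in> S" using \<open>\<And>i. i < k \<Longrightarrow> contact S (\<theta> i, y i)\<close>[of i] that I by (auto simp: contact_def)
      then show ?thesis using \<open>S \<subseteq> region I h\<close> that by (auto simp: region_def)
    qed
    then show ?thesis using contact_config[of S y] that by (simp add: admissible_def)
  qed
  have DK: "?D \<subseteq> region I h"
  proof
    fix q assume q: "q \<in> ?D"
    have "u i \<bullet> q \<le> h i" if i: "i \<in> I" for i
    proof -
      have "u i \<bullet> q \<le> u i \<bullet> x i" using parabola_body_contact[of i] q i I by (auto simp: contact_def)
      also have "\<dots> \<le> h i" using ax i by (simp add: admissible_def)
      finally show ?thesis .
    qed
    then show "q \<in> region I h" by (simp add: region_def)
  qed
  have cont_ex: "\<exists>y. \<forall>i<k. contact S (\<theta> i, y i)" if "convex_body S" for S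
  proof -
    have "compact S" "S \<noteq> {}" using that by (auto simp: convex_body_def)
    then have "\<forall>i. \<exists>y. contact S (\<theta> i, y)" using contact_exists by metis
    then show ?thesis by metis
  qed
  have le: "half_perimeter S \<le> Phi x" if "convex_body S" "S \<subseteq> region I h" for S
  proof -
    from cont_ex[OF that(1)] obtain y where y: "\<And>i. i < k \<Longrightarrow> contact S (\<theta> i, y i)" by blast
    have "half_perimeter S \<le> Phi y" using y by (rule half_perimeter_le_Phi)
    also have "\<dots> \<le> Phi x" using max adm[OF y that(2)] by (simp add: maximal_def)
    finally show ?thesis .
  qed
  have forced: "y i = x i" if "S \<subseteq> region I h" "half_perimeter S = Phi x" "\<And>i. i < k \<Longrightarrow> contact S (\<theta> i, y i)" "i < k" for S y i
  proof -
    have "Phi x \<le> Phi y" using half_perimeter_le_Phi[OF that(3)] that(2) by simp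
    then have "maximal I h y" using max adm[OF that(3,1)] by (auto simp: maximal_def intro: order_trans)
    then show ?thesis using uniq that(4) by blast
  qed
  have eq: "S = ?D" if "convex_body S" "S \<subseteq> region I h" "half_perimeter S = Phi x" for S
  proof -
    from cont_ex[OF that(1)] obtain y where y: "\<And>i. i < k \<Longrightarrow> contact S (\<theta> i, y i)" by blast
    have "contact S (\<theta> i, x i)" if "i < k" for i using y[OF that] forced[OF \<open>S \<subseteq> region I h\<close> \<open>half_perimeter S = Phi x\<close> y that] by simp
    then show ?thesis
      using that half_perimeter_parabola_body
      by (intro maximal_body_unique[OF nd] parabola_convex_body parabola_body_contact) auto
  qed
  have max_ap: "max_affine_perimeter (region I h) = 2 * Phi x"
    unfolding max_affine_perimeter_def
  proof (rule Greatest_equality)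
    show "\<exists>S. convex_body S \<and> S \<subseteq> region I h \<and> 2 * Phi x = affine_perimeter S"
      using parabola_convex_body DK half_perimeter_parabola_body by (intro exI[of _ ?D]) (simp add: affine_perimeter_eq)
  next
    fix a assume "\<exists>S. convex_body S \<and> S \<subseteq> region I h \<and> a = affine_perimeter S"
    then show "a \<le> 2 * Phi x" using le by (auto simp: affine_perimeter_eq)
  qed
  show "Dom (region I h) = ?D"
    unfolding Dom_def max_ap
  proof (rule the_equality)
    show "convex_body ?D \<and> ?D \<subseteq> region I h \<and> affine_perimeter ?D = 2 * Phi x"
      using parabola_convex_body DK half_perimeter_parabola_body by (simp add: affine_perimeter_eq)
  next
    fix S assume "convex_body S \<and> S \<subseteq> region I h \<and> affine_perimeter S = 2 * Phi x"
    then show "S = ?D" by (intro eq) (auto simp: affine_perimeter_eq)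
  qed
  assume p: "contact ?D (\<theta> i, p)" "i < k"
  \<comment> \<open>Exchanging a single contact point yields contact points of the same body, hence
    another maximiser.\<close>
  define y where "y = x(i := p)"
  have "contact ?D (\<theta> j, y j)" if "j < k" for j using p parabola_body_contact[OF that] by (simp add: y_def)
  then have "y i = x i" using DK half_perimeter_parabola_body p(2) by (intro forced[of ?D y]) auto
  then show "p = x i" by (simp add: y_def)
qed

section \<open>Faces of an intersection of half-planes\<close>

lemma region_convex_polygon:
  assumes "T \<subseteq> {..<k}" "interior (region T h) \<noteq> {}" "bounded (region T h)"
  shows "convex_polygon (region T h)"
proof -
  have "region T h = \<Inter> ((\<lambda>i. {q. u i \<bullet> q \<le> h i}) ` T)" by (auto simp: region_def)
  moreover have "polyhedron \<dots>"
    using assms(1) finite_subset by (intro polyhedron_Inter) (auto simp: polyhedron_halfspace_le)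
  ultimately have "polytope (region T h)" using assms(3) by (simp add: polytope_eq_bounded_polyhedron)
  then show ?thesis using assms(2) by (simp add: convex_polygon_def)
qed

lemma strict_slack_interior:
  assumes "finite J" "\<And>i. i \<in> J \<Longrightarrow> u i \<bullet> p < h i"
  obtains \<epsilon> where "\<epsilon> > 0" "\<And>i. i \<in> J \<Longrightarrow> u i \<bullet> (p + \<epsilon> *\<^sub>R w) \<le> h i"
proof -
  obtain \<epsilon> where e: "0 < \<epsilon>" "\<epsilon> < 1" "\<And>i. i \<in> J \<Longrightarrow> (1 - \<epsilon>) * (u i \<bullet> p) + \<epsilon> * (u i \<bullet> (p + w)) \<le> h i"
    by (rule slack_pos[where J = J and a = "\<lambda>i. u i \<bullet> p" and b = "\<lambda>i. u i \<bullet> (p + w)" and h = h]) (use assms in auto)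
  have "u i \<bullet> (p + \<epsilon> *\<^sub>R w) \<le> h i" if "i \<in> J" for i
    using e(3)[OF that] by (simp add: inner_add_right algebra_simps)
  then show ?thesis using that e by blast
qed

lemma contact_on_line:
  assumes T: "T \<subseteq> {..<k}" and p: "p \<in> region T h" and c: "\<And>q. q \<in> region T h \<Longrightarrow> uvec t \<bullet> q \<le> uvec t \<bullet> p"
  obtains i where "i \<in> T" "u i \<bullet> p = h i"
proof (rule ccontr)
  assume H: "\<not> thesis"
  have "u i \<bullet> p < h i" if "i \<in> T" for i using p that H \<open>\<And>i. _ \<Longrightarrow> _ \<Longrightarrow> thesis\<close> by (fastforce simp: region_def less_le)
  then obtain \<epsilon> where "\<epsilon> > 0" "\<And>i. i \<in> T \<Longrightarrow> u i \<bullet> (p + \<epsilon> *\<^sub>R uvec t) \<le> h i"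
    using strict_slack_interior[of T p h "uvec t"] T finite_subset by blast
  then have "uvec t \<bullet> (p + \<epsilon> *\<^sub>R uvec t) \<le> uvec t \<bullet> p" using c by (auto simp: region_def)
  then show False using \<open>\<epsilon> > 0\<close> by (simp add: inner_add_right inner_uvec_uvec)
qed

text \<open>Near \<open>p\<close> only the constraint \<open>i\<close> is active, so the region is
  locally a half-plane. A functional that is maximal at \<open>p\<close> is nonpositive on all
  directions of this half-plane, which leaves only the normal \<open>u i\<close>.\<close>

lemma contact_single_line:
  assumes T: "T \<subseteq> {..<k}" and p: "p \<in> region T h" and c: "\<And>q. q \<in> region T h \<Longrightarrow> uvec t \<bullet> q \<le> uvec t \<bullet> p"
    and i: "i \<in> T" "u i \<bullet> p = h i" and only: "\<And>j. j \<in> T \<Longrightarrow> u j \<bullet> p = h j \<Longrightarrow> j = i"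
  shows "uvec t = u i"
proof -
  have le: "uvec t \<bullet> w \<le> 0" if w: "u i \<bullet> w \<le> 0" for w
  proof -
    have "u j \<bullet> p < h j" if "j \<in> T - {i}" for j using p that only by (fastforce simp: region_def less_le)
    then obtain \<epsilon> where e: "\<epsilon> > 0" "\<And>j. j \<in> T - {i} \<Longrightarrow> u j \<bullet> (p + \<epsilon> *\<^sub>R w) \<le> h j"
      using strict_slack_interior[of "T - {i}" p h w] T finite_subset by blast
    have "u i \<bullet> (p + \<epsilon> *\<^sub>R w) \<le> h i" using i(2) e(1) w by (simp add: inner_add_right mult_nonneg_nonpos)
    then have "p + \<epsilon> *\<^sub>R w \<in> region T h" using e(2) by (auto simp: region_def)
    then have "uvec t \<bullet> (p + \<epsilon> *\<^sub>R w) \<le> uvec t \<bullet> p" by (rule c)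
    then show ?thesis using e(1) by (simp add: inner_add_right mult_le_0_iff)
  qed
  have "uvec t \<bullet> uvec (\<theta> i + pi/2) \<le> 0" "uvec t \<bullet> (- uvec (\<theta> i + pi/2)) \<le> 0" "uvec t \<bullet> (- u i) \<le> 0"
    by (intro le; simp add: inner_uvec_uvec)+
  then have "sin (t - \<theta> i) = 0" "uvec t \<bullet> (- u i) \<le> 0" by simp_all
  moreover have "uvec t \<noteq> - u i"
  proof
    assume "uvec t = - u i"
    then have "uvec t \<bullet> (- u i) = 1" by (simp only: inner_minus_left inner_minus_right inner_uvec_uvec) simp
    then show False using calculation(2) by simp
  qed
  ultimately show ?thesis using uvec_parallel by blast
qed

text \<open>The largest of the inner products with the normals in \<open>T\<close> is continuous and
  positive on the unit circle, hence bounded below by a positive constant there; in the region it is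
  at most a constant divided by the norm.\<close>

lemma spanning_bounded:
  assumes T: "T \<subseteq> {..<k}" and span: "\<And>w. w \<noteq> 0 \<Longrightarrow> \<exists>i\<in>T. u i \<bullet> w > 0"
  shows "bounded (region T h)"
proof -
  have fT: "finite T" using T finite_subset by blast
  have "T \<noteq> {}" using span[of "uvec 0"] by auto
  define f where "f w = (MAX i\<in>T. u i \<bullet> w)" for w
  define H where "H = (MAX i\<in>T. h i)"
  have cf: "continuous_on (sphere 0 1) f"
    unfolding f_def using fT \<open>T \<noteq> {}\<close>
  proof (induction T rule: finite_ne_induct)
    case (insert a F)
    have "(\<lambda>w. MAX i\<in>insert a F. u i \<bullet> w) = (\<lambda>w. max (u a \<bullet> w) (MAX i\<in>F. u i \<bullet> w))"
      using insert by (auto simp: fun_eq_iff)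
    then show ?case using insert by (auto intro!: continuous_intros)
  qed (auto intro!: continuous_intros)
  have "\<exists>w\<in>sphere 0 1. \<forall>v\<in>sphere 0 1. f w \<le> f v"
    by (intro continuous_attains_inf cf compact_sphere) (use norm_uvec[of 0] in \<open>auto intro!: exI[of _ "uvec 0"]\<close>)
  then obtain w where w: "norm w = 1" "\<And>v. norm v = 1 \<Longrightarrow> f w \<le> f v" by auto
  have "w \<noteq> 0" using w(1) by auto
  then obtain i where "i \<in> T" "u i \<bullet> w > 0" using span by blast
  moreover from this have "u i \<bullet> w \<le> f w" unfolding f_def using fT by (intro Max_ge) auto
  ultimately have fw: "f w > 0" by linarith
  have "norm q \<le> \<bar>H\<bar> / f w" if q: "q \<in> region T h" for q
  proof (cases "q = 0")
    case False
    define v where "v = (1 / norm q) *\<^sub>R q"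
    have "norm v = 1" using False by (simp add: v_def)
    then have "f w \<le> f v" by (rule w(2))
    have "f v \<in> (\<lambda>i. u i \<bullet> v) ` T" unfolding f_def using fT \<open>T \<noteq> {}\<close> by (intro Max_in) auto
    then obtain i where i: "i \<in> T" "f v = u i \<bullet> v" by blast
    have "h i \<le> H" unfolding H_def using fT i by (intro Max_ge) auto
    then have "u i \<bullet> q \<le> \<bar>H\<bar>" using q i by (fastforce simp: region_def)
    moreover have "u i \<bullet> q = norm q * (u i \<bullet> v)" using False by (simp add: v_def)
    ultimately have "norm q * f w \<le> \<bar>H\<bar>" using \<open>f w \<le> f v\<close> i(2) by (smt (verit) mult_left_mono norm_ge_zero)
    then show ?thesis using fw by (simp add: pos_le_divide_eq)
  qed (use fw in simp)
  then show ?thesis by (auto simp: bounded_iff)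
qed

text \<open>A relative interior point of an edge lies on one of the bounding lines, and the face on
  that line then contains the whole edge. Both have dimension 1, so they coincide;
  \<open>dim\<close> ensures that every line contributes an edge.\<close>

lemma sides_region:
  assumes T: "T \<subseteq> {..<k}" and poly: "convex_polygon (region T h)"
    and dim: "\<And>i. i \<in> T \<Longrightarrow> aff_dim (region T h \<inter> {q. u i \<bullet> q = h i}) \<ge> 1"
  shows "sides (region T h) = (\<lambda>i. region T h \<inter> {q. u i \<bullet> q = h i}) ` T"
proof
  let ?R = "region T h"
  note R = convex_polygonD[OF poly]
  have face: "?R \<inter> {q. u i \<bullet> q = h i} edge_of ?R" if i: "i \<in> T" for i
  proof -
    have "(?R \<inter> {q. u i \<bullet> q = h i}) face_of ?R"
      using i by (intro face_of_Int_supporting_hyperplane_le R) (auto simp: region_def)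
    moreover have "aff_dim (?R \<inter> {q. u i \<bullet> q = h i}) \<le> aff_dim {q. u i \<bullet> q = h i}" by (intro aff_dim_subset) auto
    moreover have "aff_dim {q. u i \<bullet> q = h i} = 1" by simp
    ultimately show ?thesis using dim[OF i] by (simp add: edge_of_def)
  qed
  then show "(\<lambda>i. ?R \<inter> {q. u i \<bullet> q = h i}) ` T \<subseteq> sides ?R" by (auto simp: sides_def)
  show "sides ?R \<subseteq> (\<lambda>i. ?R \<inter> {q. u i \<bullet> q = h i}) ` T"
  proof
    fix F assume F: "F \<in> sides ?R"
    then obtain t where t: "F = side_at ?R t" using edge_at_angle[OF poly] by blast
    have edge: "F face_of ?R" "aff_dim F = 1" using F by (auto simp: sides_def edge_of_def)
    have "F \<noteq> {}" "convex F" using edge by (auto simp: face_of_imp_convex)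
    then have "rel_interior F \<noteq> {}" by (simp add: rel_interior_eq_empty)
    then obtain p where p: "p \<in> rel_interior F" by blast
    have pF: "p \<in> F" using p rel_interior_subset by blast
    have "uvec t \<bullet> q \<le> uvec t \<bullet> p" if "q \<in> ?R" for q
      using support_value_ge[OF R(1) that, of t] pF t by (simp add: side_at_def)
    then obtain i where i: "i \<in> T" "u i \<bullet> p = h i"
      using contact_on_line[OF T] pF t by (metis IntD1 side_at_def)
    define G where "G = ?R \<inter> {q. u i \<bullet> q = h i}"
    have G: "G face_of ?R" "aff_dim G = 1" using face[OF i(1)] by (auto simp: G_def edge_of_def)
    have "F \<subseteq> G"
    proof (rule subset_of_face_of[OF G(1)])
      show "F \<subseteq> ?R" using edge(1) by (rule face_of_imp_subset)
      have "p \<in> G" using pF t i(2) by (auto simp: G_def side_at_def)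
      then show "G \<inter> rel_interior F \<noteq> {}" using p by blast
    qed
    then have "F face_of G" using face_of_subset[OF edge(1)] G(1) face_of_imp_subset by blast
    then have "F = G" using face_of_aff_dim_lt[of G F] G edge(2) face_of_imp_convex by fastforce
    then show "F \<in> (\<lambda>i. ?R \<inter> {q. u i \<bullet> q = h i}) ` T" using i(1) by (auto simp: G_def)
  qed
qed

end

section \<open>The polygon of the touched sides\<close>

theorem lemma1p7:
  fixes K :: "plane set" and \<kappa> m :: nat
  assumes "\<kappa> \<ge> 3"
    and "convex_polygon K"
    and "card (sides K) = \<kappa>"
    and "m \<in> {3..\<kappa>}"
    and "m = card {F \<in> sides K. Dom_tangent_to K F}"
  shows "\<exists>!KT. convex_polygon KT \<and> K \<subseteq> KT \<and>
           (card (sides KT) = m \<and> (\<forall>F\<in>sides KT. Dom_tangent_to KT F)) \<and>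
           Dom K = Dom KT"
proof -
  note K = assms(2) and K' = convex_polygonD[OF assms(2)]
  \<comment> \<open>The four axis directions only serve to keep the gaps between consecutive normals below \<open>pi\<close>.\<close>
  define A where "A = side_angles K \<union> {0, pi/2, pi, 3*pi/2}"
  have "finite A" "A \<subseteq> {0..<2*pi}" "{0, pi/2, pi, 3*pi/2} \<subseteq> A"
    using finite_side_angles[OF K] by (auto simp: A_def side_angles_def)
  then obtain k \<theta> where fan: "fan k \<theta>" and im: "\<theta> ` {..<k} = A" and inj: "inj_on \<theta> {..<k}"
    by (rule fan_exists)
  interpret fan k \<theta> by (rule fan)
  have rng: "\<theta> i \<in> {0..<2*pi}" if "i < k" for i using im that \<open>A \<subseteq> {0..<2*pi}\<close> by auto
  define I where "I = {i. i < k \<and> \<theta> i \<in> side_angles K}"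
  define h where "h i = support_value K (\<theta> i)" for i
  have I: "I \<subseteq> {..<k}" by (auto simp: I_def)
  have \<theta>I: "\<theta> ` I = side_angles K"
  proof -
    have "side_angles K \<subseteq> \<theta> ` {..<k}" unfolding im by (auto simp: A_def)
    then show ?thesis by (auto simp: I_def)
  qed
  have KI: "K = region I h"
  proof -
    have "region I h = {q. \<forall>t\<in>\<theta> ` I. uvec t \<bullet> q \<le> support_value K t}" by (auto simp: region_def h_def)
    then show ?thesis using convex_polygon_eq_halfplanes[OF K] unfolding \<theta>I by simp
  qed
  obtain c r where cr: "r > 0" "cball c r \<subseteq> K"
    using K by (auto simp: convex_polygon_def mem_interior_cball)
  obtain x z where x: "maximal I h x" and z: "admissible I h z" "nondeg z"
    by (rule maximal_exists[of I h, folded region_def, folded KI, OF K'(1) I cr])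
  have nx: "nondeg x" using maximal_nondeg[OF x z] .
  have cx: "config x" using x by (auto simp: maximal_def admissible_def)
  interpret nondeg_config k \<theta> x by unfold_locales (use cx nx in auto)
  define D where "D = parabola_body x"
  define T where "T = touched I h x"
  have TI: "T \<subseteq> I" by (auto simp: T_def touched_def)
  then have T: "T \<subseteq> {..<k}" using I by blast
  have uq: "y i = x i" if "maximal I h y" "i < k" for y i
    using maximal_unique[OF that(1) x z I that(2)] .
  have DomK: "Dom K = D"
    unfolding KI D_def by (rule Dom_region(1)[OF x nx I]) (erule (1) uq)
  have cD: "p = x i" if "contact D (\<theta> i, p)" "i < k" for i p
    by (rule Dom_region(2)[OF x nx I _ that[unfolded D_def]]) (erule (1) uq)
  have DomT: "Dom (region T h) = D"
    unfolding D_def by (rule Dom_region(1)[OF maximal_touched(1)[OF x I z, folded T_def] nx T])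
      (erule (1) maximal_touched(2)[OF x I z, folded T_def])
  have D: "compact D" "\<And>i. i < k \<Longrightarrow> contact D (\<theta> i, x i)"
    using parabola_convex_body parabola_body_contact by (auto simp: D_def convex_body_def)
  have frD: "frontier D \<subseteq> D" using D(1) by (simp add: compact_imp_closed frontier_subset_closed)
  have xi: "x i \<in> frontier D" if "i < k" for i using contact_frontier[OF D(2)[OF that]] .
  have DK: "D \<subseteq> K"
  proof -
    have "u i \<bullet> q \<le> h i" if "q \<in> D" "i \<in> I" for q i
    proof -
      have "u i \<bullet> q \<le> u i \<bullet> x i" using D(2)[of i] that I by (auto simp: contact_def)
      also have "\<dots> \<le> h i" using x that by (auto simp: maximal_def admissible_def)
      finally show ?thesis .
    qed
    then show ?thesis by (auto simp: KI region_def)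
  qed
  \<comment> \<open>A point of the limit shape on the line of a side is a contact point with the
    normal of that side, and \<open>x i\<close> is the only one.\<close>
  have on_line: "p = x i \<and> i \<in> T" if "p \<in> D" "i \<in> I" "u i \<bullet> p = h i" for p i
  proof -
    have "contact D (\<theta> i, p)"
      using that DK support_value_ge[OF K'(1)] by (auto simp: contact_def h_def)
    then have "p = x i" using cD that I by auto
    then show ?thesis using that by (simp add: T_def touched_def)
  qed
  have tang: "Dom_tangent_to K (side_at K (\<theta> i)) \<longleftrightarrow> i \<in> T" if i: "i \<in> I" for i
  proof
    assume "Dom_tangent_to K (side_at K (\<theta> i))"
    then obtain p where "p \<in> frontier D" "p \<in> side_at K (\<theta> i)" by (auto simp: Dom_tangent_to_def DomK)
    then show "i \<in> T" using on_line[of p i] i frD by (auto simp: side_at_def h_def)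
  next
    assume "i \<in> T"
    then have "x i \<in> frontier D" "x i \<in> side_at K (\<theta> i)"
      using xi T frD DK by (auto simp: side_at_def T_def touched_def h_def)
    then show "Dom_tangent_to K (side_at K (\<theta> i))" by (auto simp: Dom_tangent_to_def DomK)
  qed
  have inj_side: "inj_on (\<lambda>i. side_at K (\<theta> i)) I"
    using bij_betw_imp_inj_on[OF bij_betw_sides[OF K]] inj I \<theta>I
    by (auto simp: inj_on_def) (metis image_eqI lessThan_iff subsetD)
  have sidesI: "sides K = (\<lambda>i. side_at K (\<theta> i)) ` I"
    using bij_betw_imp_surj_on[OF bij_betw_sides[OF K]] unfolding \<theta>I[symmetric] image_image by (rule sym)
  have "{F \<in> sides K. Dom_tangent_to K F} = (\<lambda>i. side_at K (\<theta> i)) ` T"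
    using tang TI unfolding sidesI by auto
  then have mT: "m = card T" using assms(5) card_image[OF inj_on_subset[OF inj_side TI]] by simp
  have inj\<theta>T: "inj_on \<theta> T" using inj T inj_on_subset by blast
  define KT where "KT = region T h"
  have KKT: "K \<subseteq> KT" using TI by (auto simp: KI KT_def region_def)
  have "bounded KT" unfolding KT_def
    using touched_spanning[OF x I z] by (intro spanning_bounded T) (auto simp: T_def)
  moreover have "interior KT \<noteq> {}" using interior_mono[OF KKT] K by (auto simp: convex_polygon_def)
  ultimately have KT: "convex_polygon KT" using T unfolding KT_def by (intro region_convex_polygon)
  have dimT: "aff_dim (KT \<inter> {q. u i \<bullet> q = h i}) \<ge> 1" if "i \<in> T" for i
  proof -
    have "aff_dim (side_at K (\<theta> i)) = 1" using that TI by (auto simp: I_def side_angles_def edge_of_def)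
    moreover have "side_at K (\<theta> i) \<subseteq> KT \<inter> {q. u i \<bullet> q = h i}" using KKT by (auto simp: side_at_def h_def)
    ultimately show ?thesis using aff_dim_subset by metis
  qed
  have sKT: "sides KT = (\<lambda>i. KT \<inter> {q. u i \<bullet> q = h i}) ` T"
    unfolding KT_def using KT dimT T unfolding KT_def by (intro sides_region) auto
  have "support_value KT (\<theta> i) = h i" if "i \<in> T" for i
  proof -
    have "contact KT (\<theta> i, x i)"
    proof -
      have "x i \<in> KT" using xi[of i] that T frD DK KKT by blast
      then show ?thesis using that by (auto simp: contact_def T_def touched_def KT_def region_def)
    qed
    then show ?thesis using that by (simp add: support_value_contact T_def touched_def)
  qed
  then have side_KT: "KT \<inter> {q. u i \<bullet> q = h i} = side_at KT (\<theta> i)" if "i \<in> T" for i using that by (simp add: side_at_def)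
  have inj_T: "inj_on (\<lambda>i. KT \<inter> {q. u i \<bullet> q = h i}) T"
  proof (rule inj_onI)
    fix i j assume ij: "i \<in> T" "j \<in> T" "KT \<inter> {q. u i \<bullet> q = h i} = KT \<inter> {q. u j \<bullet> q = h j}"
    have sa: "\<theta> l \<in> side_angles KT" if "l \<in> T" for l
    proof -
      have "side_at KT (\<theta> l) \<in> sides KT" using that side_KT sKT by auto
      then show ?thesis using rng[of l] that T by (auto simp: side_angles_def sides_def)
    qed
    then have "\<theta> i = \<theta> j" using side_at_inj[OF KT sa sa] ij side_KT by simp
    then show "i = j" using inj ij T by (auto simp: inj_on_def)
  qed
  have tangT: "Dom_tangent_to KT F" if F: "F \<in> sides KT" for F
  proof -
    obtain i where i: "i \<in> T" "F = KT \<inter> {q. u i \<bullet> q = h i}" using F sKT by auto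
    then have "x i \<in> frontier D" "x i \<in> F" using xi[of i] T frD DK KKT by (auto simp: T_def touched_def)
    then show ?thesis using DomT by (auto simp: Dom_tangent_to_def KT_def)
  qed
  show ?thesis
  proof (rule ex1I[of _ KT])
    show "convex_polygon KT \<and> K \<subseteq> KT \<and> (card (sides KT) = m \<and> (\<forall>F\<in>sides KT. Dom_tangent_to KT F)) \<and> Dom K = Dom KT"
      using KT KKT tangT DomK DomT card_image[OF inj_T] mT sKT by (simp add: KT_def)
  next
    fix L assume L: "convex_polygon L \<and> K \<subseteq> L \<and> (card (sides L) = m \<and> (\<forall>F\<in>sides L. Dom_tangent_to L F)) \<and> Dom K = Dom L"
    then have Lp: "convex_polygon L" and KL: "K \<subseteq> L" and DomL: "Dom L = D" using DomK by auto
    note L' = convex_polygonD[OF Lp]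
    have key: "\<exists>i\<in>T. t = \<theta> i \<and> support_value L t = h i" if t: "t \<in> side_angles L" for t
    proof -
      have "side_at L t \<in> sides L" using t by (auto simp: side_angles_def sides_def)
      then have "Dom_tangent_to L (side_at L t)" using L by blast
      then obtain p where p: "p \<in> frontier D" "p \<in> side_at L t" unfolding Dom_tangent_to_def DomL by blast
      have pK: "p \<in> region I h" "p \<in> D" using p(1) frD DK unfolding KI by blast+
      \<comment> \<open>Since \<open>L\<close> contains \<open>K\<close>, the line of a side of
        \<open>L\<close> through a point of the limit shape also supports \<open>K\<close>
        there.\<close>
      have le: "uvec t \<bullet> q \<le> uvec t \<bullet> p" if "q \<in> region I h" for q
      proof -
        have "q \<in> L" using that KL unfolding KI by blast
        then show ?thesis using support_value_ge[OF L'(1), of q t] p(2) by (simp add: side_at_def)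
      qed
      obtain i where i: "i \<in> I" "u i \<bullet> p = h i" using contact_on_line[OF I pK(1) le] by blast
      have px: "p = x i" "i \<in> T" using on_line[OF pK(2) i] by auto
      have "uvec t = u i"
      proof (rule contact_single_line[OF I pK(1) le i])
        fix j assume j: "j \<in> I" "u j \<bullet> p = h j"
        have "x j = x i" using on_line[OF pK(2) j] px(1) by simp
        moreover have "j < k" "i < k" using i(1) j(1) I by blast+
        ultimately show "j = i" by (intro nondeg_distinct[OF cx nx])
      qed
      then have "t = \<theta> i" using uvec_inj[of t "\<theta> i"] t rng[of i] i I by (auto simp: side_angles_def)
      moreover have "support_value L t = h i" using p(2) i(2) \<open>t = \<theta> i\<close> by (simp add: side_at_def)
      ultimately show ?thesis using px by blast
    qed
    have "side_angles L \<subseteq> \<theta> ` T" using key by blast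
    \<comment> \<open>So far every side of \<open>L\<close> lies on a touched line; having exactly
      \<open>m\<close> sides, \<open>L\<close> uses all of them.\<close>
    moreover have "card (side_angles L) = card (\<theta> ` T)"
      using bij_betw_same_card[OF bij_betw_sides[OF Lp]] L mT card_image[OF inj\<theta>T] by simp
    moreover have "finite (\<theta> ` T)" using T finite_subset by blast
    ultimately have eqT: "side_angles L = \<theta> ` T" by (intro card_subset_eq) auto
    have "support_value L (\<theta> i) = h i" if i: "i \<in> T" for i
    proof -
      have "\<theta> i \<in> side_angles L" using eqT i by blast
      then obtain j where "j \<in> T" "\<theta> i = \<theta> j" "support_value L (\<theta> i) = h j" using key by blast
      then show ?thesis using inj\<theta>T i by (auto simp: inj_on_def)
    qed
    then have "{q. \<forall>t\<in>side_angles L. uvec t \<bullet> q \<le> support_value L t} = KT"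
      unfolding eqT by (auto simp: KT_def region_def)
    then show "L = KT" using convex_polygon_eq_halfplanes[OF Lp] by simp
  qed
qed

end
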